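(* Let $n\ge 1$ be an integer and put $k_n=\left\lfloor\frac{(n+3)(n+2)}{6}\right\rfloor$ and $\delta_n=\binom{n+3}{3}-(n+1)k_n$. (a) If $n\not\equiv 2 \pmod 3$ and $n\neq 4$, then a general collection of $k_n$ double points in $\mathbf{P}^n$ imposes independent conditions on cubics. (b) If $n=3p+2$ for some integer $p\ge 0$, then for a general collection of $k_n$ points of $\mathbf{P}^n$ there is a zero-dimensional scheme $\eta\subset\mathbf{P}^n$ of length $\delta_n$, with support disjoint from these points, such that the union of the $k_n$ double points supported at the given points and of $\eta$ imposes independent conditions on cubics.
   Context: The base field $\mathbf{K}$ is algebraically closed of characteristic zero, and $\mathbf{P}^n=\mathbf{P}(V)$ with $\dim V=n+1$; $S^dV^\vee$ is the space of homogeneous polynomials of degree $d$ on $\mathbf{P}^n$. For a point $p\in\mathbf{P}^n$ with homogeneous ideal $m_p$, the double point $p^2$ is the subscheme defined by $m_p^2$; it has length $n+1$, and a hypersurface contains $p^2$ if and only if it is singular at $p$. For a zero-dimensional subscheme $X\subset\mathbf{P}^n$, $I_X(d)\subseteq S^dV^\vee$ is the subspace of degree $d$ forms vanishing on the scheme $X$. One says that $X$ imposes independent conditions on hypersurfaces of degree $d$ (on cubics, for $d=3$) if the codimension of $I_X(d)$ in $S^dV^\vee$ equals $\min\left(\operatorname{length}(X),\binom{n+d}{n}\right)$. "A general collection of points" means that the property holds for all collections in a nonempty Zariski open subset of the space of ordered collections of that many points. *)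

theory Defs
  imports "HOL-Library.Poly_Mapping" "HOL-Computational_Algebra.Polynomial"
begin

section \<open>Polynomials\<close>

text \<open>
  Polynomials with variables indexed by \<open>'v\<close> are finitely supported functions on exponent
  vectors; the ring operations are those of \<^theory>\<open>HOL-Library.Poly_Mapping\<close> (convolution).
\<close>

type_synonym ('v, 'k) mpoly = "('v \<Rightarrow>\<^sub>0 nat) \<Rightarrow>\<^sub>0 'k"

definition mpoly_scale :: "'k::field \<Rightarrow> ('v, 'k) mpoly \<Rightarrow> ('v, 'k) mpoly" where
  "mpoly_scale c f = Poly_Mapping.single 0 c * f"

global_interpretation mpoly: vector_space "mpoly_scale :: 'k::field \<Rightarrow> ('v, 'k) mpoly \<Rightarrow> _"
  by unfold_locales
    (simp_all add: mpoly_scale_def algebra_simps single_add mult_single flip: mult.assoc)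

definition mpoly_eval :: "('v, 'k::field) mpoly \<Rightarrow> ('v \<Rightarrow> 'k) \<Rightarrow> 'k" where
  "mpoly_eval f v =
     (\<Sum>m\<in>Poly_Mapping.keys f. Poly_Mapping.lookup f m *
        (\<Prod>x\<in>Poly_Mapping.keys m. v x ^ Poly_Mapping.lookup m x))"

definition monom_degree :: "('v \<Rightarrow>\<^sub>0 nat) \<Rightarrow> nat" where
  "monom_degree m = (\<Sum>x\<in>Poly_Mapping.keys m. Poly_Mapping.lookup m x)"

text \<open>The coordinate ring \<open>K[x\<^sub>0, \<dots>, x\<^sub>n]\<close> of \<open>P\<^sup>n\<close>, and its graded pieces \<open>S\<^sup>dV\<^sup>\<or>\<close>.\<close>

definition coord_ring :: "nat \<Rightarrow> (nat, 'k::field) mpoly set" where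
  "coord_ring n = {f. \<forall>m\<in>Poly_Mapping.keys f. Poly_Mapping.keys m \<subseteq> {..n}}"

definition forms :: "nat \<Rightarrow> nat \<Rightarrow> (nat, 'k::field) mpoly set" where
  "forms n d = {f \<in> coord_ring n. \<forall>m\<in>Poly_Mapping.keys f. monom_degree m = d}"

definition hom_component :: "nat \<Rightarrow> (nat, 'k::field) mpoly \<Rightarrow> (nat, 'k) mpoly" where
  "hom_component d f =
     (\<Sum>m \<in> {m \<in> Poly_Mapping.keys f. monom_degree m = d}.
        Poly_Mapping.single m (Poly_Mapping.lookup f m))"


section \<open>Projective space\<close>

text \<open>
  Vectors of \<open>V = K\<^sup>n\<^sup>+\<^sup>1\<close> are functions vanishing beyond the index \<open>n\<close>, and \<open>P\<^sup>n = P(V)\<close>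
  is the set of one-dimensional subspaces of \<open>V\<close>. A form vanishes at a point iff it vanishes on
  all vectors of the line.
\<close>

type_synonym 'k point = "(nat \<Rightarrow> 'k) set"

definition proj_space :: "nat \<Rightarrow> 'k::field point set" where
  "proj_space n =
     {{(\<lambda>i. c * v i) | c. True} | v. (\<forall>i>n. v i = 0) \<and> (\<exists>i\<le>n. v i \<noteq> 0)}"

text \<open>The space \<open>(P\<^sup>n)\<^sup>k\<close> of ordered collections of \<open>k\<close> points.\<close>

definition collections :: "nat \<Rightarrow> nat \<Rightarrow> 'k::field point list set" where
  "collections n k = {ps. length ps = k \<and> set ps \<subseteq> proj_space n}"

text \<open>
  Zariski topology of \<open>(P\<^sup>n)\<^sup>k\<close>: the variable \<open>(i, j)\<close> is the \<open>j\<close>-th homogeneous coordinate of the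
  \<open>i\<close>-th point, and closed sets are the common zeros of polynomials that are homogeneous
  separately in each of the \<open>k\<close> groups of variables.
\<close>

definition multiforms :: "nat \<Rightarrow> nat \<Rightarrow> (nat \<times> nat, 'k::field) mpoly set" where
  "multiforms n k =
     {f. (\<forall>m\<in>Poly_Mapping.keys f. Poly_Mapping.keys m \<subseteq> {..<k} \<times> {..n}) \<and>
         (\<exists>d. \<forall>m\<in>Poly_Mapping.keys f. \<forall>i<k. (\<Sum>j\<le>n. Poly_Mapping.lookup m (i, j)) = d i)}"

definition zero_locus ::
  "nat \<Rightarrow> nat \<Rightarrow> (nat \<times> nat, 'k::field) mpoly set \<Rightarrow> 'k point list set" where
  "zero_locus n k F =
     {ps \<in> collections n k.
        \<forall>f\<in>F. \<forall>v. (\<forall>i<k. v i \<in> ps ! i) \<longrightarrow> mpoly_eval f (\<lambda>(i, j). v i j) = 0}"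

definition zariski_open :: "nat \<Rightarrow> nat \<Rightarrow> 'k::field point list set \<Rightarrow> bool" where
  "zariski_open n k U \<longleftrightarrow> (\<exists>F \<subseteq> multiforms n k. U = collections n k - zero_locus n k F)"

definition general_collection :: "nat \<Rightarrow> nat \<Rightarrow> ('k::field point list \<Rightarrow> bool) \<Rightarrow> bool" where
  "general_collection n k P \<longleftrightarrow> (\<exists>U. zariski_open n k U \<and> U \<noteq> {} \<and> (\<forall>ps\<in>U. P ps))"


section \<open>Closed subschemes of projective space\<close>

definition homogeneous_ideal :: "nat \<Rightarrow> (nat, 'k::field) mpoly set \<Rightarrow> bool" where
  "homogeneous_ideal n I \<longleftrightarrow>
     I \<subseteq> coord_ring n \<and> 0 \<in> I \<and> (\<forall>f\<in>I. \<forall>g\<in>I. f + g \<in> I) \<and>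
     (\<forall>f\<in>I. \<forall>r\<in>coord_ring n. r * f \<in> I) \<and> (\<forall>f\<in>I. \<forall>d. hom_component d f \<in> I)"

text \<open>Saturation with respect to the irrelevant ideal \<open>(x\<^sub>0, \<dots>, x\<^sub>n)\<close>.\<close>

definition saturation :: "nat \<Rightarrow> (nat, 'k::field) mpoly set \<Rightarrow> (nat, 'k) mpoly set" where
  "saturation n I = {f \<in> coord_ring n. \<exists>N. \<forall>g\<in>forms n N. g * f \<in> I}"

text \<open>
  Closed subschemes of \<open>P\<^sup>n\<close> correspond bijectively to saturated homogeneous ideals, and are
  represented by them. The subscheme defined by a homogeneous ideal \<open>I\<close> is \<open>saturation n I\<close>, the
  forms vanishing on a subscheme are those in its saturated ideal, and the union of subschemes is
  the intersection of their ideals.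
\<close>

definition closed_subscheme :: "nat \<Rightarrow> (nat, 'k::field) mpoly set \<Rightarrow> bool" where
  "closed_subscheme n X \<longleftrightarrow> homogeneous_ideal n X \<and> saturation n X = X"

definition vanishing_forms ::
  "nat \<Rightarrow> (nat, 'k::field) mpoly set \<Rightarrow> nat \<Rightarrow> (nat, 'k) mpoly set" where
  "vanishing_forms n X d = X \<inter> forms n d"

definition scheme_support :: "nat \<Rightarrow> (nat, 'k::field) mpoly set \<Rightarrow> 'k point set" where
  "scheme_support n X = {p \<in> proj_space n. \<forall>f\<in>X. \<forall>v\<in>p. mpoly_eval f v = 0}"

text \<open>A closed subscheme is zero-dimensional (or empty) iff it has finitely many points.\<close>

definition zero_dimensional :: "nat \<Rightarrow> (nat, 'k::field) mpoly set \<Rightarrow> bool" where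
  "zero_dimensional n X \<longleftrightarrow> closed_subscheme n X \<and> finite (scheme_support n X)"

text \<open>The codimension of \<open>I\<^sub>X(d)\<close> in \<open>S\<^sup>dV\<^sup>\<or>\<close>; as \<open>I\<^sub>X(d) \<subseteq> S\<^sup>dV\<^sup>\<or>\<close>, the subtraction does not truncate.\<close>

definition codim_forms :: "nat \<Rightarrow> (nat, 'k::field) mpoly set \<Rightarrow> nat \<Rightarrow> nat" where
  "codim_forms n X d =
     mpoly.dim (forms n d :: (nat, 'k) mpoly set) - mpoly.dim (vanishing_forms n X d)"

text \<open>
  The length of a zero-dimensional \<open>X\<close> is its (constant) Hilbert polynomial: for large \<open>d\<close>, the
  space \<open>S\<^sup>dV\<^sup>\<or> / I\<^sub>X(d)\<close> is \<open>H\<^sup>0(X, O\<^sub>X(d)) \<cong> H\<^sup>0(X, O\<^sub>X)\<close>.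
\<close>

definition scheme_length :: "nat \<Rightarrow> (nat, 'k::field) mpoly set \<Rightarrow> nat" where
  "scheme_length n X = (THE l. \<exists>d\<^sub>0. \<forall>d\<ge>d\<^sub>0. codim_forms n X d = l)"

definition imposes_independent_conditions ::
  "nat \<Rightarrow> (nat, 'k::field) mpoly set \<Rightarrow> nat \<Rightarrow> bool" where
  "imposes_independent_conditions n X d \<longleftrightarrow>
     codim_forms n X d = min (scheme_length n X) ((n + d) choose n)"


section \<open>Double points\<close>

text \<open>
  The homogeneous ideal \<open>m\<^sub>p\<close>: polynomials vanishing on the whole line \<open>p\<close>. Over an infinite field
  this is the same as all homogeneous components vanishing at \<open>p\<close>.
\<close>

definition point_ideal :: "nat \<Rightarrow> 'k::field point \<Rightarrow> (nat, 'k) mpoly set" where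
  "point_ideal n p = {f \<in> coord_ring n. \<forall>v\<in>p. mpoly_eval f v = 0}"

text \<open>The square of an ideal is already the \<open>K\<close>-linear span of the products.\<close>

definition ideal_square :: "(nat, 'k::field) mpoly set \<Rightarrow> (nat, 'k) mpoly set" where
  "ideal_square I = mpoly.span {f * g | f g. f \<in> I \<and> g \<in> I}"

definition double_point :: "nat \<Rightarrow> 'k::field point \<Rightarrow> (nat, 'k) mpoly set" where
  "double_point n p = saturation n (ideal_square (point_ideal n p))"

definition double_points :: "nat \<Rightarrow> 'k::field point list \<Rightarrow> (nat, 'k) mpoly set" where
  "double_points n ps = coord_ring n \<inter> (\<Inter>p\<in>set ps. double_point n p)"


section \<open>The numerical invariants\<close>

definition k_num :: "nat \<Rightarrow> nat" where
  "k_num n = ((n + 3) * (n + 2)) div 6"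

text \<open>As \<open>6 * (n + 1) * k_num n \<le> (n + 3) * (n + 2) * (n + 1)\<close>, the subtraction does not truncate.\<close>

definition delta_num :: "nat \<Rightarrow> nat" where
  "delta_num n = ((n + 3) choose 3) - (n + 1) * k_num n"

end

theory Submission
  imports Defs
begin

text \<open>
  A cubic form is a symmetric tensor \<open>c\<close>, and it is singular at \<open>v\<close> iff \<open>c(v, v, \<cdot>) = 0\<close>. The theorem
  amounts to finding \<open>k\<^sub>n\<close> vectors, together with \<open>\<delta>\<^sub>n\<close> further ones at which the cubic is only
  required to vanish, such that no nonzero cubic satisfies all these linear conditions: there are exactly
  as many conditions as cubic monomials, so they are then independent, and \<open>\<eta>\<close> can be taken to be a
  set of \<open>\<delta>\<^sub>n\<close> reduced points, the same for all collections in the open set.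

  The vectors are found by the induction of Brambilla and Ottaviani. Degenerate \<open>k\<^sub>n\<^sub>-\<^sub>3\<close> of the points to a
  coordinate subspace \<open>L\<close> of codimension three; by induction the cubic vanishes on \<open>L\<close>. Such
  cubics are treated in the same way with a second subspace \<open>M\<close>, then cubics containing \<open>L \<union> M\<close>
  with a third subspace, this time of codimension two, and what is left is a fixed finite problem. At each
  step two open conditions on the same points have to be met simultaneously; it suffices to
  move along a line in the space of configurations. The exception \<open>n = 4\<close> makes it necessary to start one of
  the three residue classes at \<open>n = 7\<close>. The starting points of the inductions are explicit sparse integer
  configurations.
\<close>

section \<open>Symmetric tensors and cubic hypersurfaces\<close>

text \<open>Every level of the degeneration is a square system, so injectivity is enough. With
  \<open>N = n + 1\<close> coordinates, \<open>k_n - k_{n-3} = N\<close>: codimension three leaves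
  the remainder of \<open>(n + 3) * (n + 2)\<close> modulo 6 unchanged. On cubics that contain a
  coordinate subspace of codimension \<open>e\<close>, a double point on it imposes only its
  \<open>e\<close> normal derivatives; these are the second use of the points moved into the
  subspace. Codimension one would not do for the third subspace. The residue would be a bilinear
  form \<open>B\<close> on two three-dimensional spaces, and one point on each of \<open>L\<close>
  and \<open>M\<close> would impose \<open>B y = 0\<close> and \<open>x B = 0\<close>, which share
  the equation \<open>x B y = 0\<close>. Codimension two separates these equations. The exception is
  genuine: for \<open>n = 4\<close>, seven general points lie on a rational normal quartic, whose
  secant variety is a cubic singular along the curve, although 35 conditions meet 35
  coefficients.\<close>

type_synonym 'k tensor = "nat \<Rightarrow> nat \<Rightarrow> nat \<Rightarrow> 'k"

definition symmetric_tensor :: "'k tensor \<Rightarrow> bool" where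
  "symmetric_tensor c \<longleftrightarrow> (\<forall>a b d. c a b d = c b a d \<and> c a b d = c a d b)"

definition vanishes_on :: "nat set \<Rightarrow> 'k::zero tensor \<Rightarrow> bool" where
  "vanishes_on A c \<longleftrightarrow> (\<forall>a\<in>A. \<forall>b\<in>A. \<forall>d\<in>A. c a b d = 0)"

definition grad :: "nat set \<Rightarrow> 'k::field tensor \<Rightarrow> (nat \<Rightarrow> 'k) \<Rightarrow> nat \<Rightarrow> 'k" where
  "grad I c v j = (\<Sum>a\<in>I. \<Sum>b\<in>I. c a b j * v a * v b)"

definition cubic_value :: "nat set \<Rightarrow> 'k::field tensor \<Rightarrow> (nat \<Rightarrow> 'k) \<Rightarrow> 'k" where
  "cubic_value I c v = (\<Sum>j\<in>I. grad I c v j * v j)"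

text \<open>
  Below, \<open>\<Z>\<close> consists of the index sets of the coordinate subspaces that the cubic has to contain, \<open>D\<close>
  and \<open>S\<close> are the labels of the points where it has to be singular and to vanish, respectively, and
  \<open>s\<close> prescribes a coordinate subspace for each point. Up to the factor 3, \<open>grad\<close> is the gradient of the
  cubic form.
\<close>

definition rigid ::
  "nat set \<Rightarrow> nat set set \<Rightarrow> 'l set \<Rightarrow> 'l set \<Rightarrow> ('l \<Rightarrow> nat \<Rightarrow> 'k::field) \<Rightarrow> bool" where
  "rigid I \<Z> D S u \<longleftrightarrow>
     (\<forall>c. symmetric_tensor c \<longrightarrow> (\<forall>A\<in>\<Z>. vanishes_on A c) \<longrightarrow>
          (\<forall>l\<in>D. \<forall>j\<in>I. grad I c (u l) j = 0) \<longrightarrow> (\<forall>l\<in>S. cubic_value I c (u l) = 0) \<longrightarrow>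
          vanishes_on I c)"

definition realizable ::
  "'k::field itself \<Rightarrow> nat set \<Rightarrow> nat set set \<Rightarrow> 'l set \<Rightarrow> 'l set \<Rightarrow> ('l \<Rightarrow> nat set) \<Rightarrow> bool" where
  "realizable _ I \<Z> D S s \<longleftrightarrow>
     (\<exists>u :: 'l \<Rightarrow> nat \<Rightarrow> 'k. (\<forall>l\<in>D \<union> S. \<forall>a. a \<notin> s l \<longrightarrow> u l a = 0) \<and> rigid I \<Z> D S u)"

lemma grad_restrict:
  assumes "finite I" "J \<subseteq> I" "\<And>a. a \<notin> J \<Longrightarrow> v a = 0"
  shows "grad I c v j = grad J c v j"
proof -
  have "(\<Sum>b\<in>I. c a b j * v a * v b) = (\<Sum>b\<in>J. c a b j * v a * v b)" for a
    using assms by (intro sum.mono_neutral_right) auto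
  then have "grad I c v j = (\<Sum>a\<in>I. \<Sum>b\<in>J. c a b j * v a * v b)"
    by (simp add: grad_def)
  also have "\<dots> = grad J c v j"
    unfolding grad_def using assms by (intro sum.mono_neutral_right) auto
  finally show ?thesis .
qed

lemma cubic_value_restrict:
  assumes "finite I" "J \<subseteq> I" "\<And>a. a \<notin> J \<Longrightarrow> v a = 0"
  shows "cubic_value I c v = cubic_value J c v"
proof -
  have "cubic_value I c v = (\<Sum>j\<in>I. grad J c v j * v j)"
    by (simp add: cubic_value_def grad_restrict[OF assms])
  also have "\<dots> = cubic_value J c v"
    unfolding cubic_value_def using assms by (intro sum.mono_neutral_right) auto
  finally show ?thesis .
qed

text \<open>At a point of \<open>J\<close>, the derivatives along \<open>J\<close> see only the
  restriction of the cubic to \<open>J\<close>, which the first problem forces to vanish; the cubic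
  then contains \<open>J\<close>. The sets \<open>D0\<close> and \<open>D1\<close> may overlap: the
  same point serves with tangential derivatives in one problem and with normal ones in the
  other.\<close>

lemma rigid_step:
  assumes "finite I" "J \<subseteq> I"
    and "\<And>l a. l \<in> D0 \<union> S0 \<Longrightarrow> a \<notin> J \<Longrightarrow> u l a = 0"
    and "rigid J ((\<lambda>A. A \<inter> J) ` \<Z>) D0 S0 u" "rigid I (insert J \<Z>) D1 S1 u"
    and "D0 \<union> D1 \<subseteq> D" "S0 \<union> S1 \<subseteq> S"
  shows "rigid I \<Z> D S u"
  unfolding rigid_def
proof (intro allI impI)
  fix c :: "'b tensor"
  assume c: "symmetric_tensor c" "\<forall>A\<in>\<Z>. vanishes_on A c"
    "\<forall>l\<in>D. \<forall>j\<in>I. grad I c (u l) j = 0" "\<forall>l\<in>S. cubic_value I c (u l) = 0"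
  have c0: "\<forall>A\<in>(\<lambda>A. A \<inter> J) ` \<Z>. vanishes_on A c"
    using c(2) by (auto simp: vanishes_on_def)
  have g0: "\<forall>l\<in>D0. \<forall>j\<in>J. grad J c (u l) j = 0"
  proof (intro ballI)
    fix l j assume "l \<in> D0" "j \<in> J"
    moreover from this have "grad I c (u l) j = grad J c (u l) j"
      by (intro grad_restrict[OF assms(1,2)] assms(3)) auto
    moreover from calculation have "l \<in> D" "j \<in> I" using assms(2,6) by auto
    ultimately show "grad J c (u l) j = 0" using c(3) by simp
  qed
  have s0: "\<forall>l\<in>S0. cubic_value J c (u l) = 0"
  proof
    fix l assume "l \<in> S0"
    moreover from this have "cubic_value I c (u l) = cubic_value J c (u l)"
      by (intro cubic_value_restrict[OF assms(1,2)] assms(3)) auto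
    moreover from calculation have "l \<in> S" using assms(7) by auto
    ultimately show "cubic_value J c (u l) = 0" using c(4) by simp
  qed
  have "vanishes_on J c"
    using assms(4)[unfolded rigid_def, rule_format, OF c(1)] c0 g0 s0 by blast
  then have "\<forall>A\<in>insert J \<Z>. vanishes_on A c" using c(2) by blast
  moreover have "\<forall>l\<in>D1. \<forall>j\<in>I. grad I c (u l) j = 0" "\<forall>l\<in>S1. cubic_value I c (u l) = 0"
    using assms(6,7) c(3,4) by auto
  ultimately show "vanishes_on I c"
    using assms(5)[unfolded rigid_def, rule_format, OF c(1)] by blast
qed

section \<open>Openness of injectivity of linear systems\<close>

definition trivial_kernel :: "('p \<Rightarrow> 'r \<Rightarrow> 'k::field) \<Rightarrow> ('i \<Rightarrow> 'r) set \<Rightarrow> 'i set \<Rightarrow> 'p \<Rightarrow> bool" where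
  "trivial_kernel ev R I p \<longleftrightarrow>
     (\<forall>x. (\<forall>q\<in>R. (\<Sum>i\<in>I. ev p (q i) * x i) = 0) \<longrightarrow> (\<forall>i\<in>I. x i = 0))"

text \<open>
  Fraction-free Gaussian elimination: \<open>F\<close> is the product of the pivots chosen at \<open>p\<^sub>0\<close>. The family
  \<open>H\<close> of homogeneous pieces keeps track of the multidegrees of \<open>F\<close> and of the intermediate rows.
\<close>

lemma trivial_kernel_open:
  fixes ev :: "'p \<Rightarrow> 'r::comm_ring_1 \<Rightarrow> 'k::field" and H :: "'r set set"
  assumes mult: "\<And>p a b. ev p (a * b) = ev p a * ev p b"
    and diff: "\<And>p a b. ev p (a - b) = ev p a - ev p b"
    and one: "\<And>p. ev p 1 = 1" "1 \<in> \<Union>H"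
    and H: "\<And>A B. A \<in> H \<Longrightarrow> B \<in> H \<Longrightarrow>
      \<exists>C\<in>H. \<forall>a\<in>A. \<forall>a'\<in>A. \<forall>b\<in>B. \<forall>b'\<in>B. a * b \<in> C \<and> a * b - a' * b' \<in> C"
    and "finite I"
  shows "(\<And>q. q \<in> R \<Longrightarrow> \<exists>A\<in>H. \<forall>i\<in>I. q i \<in> A) \<Longrightarrow> trivial_kernel ev R I p0 \<Longrightarrow>
    \<exists>F\<in>\<Union>H. ev p0 F \<noteq> 0 \<and> (\<forall>p. ev p F \<noteq> 0 \<longrightarrow> trivial_kernel ev R I p)"
  using \<open>finite I\<close>
proof (induction I arbitrary: R rule: finite_induct)
  case empty
  then show ?case using one by (intro bexI[of _ 1]) (auto simp: trivial_kernel_def)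
next
  case (insert i0 I)
  have "\<exists>q0\<in>R. ev p0 (q0 i0) \<noteq> 0"
  proof (rule ccontr)
    assume "\<not> ?thesis"
    moreover define x where "x i = (if i = i0 then 1 else 0 :: 'k)" for i
    ultimately have "\<forall>q\<in>R. (\<Sum>i\<in>insert i0 I. ev p0 (q i) * x i) = 0"
      using insert.hyps by (auto intro!: sum.neutral)
    then show False
      using insert.prems(2) by (auto simp: trivial_kernel_def x_def)
  qed
  then obtain q0 where q0: "q0 \<in> R" "ev p0 (q0 i0) \<noteq> 0" by blast
  \<comment> \<open>Cross-multiplication with the pivot row \<open>q0\<close> removes the unknown
    \<open>i0\<close> without division, so the entries stay in the ring and in homogeneous
    pieces.\<close>
  define R' where "R' = (\<lambda>q i. q i * q0 i0 - q i0 * q0 i) ` R"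
  have sum_R': "(\<Sum>i\<in>I. ev p (q i * q0 i0 - q i0 * q0 i) * x i) =
      ev p (q0 i0) * (\<Sum>i\<in>I. ev p (q i) * x i) - ev p (q i0) * (\<Sum>i\<in>I. ev p (q0 i) * x i)" for p q x
    by (simp add: mult diff algebra_simps sum_subtractf sum_distrib_left)
  have H': "\<exists>A\<in>H. \<forall>i\<in>I. q i \<in> A" if "q \<in> R'" for q
  proof -
    from that obtain q1 where q1: "q1 \<in> R" "q = (\<lambda>i. q1 i * q0 i0 - q1 i0 * q0 i)"
      by (auto simp: R'_def)
    obtain A B where AB: "A \<in> H" "\<forall>i\<in>insert i0 I. q1 i \<in> A" "B \<in> H" "\<forall>i\<in>insert i0 I. q0 i \<in> B"
      using insert.prems(1)[OF q1(1)] insert.prems(1)[OF q0(1)] by blast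
    obtain C where C: "C \<in> H" "\<forall>a\<in>A. \<forall>a'\<in>A. \<forall>b\<in>B. \<forall>b'\<in>B. a * b - a' * b' \<in> C"
      using H[OF AB(1,3)] by blast
    have "\<forall>i\<in>I. q i \<in> C" unfolding q1(2) using AB(2,4) C(2) by simp
    then show ?thesis using C(1) by blast
  qed
  have "trivial_kernel ev R' I p0"
    unfolding trivial_kernel_def
  proof (intro allI impI)
    fix x assume x: "\<forall>q\<in>R'. (\<Sum>i\<in>I. ev p0 (q i) * x i) = 0"
    define y where "y = x(i0 := - (\<Sum>i\<in>I. ev p0 (q0 i) * x i) / ev p0 (q0 i0))"
    have y: "(\<Sum>i\<in>insert i0 I. ev p0 (q i) * y i) = ev p0 (q i0) * y i0 + (\<Sum>i\<in>I. ev p0 (q i) * x i)"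
      for q using insert.hyps by (auto simp: y_def intro!: sum.cong)
    have "(\<Sum>i\<in>insert i0 I. ev p0 (q i) * y i) = 0" if "q \<in> R" for q
    proof -
      have "ev p0 (q0 i0) * (\<Sum>i\<in>I. ev p0 (q i) * x i) - ev p0 (q i0) * (\<Sum>i\<in>I. ev p0 (q0 i) * x i) = 0"
        using x that unfolding R'_def ball_simps sum_R' by blast
      then show ?thesis using q0(2) unfolding y by (simp add: y_def field_simps)
    qed
    then have "\<forall>i\<in>insert i0 I. y i = 0"
      using insert.prems(2) by (simp only: trivial_kernel_def) blast
    then show "\<forall>i\<in>I. x i = 0"
      using insert.hyps by (auto simp: y_def split: if_splits)
  qed
  then obtain F where F: "F \<in> \<Union>H" "ev p0 F \<noteq> 0" "\<And>p. ev p F \<noteq> 0 \<Longrightarrow> trivial_kernel ev R' I p"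
    using insert.IH[of R'] H' by blast
  show ?case
  proof (intro bexI conjI allI impI)
    obtain A B where "A \<in> H" "F \<in> A" "B \<in> H" "q0 i0 \<in> B"
      using F(1) insert.prems(1)[OF q0(1)] by blast
    then show "F * q0 i0 \<in> \<Union>H" using H[of A B] by blast
    show "ev p0 (F * q0 i0) \<noteq> 0" using F(2) q0(2) by (simp add: mult)
    fix p assume "ev p (F * q0 i0) \<noteq> 0"
    then have p: "ev p F \<noteq> 0" "ev p (q0 i0) \<noteq> 0" by (auto simp: mult)
    show "trivial_kernel ev R (insert i0 I) p"
      unfolding trivial_kernel_def
    proof (intro allI impI)
      fix x assume x: "\<forall>q\<in>R. (\<Sum>i\<in>insert i0 I. ev p (q i) * x i) = 0"
      then have eq: "(\<Sum>i\<in>I. ev p (q i) * x i) = - ev p (q i0) * x i0" if "q \<in> R" for q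
        using that insert.hyps by (simp add: add_eq_0_iff)
      have "\<forall>q\<in>R'. (\<Sum>i\<in>I. ev p (q i) * x i) = 0"
        using q0(1) by (auto simp: R'_def sum_R' eq)
      then have "\<forall>i\<in>I. x i = 0" using F(3)[OF p(1)] by (auto simp: trivial_kernel_def)
      moreover from this have "x i0 = 0" using eq[OF q0(1)] p(2) by simp
      ultimately show "\<forall>i\<in>insert i0 I. x i = 0" by simp
    qed
  qed
qed


section \<open>Rigidity as a linear system over a ring of parameters\<close>

definition monomial_row :: "'i \<Rightarrow> 'i \<Rightarrow> 'r::zero_neq_one" where
  "monomial_row t = (\<lambda>t'. if t' = t then 1 else 0)"

text \<open>The unknowns are indexed by all triples from \<open>I\<close>, so symmetry needs rows of
  its own. The coordinates \<open>L\<close> live in a ring that \<open>ev\<close> specialises: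
  polynomials in one parameter for a line of configurations, multigraded polynomials for the space
  of collections.\<close>

definition rigid_rows ::
  "nat set \<Rightarrow> nat set set \<Rightarrow> 'l set \<Rightarrow> 'l set \<Rightarrow> ('l \<Rightarrow> nat \<Rightarrow> 'r::comm_ring_1) \<Rightarrow> (nat \<times> nat \<times> nat \<Rightarrow> 'r) set" where
  "rigid_rows I \<Z> D S L =
     {\<lambda>(a, b, d). if d = j then L l a * L l b else 0 | l j. l \<in> D \<and> j \<in> I} \<union>
     {\<lambda>(a, b, d). L l a * L l b * L l d | l. l \<in> S} \<union>
     {monomial_row (a, b, d) | a b d A. A \<in> \<Z> \<and> {a, b, d} \<subseteq> A \<inter> I} \<union>
     {\<lambda>t. monomial_row (a, b, d) t - monomial_row t' t | a b d t'.
        {a, b, d} \<subseteq> I \<and> t' \<in> {(b, a, d), (a, d, b)}}"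

lemma rigid_iff_trivial_kernel:
  fixes ev :: "'p \<Rightarrow> 'r::comm_ring_1 \<Rightarrow> 'k::field"
  assumes mult: "\<And>a b. ev p (a * b) = ev p a * ev p b"
    and diff: "\<And>a b. ev p (a - b) = ev p a - ev p b"
    and one: "ev p 1 = 1"
    and I: "finite I"
  shows "rigid I \<Z> D S (\<lambda>l a. ev p (L l a)) \<longleftrightarrow>
    trivial_kernel ev (rigid_rows I \<Z> D S L) (I \<times> I \<times> I) p"
proof -
  have zero: "ev p 0 = 0" using diff[of 0 0] by simp
  define val where "val q x = (\<Sum>i\<in>I \<times> I \<times> I. ev p (q i) * x i)" for q x
  have mono: "val (monomial_row t) x = x t" if "t \<in> I \<times> I \<times> I" for t x
  proof -
    have "val (monomial_row t) x = (\<Sum>i\<in>I \<times> I \<times> I. if i = t then x i else 0)"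
      unfolding val_def by (intro sum.cong) (auto simp: monomial_row_def one zero)
    then show ?thesis using that I by simp
  qed
  have val_diff: "val (\<lambda>t. q t - q' t) x = val q x - val q' x" for q q' x
    by (simp add: val_def diff left_diff_distrib sum_subtractf)
  have gradr: "val (\<lambda>(a, b, d). if d = j then L l a * L l b else 0) x =
      grad I (\<lambda>a b d. x (a, b, d)) (\<lambda>a. ev p (L l a)) j" if "j \<in> I" for j l x
  proof -
    have "val (\<lambda>(a, b, d). if d = j then L l a * L l b else 0) x =
      (\<Sum>a\<in>I. \<Sum>b\<in>I. \<Sum>d\<in>I. if d = j then ev p (L l a) * ev p (L l b) * x (a, b, d) else 0)"
      unfolding val_def sum.cartesian_product
      by (intro sum.cong) (auto simp: mult zero)
    then show ?thesis using that I by (simp add: grad_def mult_ac)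
  qed
  have cubr: "val (\<lambda>(a, b, d). L l a * L l b * L l d) x =
      cubic_value I (\<lambda>a b d. x (a, b, d)) (\<lambda>a. ev p (L l a))" for l x
  proof -
    have "val (\<lambda>(a, b, d). L l a * L l b * L l d) x =
      (\<Sum>a\<in>I. \<Sum>b\<in>I. \<Sum>d\<in>I. ev p (L l a) * ev p (L l b) * ev p (L l d) * x (a, b, d))"
      unfolding val_def sum.cartesian_product
      by (intro sum.cong) (auto simp: mult)
    also have "\<dots> = (\<Sum>a\<in>I. \<Sum>d\<in>I. \<Sum>b\<in>I. ev p (L l a) * ev p (L l b) * ev p (L l d) * x (a, b, d))"
      by (intro sum.cong refl sum.swap)
    also have "\<dots> = (\<Sum>d\<in>I. \<Sum>a\<in>I. \<Sum>b\<in>I. ev p (L l a) * ev p (L l b) * ev p (L l d) * x (a, b, d))"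
      by (rule sum.swap)
    finally show ?thesis
      by (simp add: cubic_value_def grad_def sum_distrib_left sum_distrib_right mult_ac)
  qed
  have rows: "(\<forall>q\<in>rigid_rows I \<Z> D S L. val q x = 0) \<longleftrightarrow>
      (\<forall>l\<in>D. \<forall>j\<in>I. grad I (\<lambda>a b d. x (a, b, d)) (\<lambda>a. ev p (L l a)) j = 0) \<and>
      (\<forall>l\<in>S. cubic_value I (\<lambda>a b d. x (a, b, d)) (\<lambda>a. ev p (L l a)) = 0) \<and>
      (\<forall>A\<in>\<Z>. \<forall>a\<in>A \<inter> I. \<forall>b\<in>A \<inter> I. \<forall>d\<in>A \<inter> I. x (a, b, d) = 0) \<and>
      (\<forall>a\<in>I. \<forall>b\<in>I. \<forall>d\<in>I. x (a, b, d) = x (b, a, d) \<and> x (a, b, d) = x (a, d, b))"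
    (is "?l \<longleftrightarrow> ?r") for x
  proof
    assume l: ?l
    have g: "grad I (\<lambda>a b d. x (a, b, d)) (\<lambda>a. ev p (L l a)) j = 0" if "l \<in> D" "j \<in> I" for l j
    proof -
      have "(\<lambda>(a, b, d). if d = j then L l a * L l b else 0) \<in> rigid_rows I \<Z> D S L"
        unfolding rigid_rows_def using that by blast
      then show ?thesis using bspec[OF l] gradr[OF that(2)] by metis
    qed
    have c: "cubic_value I (\<lambda>a b d. x (a, b, d)) (\<lambda>a. ev p (L l a)) = 0" if "l \<in> S" for l
    proof -
      have "(\<lambda>(a, b, d). L l a * L l b * L l d) \<in> rigid_rows I \<Z> D S L"
        unfolding rigid_rows_def using that by blast
      then show ?thesis using bspec[OF l] cubr by metis
    qed
    have v: "x (a, b, d) = 0" if "A \<in> \<Z>" "a \<in> A \<inter> I" "b \<in> A \<inter> I" "d \<in> A \<inter> I" for A a b d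
    proof -
      have "monomial_row (a, b, d) \<in> rigid_rows I \<Z> D S L"
        unfolding rigid_rows_def using that by blast
      then have "val (monomial_row (a, b, d)) x = 0" using l by blast
      then show ?thesis using mono[of "(a, b, d)" x] that by simp
    qed
    have s: "x (a, b, d) = x t'"
      if "a \<in> I" "b \<in> I" "d \<in> I" "t' \<in> {(b, a, d), (a, d, b)}" for a b d t'
    proof -
      have "(\<lambda>t. monomial_row (a, b, d) t - monomial_row t' t) \<in> rigid_rows I \<Z> D S L"
        unfolding rigid_rows_def using that by blast
      then have "val (monomial_row (a, b, d)) x - val (monomial_row t') x = 0"
        unfolding val_diff[symmetric] by (rule bspec[OF l])
      then show ?thesis using that by (auto simp: mono)
    qed
    show ?r
    proof (intro conjI)
      show "\<forall>l\<in>D. \<forall>j\<in>I. grad I (\<lambda>a b d. x (a, b, d)) (\<lambda>a. ev p (L l a)) j = 0"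
        using g by blast
      show "\<forall>l\<in>S. cubic_value I (\<lambda>a b d. x (a, b, d)) (\<lambda>a. ev p (L l a)) = 0"
        using c by blast
      show "\<forall>A\<in>\<Z>. \<forall>a\<in>A \<inter> I. \<forall>b\<in>A \<inter> I. \<forall>d\<in>A \<inter> I. x (a, b, d) = 0"
        using v by blast
      show "\<forall>a\<in>I. \<forall>b\<in>I. \<forall>d\<in>I. x (a, b, d) = x (b, a, d) \<and> x (a, b, d) = x (a, d, b)"
      proof (intro ballI)
        fix a b d assume "a \<in> I" "b \<in> I" "d \<in> I"
        then show "x (a, b, d) = x (b, a, d) \<and> x (a, b, d) = x (a, d, b)"
          using s[of a b d "(b, a, d)"] s[of a b d "(a, d, b)"] by simp
      qed
    qed
  next
    assume r: ?r
    have "rigid_rows I \<Z> D S L \<subseteq> {q. val q x = 0}"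
      unfolding rigid_rows_def
    proof (intro Un_least subsetI CollectI; elim CollectE exE conjE)
      fix q l j assume "q = (\<lambda>(a, b, d). if d = j then L l a * L l b else 0)" "l \<in> D" "j \<in> I"
      then show "val q x = 0" using r gradr by simp
    next
      fix q l assume "q = (\<lambda>(a, b, d). L l a * L l b * L l d)" "l \<in> S"
      then show "val q x = 0" using r cubr by simp
    next
      fix q :: "nat \<times> nat \<times> nat \<Rightarrow> 'r" and a b d A
      assume "q = monomial_row (a, b, d)" "A \<in> \<Z>" "{a, b, d} \<subseteq> A \<inter> I"
      then show "val q x = 0" using r mono by auto
    next
      fix q :: "nat \<times> nat \<times> nat \<Rightarrow> 'r" and a b d t'
      assume "q = (\<lambda>t. monomial_row (a, b, d) t - monomial_row t' t)"
        "{a, b, d} \<subseteq> I" "t' \<in> {(b, a, d), (a, d, b)}"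
      then show "val q x = 0" using r mono by (auto simp: val_diff)
    qed
    then show ?l by blast
  qed
  show ?thesis
  proof
    assume rig: "rigid I \<Z> D S (\<lambda>l a. ev p (L l a))"
    show "trivial_kernel ev (rigid_rows I \<Z> D S L) (I \<times> I \<times> I) p"
      unfolding trivial_kernel_def val_def[symmetric] rows
    proof (intro allI impI)
      fix x assume x: "(\<forall>l\<in>D. \<forall>j\<in>I. grad I (\<lambda>a b d. x (a, b, d)) (\<lambda>a. ev p (L l a)) j = 0) \<and>
        (\<forall>l\<in>S. cubic_value I (\<lambda>a b d. x (a, b, d)) (\<lambda>a. ev p (L l a)) = 0) \<and>
        (\<forall>A\<in>\<Z>. \<forall>a\<in>A \<inter> I. \<forall>b\<in>A \<inter> I. \<forall>d\<in>A \<inter> I. x (a, b, d) = 0) \<and>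
        (\<forall>a\<in>I. \<forall>b\<in>I. \<forall>d\<in>I. x (a, b, d) = x (b, a, d) \<and> x (a, b, d) = x (a, d, b))"
      \<comment> \<open>\<open>rigid\<close> quantifies over tensors that are symmetric at all
        indices, so the solution is extended by zero outside \<open>I\<close>.\<close>
      define c where "c a b d = (if {a, b, d} \<subseteq> I then x (a, b, d) else 0)" for a b d
      note x1 = x[THEN conjunct1] and x2 = x[THEN conjunct2, THEN conjunct1]
        and x3 = x[THEN conjunct2, THEN conjunct2, THEN conjunct1]
        and x4 = x[THEN conjunct2, THEN conjunct2, THEN conjunct2, rule_format]
      have c: "grad I c v j = grad I (\<lambda>a b d. x (a, b, d)) v j" if "j \<in> I" for v j
        using that unfolding grad_def c_def by (intro sum.cong) auto
      have c': "cubic_value I c v = cubic_value I (\<lambda>a b d. x (a, b, d)) v" for v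
        unfolding cubic_value_def by (intro sum.cong) (simp_all only: c)
      have "c a b d = c b a d \<and> c a b d = c a d b" for a b d
      proof (cases "{a, b, d} \<subseteq> I")
        case True
        then have "c a b d = x (a, b, d)" "c b a d = x (b, a, d)" "c a d b = x (a, d, b)"
          by (auto simp: c_def)
        moreover have "x (a, b, d) = x (b, a, d) \<and> x (a, b, d) = x (a, d, b)"
          by (rule x4) (use True in auto)
        ultimately show ?thesis by metis
      qed (auto simp: c_def)
      then have "symmetric_tensor c" by (simp add: symmetric_tensor_def)
      moreover have "\<forall>A\<in>\<Z>. vanishes_on A c" using x3 by (auto simp: vanishes_on_def c_def)
      moreover have "\<forall>l\<in>D. \<forall>j\<in>I. grad I c (\<lambda>a. ev p (L l a)) j = 0"
        using x1 c by simp
      moreover have "\<forall>l\<in>S. cubic_value I c (\<lambda>a. ev p (L l a)) = 0"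
        using x2 c' by simp
      ultimately have "vanishes_on I c"
        using rig unfolding rigid_def by blast
      then show "\<forall>i\<in>I \<times> I \<times> I. x i = 0" by (auto simp: vanishes_on_def c_def)
    qed
  next
    assume tk: "trivial_kernel ev (rigid_rows I \<Z> D S L) (I \<times> I \<times> I) p"
    show "rigid I \<Z> D S (\<lambda>l a. ev p (L l a))"
      unfolding rigid_def
    proof (intro allI impI)
      fix c :: "'k tensor"
      assume c: "symmetric_tensor c" "\<forall>A\<in>\<Z>. vanishes_on A c"
        "\<forall>l\<in>D. \<forall>j\<in>I. grad I c (\<lambda>a. ev p (L l a)) j = 0"
        "\<forall>l\<in>S. cubic_value I c (\<lambda>a. ev p (L l a)) = 0"
      have "\<forall>i\<in>I \<times> I \<times> I. (\<lambda>(a, b, d). c a b d) i = 0"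
      proof -
        have "\<forall>q\<in>rigid_rows I \<Z> D S L. val q (\<lambda>(a, b, d). c a b d) = 0"
          unfolding rows prod.case using c(3,4) c(1)[unfolded symmetric_tensor_def]
            c(2)[unfolded vanishes_on_def] by (intro conjI) blast+
        then show ?thesis using tk unfolding trivial_kernel_def val_def by blast
      qed
      then show "vanishes_on I c" by (auto simp: vanishes_on_def)
    qed
  qed
qed

text \<open>The product of the pivots chosen at \<open>t = 0\<close> is a nonzero polynomial in
  \<open>t\<close>, and all bad parameters are among its roots. No grading has to be tracked here,
  hence the single piece \<open>UNIV\<close>.\<close>

lemma rigid_on_line:
  fixes u0 u1 :: "'l \<Rightarrow> nat \<Rightarrow> 'k::field"
  assumes "finite I" "rigid I \<Z> D S u0"
  shows "finite {t. \<not> rigid I \<Z> D S (\<lambda>l a. u0 l a + t * (u1 l a - u0 l a))}"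
proof -
  define L where "L l a = [:u0 l a, u1 l a - u0 l a:]" for l a
  have L: "poly (L l a) t = u0 l a + t * (u1 l a - u0 l a)" for l a t
    by (simp add: L_def)
  define R where "R = rigid_rows I \<Z> D S L"
  have iff: "rigid I \<Z> D S (\<lambda>l a. u0 l a + t * (u1 l a - u0 l a)) \<longleftrightarrow>
      trivial_kernel (\<lambda>t q. poly q t) R (I \<times> I \<times> I) t" for t
    unfolding L[symmetric] R_def by (rule rigid_iff_trivial_kernel) (auto simp: assms)
  have "trivial_kernel (\<lambda>t q. poly q t) R (I \<times> I \<times> I) 0"
    using assms(2) iff[of 0] by simp
  then have "\<exists>F\<in>\<Union>{UNIV}. poly F 0 \<noteq> 0 \<and>
      (\<forall>t. poly F t \<noteq> 0 \<longrightarrow> trivial_kernel (\<lambda>t q. poly q t) R (I \<times> I \<times> I) t)"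
    by (intro trivial_kernel_open) (auto simp: assms)
  then obtain F where F: "poly F 0 \<noteq> 0"
    "\<And>t. poly F t \<noteq> 0 \<Longrightarrow> trivial_kernel (\<lambda>t q. poly q t) R (I \<times> I \<times> I) t" by blast
  have "finite {t. poly F t = 0}" using F(1) by (intro poly_roots_finite) auto
  then show ?thesis by (rule finite_subset[rotated]) (use F(2) iff in blast)
qed

lemma rigid_cong:
  assumes "\<And>l. l \<in> D \<union> S \<Longrightarrow> u l = u' l"
  shows "rigid I \<Z> D S u \<longleftrightarrow> rigid I \<Z> D S u'"
  using assms unfolding rigid_def by simp

lemma realizable_merge:
  assumes "finite I0" "finite I1"
    and r0: "realizable TYPE('k::field_char_0) I0 \<Z>0 D0 S0 s0"
    and r1: "realizable TYPE('k::field_char_0) I1 \<Z>1 D1 S1 s1"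
    and s0: "\<And>l. l \<in> D0 \<union> S0 \<Longrightarrow> s0 l \<subseteq> s l" and s1: "\<And>l. l \<in> D1 \<union> S1 \<Longrightarrow> s1 l \<subseteq> s l"
  obtains u :: "'l \<Rightarrow> nat \<Rightarrow> 'k::field_char_0"
  where "rigid I0 \<Z>0 D0 S0 u" "rigid I1 \<Z>1 D1 S1 u"
    "\<And>l a. l \<in> D0 \<union> S0 \<union> D1 \<union> S1 \<Longrightarrow> a \<notin> s l \<Longrightarrow> u l a = 0"
proof -
  obtain u0 :: "'l \<Rightarrow> nat \<Rightarrow> 'k" where
    u0: "\<And>l a. l \<in> D0 \<union> S0 \<Longrightarrow> a \<notin> s0 l \<Longrightarrow> u0 l a = 0" "rigid I0 \<Z>0 D0 S0 u0"
    using r0 unfolding realizable_def by blast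
  obtain u1 :: "'l \<Rightarrow> nat \<Rightarrow> 'k" where
    u1: "\<And>l a. l \<in> D1 \<union> S1 \<Longrightarrow> a \<notin> s1 l \<Longrightarrow> u1 l a = 0" "rigid I1 \<Z>1 D1 S1 u1"
    using r1 unfolding realizable_def by blast
  \<comment> \<open>A label used by only one problem has the same vector at both ends, so the whole
    line stays in the prescribed subspaces.\<close>
  define v0 where "v0 l = (if l \<in> D0 \<union> S0 then u0 l else u1 l)" for l
  define v1 where "v1 l = (if l \<in> D1 \<union> S1 then u1 l else u0 l)" for l
  have "rigid I0 \<Z>0 D0 S0 v0" "rigid I1 \<Z>1 D1 S1 v1"
    using u0(2) rigid_cong[of D0 S0 v0 u0] u1(2) rigid_cong[of D1 S1 v1 u1]
    by (auto simp: v0_def v1_def)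
  note fin = rigid_on_line[OF assms(1) this(1), of v1] rigid_on_line[OF assms(2) this(2), of v0]
  \<comment> \<open>The second condition is known at the other end of the line, hence the reflection
    \<open>1 - t\<close>.\<close>
  have "finite ({t. \<not> rigid I0 \<Z>0 D0 S0 (\<lambda>l a. v0 l a + t * (v1 l a - v0 l a))} \<union>
    (\<lambda>t. 1 - t) ` {t. \<not> rigid I1 \<Z>1 D1 S1 (\<lambda>l a. v1 l a + t * (v0 l a - v1 l a))})"
    using fin by blast
  then obtain t where t: "t \<notin> {t. \<not> rigid I0 \<Z>0 D0 S0 (\<lambda>l a. v0 l a + t * (v1 l a - v0 l a))} \<union>
    (\<lambda>t. 1 - t) ` {t. \<not> rigid I1 \<Z>1 D1 S1 (\<lambda>l a. v1 l a + t * (v0 l a - v1 l a))}"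
    using ex_new_if_finite[OF infinite_UNIV_char_0[where 'a = 'k]] by blast
  show ?thesis
  proof (rule that)
    show "rigid I0 \<Z>0 D0 S0 (\<lambda>l a. v0 l a + t * (v1 l a - v0 l a))" using t by blast
    have "rigid I1 \<Z>1 D1 S1 (\<lambda>l a. v1 l a + (1 - t) * (v0 l a - v1 l a))"
    proof (rule ccontr)
      assume "\<not> ?thesis"
      then have "1 - (1 - t) \<in> (\<lambda>t. 1 - t) ` {t. \<not> rigid I1 \<Z>1 D1 S1 (\<lambda>l a. v1 l a + t * (v0 l a - v1 l a))}"
        by blast
      then show False using t by simp
    qed
    then show "rigid I1 \<Z>1 D1 S1 (\<lambda>l a. v0 l a + t * (v1 l a - v0 l a))"
      by (simp add: algebra_simps)
    fix l a assume "l \<in> D0 \<union> S0 \<union> D1 \<union> S1" "a \<notin> s l"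
    then show "v0 l a + t * (v1 l a - v0 l a) = 0"
    proof -
      have "l \<in> D0 \<union> S0 \<Longrightarrow> u0 l a = 0" "l \<in> D1 \<union> S1 \<Longrightarrow> u1 l a = 0"
        using u0(1)[of l a] u1(1)[of l a] s0[of l] s1[of l] \<open>a \<notin> s l\<close> by blast+
      then show ?thesis
        using \<open>l \<in> D0 \<union> S0 \<union> D1 \<union> S1\<close> by (auto simp: v0_def v1_def)
    qed
  qed
qed

text \<open>
  The degeneration step: part of the points is moved into the coordinate subspace with index set
  \<open>J\<close>, where they force the cubic to vanish; what is left is a problem on cubics containing it.
\<close>

lemma realizable_step:
  assumes "finite I" "J \<subseteq> I"
    and r0: "realizable TYPE('k::field_char_0) J ((\<lambda>A. A \<inter> J) ` \<Z>) D0 S0 s0"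
    and r1: "realizable TYPE('k::field_char_0) I (insert J \<Z>) D1 S1 s1"
    and s0: "\<And>l. l \<in> D0 \<union> S0 \<Longrightarrow> s0 l \<subseteq> J \<inter> s l" and s1: "\<And>l. l \<in> D1 \<union> S1 \<Longrightarrow> s1 l \<subseteq> s l"
    and shared: "\<And>l. l \<in> (D0 \<union> S0) \<inter> (D1 \<union> S1) \<Longrightarrow> s1 l \<subseteq> J"
    and D: "D = D0 \<union> D1" and S: "S = S0 \<union> S1"
  shows "realizable TYPE('k::field_char_0) I \<Z> D S s"
proof -
  \<comment> \<open>All labels of the problem on \<open>J\<close> have to stay inside
    \<open>J\<close> after merging, also those that the residual problem uses; \<open>shared\<close>
    makes this possible.\<close>
  define s' where "s' l = (if l \<in> D0 \<union> S0 then J \<inter> s l else s l)" for l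
  have "finite J" using assms(1,2) by (rule rev_finite_subset)
  moreover have "s0 l \<subseteq> s' l" if "l \<in> D0 \<union> S0" for l
    using s0[OF that] that unfolding s'_def by (simp only: if_True)
  moreover have "s1 l \<subseteq> s' l" if "l \<in> D1 \<union> S1" for l
    using s1[OF that] shared[of l] that unfolding s'_def by (cases "l \<in> D0 \<union> S0") auto
  ultimately obtain u :: "'a \<Rightarrow> nat \<Rightarrow> 'k" where u: "rigid J ((\<lambda>A. A \<inter> J) ` \<Z>) D0 S0 u"
    "rigid I (insert J \<Z>) D1 S1 u"
    "\<And>l a. l \<in> D0 \<union> S0 \<union> D1 \<union> S1 \<Longrightarrow> a \<notin> s' l \<Longrightarrow> u l a = 0"
    using realizable_merge[OF _ assms(1) r0 r1, of s'] by metis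
  have "rigid I \<Z> D S u"
    by (rule rigid_step[OF assms(1,2) _ u(1,2)]) (use u(3) in \<open>auto simp: D S s'_def\<close>)
  then show ?thesis
    unfolding realizable_def using u(3) by (intro exI[of _ u]) (auto simp: D S s'_def)
qed

section \<open>Certified elimination for explicit configurations\<close>

text \<open>
  A row lists the nonzero coefficients of a linear form in the entries \<open>c a b d\<close> with
  \<open>a \<le> b \<le> d\<close> of a symmetric tensor.
\<close>

type_synonym row = "((nat \<times> nat \<times> nat) \<times> int) list"

fun entry :: "'k tensor \<Rightarrow> nat \<times> nat \<times> nat \<Rightarrow> 'k" where
  "entry c (a, b, d) = c a b d"

definition row_value :: "'k::field tensor \<Rightarrow> row \<Rightarrow> 'k" where
  "row_value c r = (\<Sum>(t, x)\<leftarrow>r. of_int x * entry c t)"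

fun add_term :: "(nat \<times> nat \<times> nat) \<times> int \<Rightarrow> row \<Rightarrow> row" where
  "add_term (t, x) [] = [(t, x)]"
| "add_term (t, x) ((t', y) # r) =
    (if t = t' then (if x + y = 0 then r else (t, x + y) # r) else (t', y) # add_term (t, x) r)"

definition scale_row :: "int \<Rightarrow> row \<Rightarrow> row" where
  "scale_row a = map (apsnd ((*) a))"

text \<open>Fraction-free row operation; dividing by the gcd keeps the integers small. Soundness
  rests only on the result being an integer combination of two vanishing rows.\<close>

fun eliminate :: "(nat \<times> nat \<times> nat) \<times> int \<Rightarrow> row \<Rightarrow> int option \<Rightarrow> row \<Rightarrow> row" where
  "eliminate (t, a) r None s = s"
| "eliminate (t, a) r (Some b) s =
    foldr add_term (scale_row (- (b div gcd a b)) ((t, a) # r)) (scale_row (a div gcd a b) s)"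

text \<open>This is back substitution: \<open>ts\<close> are the entries already solved from the
  reduced rows, and the pivot entry follows once the rest of its row is among them.\<close>

definition record_pivot ::
  "(nat \<times> nat \<times> nat) \<times> int \<Rightarrow> row \<Rightarrow> (nat \<times> nat \<times> nat) list \<Rightarrow> (nat \<times> nat \<times> nat) list" where
  "record_pivot p r ts = (if snd p \<noteq> 0 \<and> list_all (\<lambda>q. fst q \<in> set ts) r then fst p # ts else ts)"

fun no_longer :: "row \<Rightarrow> row \<Rightarrow> bool" where
  "no_longer [] s = True"
| "no_longer (p # r) [] = False"
| "no_longer (p # r) (q # s) = no_longer r s"

text \<open>A shortest row as pivot row limits the fill-in of the remaining rows.\<close>

fun pull_shortest :: "row \<Rightarrow> row list \<Rightarrow> row list \<Rightarrow> row \<times> row list" where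
  "pull_shortest r [] acc = (r, acc)"
| "pull_shortest r (s # rs) acc =
    (if no_longer r s then pull_shortest r rs (s # acc) else pull_shortest s rs (r # acc))"

text \<open>The number is fuel. Each round consumes one row, so the number of rows is enough; less
  fuel could only shorten the answer.\<close>

fun solved_entries :: "nat \<Rightarrow> row list \<Rightarrow> (nat \<times> nat \<times> nat) list"
  and solve_with :: "nat \<Rightarrow> row \<times> row list \<Rightarrow> (nat \<times> nat \<times> nat) list" where
  "solved_entries m [] = []"
| "solved_entries 0 (r # rs) = []"
| "solved_entries (Suc m) (r # rs) = solve_with m (pull_shortest r rs [])"
| "solve_with m ([], rs) = solved_entries m rs"
| "solve_with m (p # r, rs) =
    record_pivot p r (solved_entries m (map (\<lambda>s. eliminate p r (map_of s (fst p)) s) rs))"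

fun sorted_triple :: "nat \<Rightarrow> nat \<Rightarrow> nat \<Rightarrow> nat \<times> nat \<times> nat" where
  "sorted_triple a b d =
    (if b < a then (if d < b then (d, b, a) else if d < a then (b, d, a) else (b, a, d))
     else (if d < a then (d, a, b) else if d < b then (a, d, b) else (a, b, d)))"

text \<open>The test \<open>z\<close> tells the entries that are already known to vanish.\<close>

fun grad_row :: "(nat \<times> nat \<times> nat \<Rightarrow> bool) \<Rightarrow> nat \<Rightarrow> (nat \<times> int) list \<Rightarrow> row" where
  "grad_row z j [] = []"
| "grad_row z j ((a, x) # v) =
     filter (\<lambda>q. \<not> z (fst q))
       ((sorted_triple a a j, x * x) # map (\<lambda>(b, y). (sorted_triple a b j, 2 * x * y)) v) @ grad_row z j v"

definition covers :: "nat \<Rightarrow> (nat \<times> nat \<times> nat \<Rightarrow> bool) \<Rightarrow> (nat \<times> nat \<times> nat) list \<Rightarrow> bool" where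
  "covers N z ts \<longleftrightarrow>
     list_all (\<lambda>a. list_all (\<lambda>b. list_all (\<lambda>d. z (a, b, d) \<or> List.member ts (a, b, d)) [b..<N]) [a..<N]) [0..<N]"

definition grad_rows :: "nat \<Rightarrow> (nat \<times> nat \<times> nat \<Rightarrow> bool) \<Rightarrow> (nat \<times> int) list list \<Rightarrow> row list" where
  "grad_rows N z vs = concat (map (\<lambda>v. map (\<lambda>j. grad_row z j v) [0..<N]) vs)"

definition determines :: "nat \<Rightarrow> (nat \<times> nat \<times> nat \<Rightarrow> bool) \<Rightarrow> (nat \<times> int) list list \<Rightarrow> bool" where
  "determines N z vs \<longleftrightarrow> covers N z (solved_entries (N * length vs) (grad_rows N z vs))"

section \<open>Soundness of the elimination\<close>

lemma row_value_simps [simp]: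
  "row_value c [] = 0"
  "row_value c ((t, x) # r) = of_int x * entry c t + row_value c r"
  "row_value c (r @ s) = row_value c r + row_value c s"
  by (simp_all add: row_value_def)

lemma row_value_eq_0: "(\<And>q. q \<in> set r \<Longrightarrow> entry c (fst q) = 0) \<Longrightarrow> row_value c r = 0"
  unfolding row_value_def by (induction r) (simp_all add: case_prod_unfold)

lemma row_value_add_term: "row_value c (add_term q r) = of_int (snd q) * entry c (fst q) + row_value c r"
proof (induction q r rule: add_term.induct)
  case (2 t x t' y r)
  show ?case
  proof (cases "t = t' \<and> x + y = 0")
    case True
    then have "(of_int x :: 'a) + of_int y = 0" by (metis of_int_0 of_int_add)
    then have "of_int x * entry c t + of_int y * entry c t = 0"
      by (metis distrib_right mult_zero_left)
    then show ?thesis using True by (simp add: algebra_simps)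
  qed (use 2 in \<open>auto simp: algebra_simps\<close>)
qed simp

lemma row_value_foldr_add_term: "row_value c (foldr add_term r s) = row_value c r + row_value c s"
  by (induction r) (auto simp: row_value_add_term)

lemma row_value_scale_row: "row_value c (scale_row a r) = of_int a * row_value c r"
  by (induction r) (auto simp: scale_row_def algebra_simps)

lemma row_value_eliminate:
  assumes "row_value c (p # r) = 0" "row_value c s = 0"
  shows "row_value c (eliminate p r b s) = 0"
proof (cases p)
  case (Pair t a)
  then show ?thesis
    using assms by (cases b) (auto simp: row_value_foldr_add_term row_value_scale_row simp flip: row_value_simps(2))
qed

lemma pull_shortest_set:
  "pull_shortest r rs acc = (r', rs') \<Longrightarrow> insert r' (set rs') \<subseteq> insert r (set rs \<union> set acc)"
  by (induction r rs acc rule: pull_shortest.induct) (fastforce split: if_splits)+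

text \<open>The only invariant is that all current rows vanish at \<open>c\<close>. Reordering and
  elimination preserve it, and a recorded pivot is the only entry of its row not yet known to
  vanish, with a nonzero coefficient.\<close>

lemma
  fixes c :: "'k::field_char_0 tensor"
  shows solved_entries_zero: "\<forall>r\<in>set rows. row_value c r = 0 \<Longrightarrow>
      t \<in> set (solved_entries m rows) \<Longrightarrow> entry c t = 0"
    and "\<forall>r\<in>insert (fst q) (set (snd q)). row_value c r = 0 \<Longrightarrow>
      t \<in> set (solve_with m q) \<Longrightarrow> entry c t = 0"
proof (induction m rows and m q arbitrary: t and t rule: solved_entries_solve_with.induct)
  case (3 m r rs)
  obtain r' rs' where pull: "pull_shortest r rs [] = (r', rs')" by fastforce
  have "\<forall>r\<in>insert r' (set rs'). row_value c r = 0"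
    using 3(2) pull_shortest_set[OF pull] by auto
  then show ?case
    using 3(1,3) unfolding pull by (simp add: pull)
next
  case (5 m p r rs)
  obtain u a where p: "p = (u, a)" by fastforce
  define ts where "ts = solved_entries m (map (\<lambda>s. eliminate p r (map_of s (fst p)) s) rs)"
  have ts: "entry c t = 0" if "t \<in> set ts" for t
  proof (rule 5(1)[OF ballI that[unfolded ts_def]])
    fix s assume "s \<in> set (map (\<lambda>s. eliminate p r (map_of s (fst p)) s) rs)"
    then show "row_value c s = 0"
      using 5(2) by (auto intro!: row_value_eliminate simp del: row_value_simps)
  qed
  have "t \<in> set (record_pivot p r ts)" using 5(3) by (simp add: ts_def)
  then consider "t \<in> set ts" | "t = u" "a \<noteq> 0" "\<forall>q\<in>set r. fst q \<in> set ts"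
    by (auto simp: record_pivot_def p list_all_iff split: if_splits)
  then show ?case
  proof cases
    case 2
    have "row_value c r = 0"
      using 2(3) ts by (intro row_value_eq_0) blast
    then show ?thesis using 5(2) 2(1,2) by (auto simp: p)
  qed (rule ts)
qed auto

definition sparse :: "(nat \<times> int) list \<Rightarrow> nat \<Rightarrow> 'k::field" where
  "sparse v i = (\<Sum>(a, x)\<leftarrow>v. if a = i then of_int x else 0)"

lemma sparse_eq_0: "i \<notin> fst ` set v \<Longrightarrow> sparse v i = 0"
  by (induction v) (auto simp: sparse_def)

lemma sum_sparse:
  assumes "finite I" "fst ` set v \<subseteq> I"
  shows "(\<Sum>i\<in>I. f i * sparse v i) = (\<Sum>(a, x)\<leftarrow>v. f a * of_int x)"
  using assms(2)
proof (induction v)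
  case (Cons p v)
  obtain a x where p: "p = (a, x)" by fastforce
  have "(\<Sum>i\<in>I. f i * sparse (p # v) i) = (\<Sum>i\<in>I. if a = i then f i * of_int x else 0) + (\<Sum>i\<in>I. f i * sparse v i)"
    unfolding sum.distrib[symmetric] by (intro sum.cong) (auto simp: p sparse_def algebra_simps)
  then show ?case using Cons assms(1) by (simp add: p)
qed (simp add: sparse_def)

lemma sorted_triple:
  assumes "symmetric_tensor c" "sorted_triple a b d = (a', b', d')"
  shows "c a b d = c a' b' d'" "a' \<le> b'" "b' \<le> d'" "{a', b', d'} = {a, b, d}"
proof -
  have c: "c a b d = c b a d" "c a b d = c a d b" for a b d
    using assms(1) unfolding symmetric_tensor_def by blast+
  show "c a b d = c a' b' d'" using assms(2) c by (auto split: if_splits)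
  show "a' \<le> b'" "b' \<le> d'" "{a', b', d'} = {a, b, d}" using assms(2) by (auto split: if_splits)
qed

declare sorted_triple.simps [simp del]

lemma entry_sorted_triple: "symmetric_tensor c \<Longrightarrow> entry c (sorted_triple a b d) = c a b d"
  using sorted_triple(1) by (metis entry.simps prod_cases3)

lemma row_value_filter:
  "(\<And>q. q \<in> set r \<Longrightarrow> z (fst q) \<Longrightarrow> entry c (fst q) = 0) \<Longrightarrow>
    row_value c (filter (\<lambda>q. \<not> z (fst q)) r) = row_value c r"
proof (induction r)
  case (Cons q r)
  then have "row_value c (filter (\<lambda>q. \<not> z (fst q)) r) = row_value c r" by simp
  then show ?case using Cons.prems[of q] by (cases q) (simp del: split_paired_All)
qed simp

text \<open>\<open>grad\<close> runs over ordered pairs of indices, \<open>grad_row\<close> over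
  unordered ones. Symmetry of \<open>c\<close> merges the two orders, which is the factor 2; the
  entries filtered out by \<open>z\<close> contribute zero.\<close>

lemma row_value_grad_row:
  assumes c: "symmetric_tensor c"
    and z: "\<And>a b d. a \<le> b \<Longrightarrow> b \<le> d \<Longrightarrow> d < N \<Longrightarrow> z (a, b, d) \<Longrightarrow> c a b d = 0"
    and "j < N" "fst ` set v \<subseteq> {..<N}"
  shows "row_value c (grad_row z j v) = grad {..<N} c (sparse v) j"
proof -
  have zs: "c a b j = 0" if "a < N" "b < N" "z (sorted_triple a b j)" for a b
  proof -
    obtain a' b' d' where t: "sorted_triple a b j = (a', b', d')" by (metis prod_cases3)
    have "d' < N" using sorted_triple(4)[OF c t] that assms(3) by auto
    then show ?thesis using sorted_triple(1-3)[OF c t] z[of a' b' d'] that(3) by (simp add: t)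
  qed
  have "row_value c (grad_row z j v) =
      (\<Sum>(a, x)\<leftarrow>v. \<Sum>(b, y)\<leftarrow>v. c a b j * of_int x * of_int y)"
    using assms(4)
  proof (induction v)
    case (Cons p v)
    obtain a x where p: "p = (a, x)" by fastforce
    define r where "r = map (\<lambda>(b, y). (sorted_triple a b j, 2 * x * y)) v"
    define A where "A = (\<Sum>(b, y)\<leftarrow>v. c a b j * of_int x * of_int y)"
    define T where "T = (\<Sum>(a, x)\<leftarrow>v. \<Sum>(b, y)\<leftarrow>v. c a b j * of_int x * of_int y)"
    have "row_value c (filter (\<lambda>q. \<not> z (fst q)) ((sorted_triple a a j, x * x) # r)) =
        row_value c ((sorted_triple a a j, x * x) # r)"
      using Cons.prems c zs by (intro row_value_filter) (auto simp: p r_def entry_sorted_triple)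
    also have "\<dots> = c a a j * of_int x * of_int x + row_value c r"
      by (simp add: entry_sorted_triple[OF c] mult_ac)
    also have "row_value c r = (\<Sum>q\<leftarrow>v. 2 * (c a (fst q) j * of_int x * of_int (snd q)))"
      unfolding r_def row_value_def map_map comp_def case_prod_unfold
      by (intro arg_cong[where f = sum_list] map_cong refl) (simp add: entry_sorted_triple[OF c])
    also have "\<dots> = A + A"
      unfolding sum_list_const_mult A_def case_prod_unfold by simp
    finally have "row_value c (grad_row z j (p # v)) = c a a j * of_int x * of_int x + (A + A) + T"
      using Cons by (simp only: p grad_row.simps row_value_simps r_def[symmetric] T_def) simp
    moreover have "(\<Sum>(b, y)\<leftarrow>v. c b a j * of_int y * of_int x) = A"
      using c unfolding symmetric_tensor_def A_def
      by (intro arg_cong[where f = sum_list] map_cong) (auto simp: mult_ac)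
    moreover have "(\<Sum>(a, x)\<leftarrow>p # v. \<Sum>(b, y)\<leftarrow>p # v. c a b j * of_int x * of_int y) =
        c a a j * of_int x * of_int x + A + ((\<Sum>(b, y)\<leftarrow>v. c b a j * of_int y * of_int x) + T)"
      by (simp add: p A_def T_def case_prod_unfold sum_list_addf)
    ultimately show ?case by simp
  qed (simp add: row_value_def)
  also have "\<dots> = grad {..<N} c (sparse v) j"
  proof -
    have "grad {..<N} c (sparse v) j = (\<Sum>a<N. (\<Sum>b<N. c a b j * sparse v b) * sparse v a)"
      by (simp add: grad_def sum_distrib_right sum_distrib_left mult_ac)
    also have "\<dots> = (\<Sum>(a, x)\<leftarrow>v. (\<Sum>(b, y)\<leftarrow>v. c a b j * of_int y) * of_int x)"
      using assms(4) by (simp only: sum_sparse finite_lessThan)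
    also have "\<dots> = (\<Sum>(a, x)\<leftarrow>v. \<Sum>(b, y)\<leftarrow>v. c a b j * of_int x * of_int y)"
      unfolding case_prod_unfold sum_list_mult_const[symmetric]
      by (intro arg_cong[where f = sum_list] map_cong refl) (simp add: mult_ac)
    finally show ?thesis by (rule sym)
  qed
  finally show ?thesis .
qed

lemma determines_vanishes:
  fixes c :: "'k::field_char_0 tensor"
  assumes c: "symmetric_tensor c"
    and z: "\<And>a b d. a \<le> b \<Longrightarrow> b \<le> d \<Longrightarrow> d < N \<Longrightarrow> z (a, b, d) \<Longrightarrow> c a b d = 0"
    and det: "determines N z vs"
    and vs: "\<And>v. v \<in> set vs \<Longrightarrow> fst ` set v \<subseteq> {..<N}"
      "\<And>v j. v \<in> set vs \<Longrightarrow> j < N \<Longrightarrow> grad {..<N} c (sparse v) j = 0"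
  shows "vanishes_on {..<N} c"
proof -
  have "row_value c r = 0" if "r \<in> set (grad_rows N z vs)" for r
    using that row_value_grad_row[OF c z] vs by (auto simp: grad_rows_def)
  then have rows: "\<forall>r\<in>set (grad_rows N z vs). row_value c r = 0" by blast
  have sorted: "c a b d = 0" if "a \<le> b" "b \<le> d" "d < N" for a b d
  proof -
    have "z (a, b, d) \<or> (a, b, d) \<in> set (solved_entries (N * length vs) (grad_rows N z vs))"
      using det that by (auto simp: determines_def covers_def list_all_iff)
    then show ?thesis using z[OF that] solved_entries_zero[OF rows] by fastforce
  qed
  show ?thesis
    unfolding vanishes_on_def
  proof (intro ballI)
    fix a b d assume "a \<in> {..<N}" "b \<in> {..<N}" "d \<in> {..<N}"
    moreover obtain a' b' d' where t: "sorted_triple a b d = (a', b', d')" by (metis prod_cases3)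
    moreover have "d' \<in> {a, b, d}" using sorted_triple(4)[OF c t] by blast
    ultimately show "c a b d = 0"
      using sorted_triple(1-3)[OF c t] sorted[of a' b' d'] by auto
  qed
qed

text \<open>A double point at a coordinate vector \<open>e_i\<close> says directly that
  \<open>c i i j = 0\<close> for all \<open>j\<close>. Such points, listed in \<open>es\<close>,
  only feed the test \<open>z\<close>; the elimination runs on the points \<open>vs\<close> with the
  entries passing the test removed, which keeps the certified computation small.\<close>

lemma realizable_of_determines:
  fixes ws :: "(nat \<times> int) list list"
  assumes "determines N z vs" "set vs \<subseteq> set ws" "\<And>i. i \<in> set es \<Longrightarrow> [(i, 1)] \<in> set ws"
    and z: "\<And>c :: 'k::field_char_0 tensor. \<And>a b d. symmetric_tensor c \<Longrightarrow> \<forall>A\<in>\<Z>. vanishes_on A c \<Longrightarrow>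
      \<forall>i\<in>set es. \<forall>j<N. c i i j = 0 \<Longrightarrow> a \<le> b \<Longrightarrow> b \<le> d \<Longrightarrow> d < N \<Longrightarrow> z (a, b, d) \<Longrightarrow> c a b d = 0"
    and supports: "list_all2 (\<lambda>w A. fst ` set w \<subseteq> A \<inter> {..<N}) ws (map s [0..<length ws])"
  shows "realizable TYPE('k::field_char_0) {..<N} \<Z> {..<length ws} {} s"
proof -
  have s: "fst ` set (ws ! l) \<subseteq> s l \<inter> {..<N}" if "l < length ws" for l
    using supports that by (auto simp: list_all2_conv_all_nth)
  have ws: "fst ` set w \<subseteq> {..<N}" if "w \<in> set ws" for w
    using that s by (auto simp: in_set_conv_nth)
  have "rigid {..<N} \<Z> {..<length ws} {} (\<lambda>l. sparse (ws ! l) :: nat \<Rightarrow> 'k)"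
    unfolding rigid_def
  proof (intro allI impI)
    fix c :: "'k tensor"
    assume c: "symmetric_tensor c" "\<forall>A\<in>\<Z>. vanishes_on A c"
      "\<forall>l\<in>{..<length ws}. \<forall>j\<in>{..<N}. grad {..<N} c (sparse (ws ! l)) j = 0"
    have g: "grad {..<N} c (sparse w) j = 0" if "w \<in> set ws" "j < N" for w j
      using c(3) that by (auto simp: in_set_conv_nth)
    have es: "c i i j = 0" if "i \<in> set es" "j < N" for i j
    proof -
      have "grad {..<N} c (sparse [(i, 1)]) j = row_value c (grad_row (\<lambda>_. False) j [(i, 1)])"
        using ws[OF assms(3)[OF that(1)]] that(2)
        by (intro row_value_grad_row[symmetric, where z = "\<lambda>_. False"] c(1)) simp_all
      also have "\<dots> = c i i j"
        by (simp add: entry_sorted_triple[OF c(1)])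
      finally show ?thesis using g[OF assms(3)[OF that(1)] that(2)] by simp
    qed
    show "vanishes_on {..<N} c"
    proof (rule determines_vanishes[OF c(1) _ assms(1)])
      show "c a b d = 0" if "a \<le> b" "b \<le> d" "d < N" "z (a, b, d)" for a b d
        using z[OF c(1,2) _ that] es by blast
      show "fst ` set v \<subseteq> {..<N}" if "v \<in> set vs" for v
        using that assms(2) ws by blast
      show "grad {..<N} c (sparse v) j = 0" if "v \<in> set vs" "j < N" for v j
        using that assms(2) g by blast
    qed
  qed
  then show ?thesis
    unfolding realizable_def
  proof (intro exI conjI ballI allI impI)
    fix l a assume "l \<in> {..<length ws} \<union> {}" "a \<notin> s l"
    then show "sparse (ws ! l) a = (0 :: 'k)" using s[of l] by (intro sparse_eq_0) auto
  qed
qed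

section \<open>Relabelling\<close>

lemma realizable_image:
  fixes f :: "nat \<Rightarrow> nat" and g :: "'l \<Rightarrow> 'm"
  assumes "realizable TYPE('k::field) I \<Z> D {} s" "inj_on f I" "inj_on g D"
    and \<Z>: "\<And>A. A \<in> \<Z> \<Longrightarrow> A \<subseteq> I" and s: "\<And>l. l \<in> D \<Longrightarrow> f ` (s l \<inter> I) \<subseteq> s' (g l)"
  shows "realizable TYPE('k::field) (f ` I) ((`) f ` \<Z>) (g ` D) {} s'"
proof -
  obtain u :: "'l \<Rightarrow> nat \<Rightarrow> 'k" where u: "\<And>l a. l \<in> D \<Longrightarrow> a \<notin> s l \<Longrightarrow> u l a = 0"
    "rigid I \<Z> D {} u"
    using assms(1) unfolding realizable_def by blast
  define v where "v m a = (if a \<in> f ` I then u (inv_into D g m) (inv_into I f a) else 0)" for m a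
  have v: "v (g l) (f a) = u l a" if "l \<in> D" "a \<in> I" for l a
    using that assms(2,3) by (simp add: v_def)
  have "rigid (f ` I) ((`) f ` \<Z>) (g ` D) {} v"
    unfolding rigid_def
  proof (intro allI impI)
    fix c :: "'k tensor"
    assume c: "symmetric_tensor c" "\<forall>A\<in>(`) f ` \<Z>. vanishes_on A c"
      "\<forall>m\<in>g ` D. \<forall>j\<in>f ` I. grad (f ` I) c (v m) j = 0"
    define c' where "c' a b d = c (f a) (f b) (f d)" for a b d
    have "symmetric_tensor c'" using c(1) unfolding symmetric_tensor_def c'_def by blast
    moreover have "\<forall>A\<in>\<Z>. vanishes_on A c'"
      using c(2) by (auto simp: vanishes_on_def c'_def)
    moreover have "grad I c' (u l) j = 0" if "l \<in> D" "j \<in> I" for l j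
    proof -
      have "grad (f ` I) c (v (g l)) (f j) = grad I c' (u l) j"
        unfolding grad_def sum.reindex[OF assms(2)] comp_def c'_def
        by (intro sum.cong refl) (simp add: v that)
      then show ?thesis using c(3) that by auto
    qed
    ultimately have "vanishes_on I c'" using u(2) unfolding rigid_def by blast
    then show "vanishes_on (f ` I) c" by (auto simp: vanishes_on_def c'_def)
  qed
  moreover have "v m a = 0" if "m \<in> g ` D" "a \<notin> s' m" for m a
  proof -
    from that(1) obtain l where l: "l \<in> D" "m = g l" by blast
    show ?thesis
    proof (cases "a \<in> f ` I")
      case True
      then obtain i where "i \<in> I" "a = f i" by blast
      moreover from this have "i \<notin> s l" using s[OF l(1)] l(2) that(2) by blast
      ultimately show ?thesis using v[OF l(1)] l u(1) by simp
    qed (simp add: v_def)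
  qed
  ultimately show ?thesis unfolding realizable_def by (intro exI[of _ v]) blast
qed

lemma enumerate_partition:
  assumes "finite A" "finite B" "finite C" "A \<inter> B = {}" "A \<inter> C = {}" "B \<inter> C = {}"
    and "card A = p" "card B = q" "card C = r"
  obtains f :: "nat \<Rightarrow> 'a" where "inj_on f {..<p + q + r}"
    "f ` {..<p} = A" "f ` {p..<p + q} = B" "f ` {p + q..<p + q + r} = C"
proof -
  obtain f1 f2 f3 where f: "bij_betw f1 {0..<p} A" "bij_betw f2 {0..<q} B" "bij_betw f3 {0..<r} C"
    using ex_bij_betw_nat_finite assms by metis
  define f where "f i = (if i < p then f1 i else if i < p + q then f2 (i - p) else f3 (i - p - q))" for i
  have shift: "bij_betw (\<lambda>i. i - k) {k..<k + m} {0..<m}" for k m :: nat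
    by (rule bij_betw_byWitness[where f' = "\<lambda>i. i + k"]) auto
  have "bij_betw f {..<p} A \<longleftrightarrow> bij_betw f1 {..<p} A"
    by (rule bij_betw_cong) (simp add: f_def)
  then have 1: "bij_betw f {..<p} A"
    using f(1) by (simp add: lessThan_atLeast0)
  have "bij_betw f {p..<p + q} B \<longleftrightarrow> bij_betw (f2 \<circ> (\<lambda>i. i - p)) {p..<p + q} B"
    by (rule bij_betw_cong) (simp add: f_def)
  then have 2: "bij_betw f {p..<p + q} B"
    using bij_betw_trans[OF shift f(2)] by simp
  have "bij_betw f {p + q..<p + q + r} C \<longleftrightarrow> bij_betw (f3 \<circ> (\<lambda>i. i - (p + q))) {p + q..<p + q + r} C"
    by (rule bij_betw_cong) (simp add: f_def)
  then have 3: "bij_betw f {p + q..<p + q + r} C"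
    using bij_betw_trans[OF shift f(3)] by simp
  have "bij_betw f ({..<p} \<union> {p..<p + q}) (A \<union> B)"
    using 1 2 assms(4) by (rule bij_betw_combine)
  then have "bij_betw f ({..<p} \<union> {p..<p + q} \<union> {p + q..<p + q + r}) (A \<union> B \<union> C)"
    using 3 by (rule bij_betw_combine) (use assms(5,6) in blast)
  moreover have "{..<p} \<union> {p..<p + q} \<union> {p + q..<p + q + r} = {..<p + q + r}" by auto
  ultimately show ?thesis
    using 1 2 3 by (intro that[of f]) (auto simp: bij_betw_def)
qed

section \<open>Explicit configurations\<close>

text \<open>The configurations were found by a random search for sparse points on which the elimination succeeds.\<close>

lemma vanishes_onD: "vanishes_on A c \<Longrightarrow> {a, b, d} \<subseteq> A \<Longrightarrow> c a b d = 0"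
  by (simp add: vanishes_on_def)

text \<open>With the blocks \<open>{0, 1, 2}\<close>, \<open>{3, 4, 5}\<close>,
  \<open>{6, 7}\<close>, the free entries have one index in each block: 18 unknowns. A point on one
  of the subspaces imposes one condition per index of the missing block, in total
  \<open>2 * 3 + 2 * 3 + 3 * 2 = 18\<close>.\<close>

lemma three_subspaces_base:
  "realizable TYPE('k::field_char_0) {..<8} {{..<6}, {3..<8}, {..<3} \<union> {6..<8}} {..<7::nat} {}
     (\<lambda>l. if l < 2 then {3..<8} else if l < 4 then {..<3} \<union> {6..<8} else {..<6})"
proof -
  define ws :: "(nat \<times> int) list list" where "ws = [[(3, 1), (7, 1)],
      [(5, 1), (7, 1)],
      [(1, 1), (6, 1)],
      [(0, 1), (2, 1), (6, 1)],
      [(0, 1), (4, 1), (5, 1)],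
      [(1, -1), (2, 1), (4, 1)],
      [(2, 1), (3, 1), (4, 1)]]"
  have "determines 8 (\<lambda>(a, b, d). b < 3 \<or> 2 < a \<or> 5 < b \<or> d < 6) ws"
    unfolding ws_def by code_simp
  then have "realizable TYPE('k::field_char_0) {..<8} {{..<6}, {3..<8}, {..<3} \<union> {6..<8}} {..<length ws} {}
     (\<lambda>l. if l < 2 then {3..<8} else if l < 4 then {..<3} \<union> {6..<8} else {..<6})"
  proof (rule realizable_of_determines[where es = "[]"])
    show "c a b d = 0" if "\<forall>A\<in>{{..<6}, {3..<8}, {..<3} \<union> {6..<8}}. vanishes_on A c" "a \<le> b" "b \<le> d" "d < 8"
      "case (a, b, d) of (a, b, d) \<Rightarrow> b < 3 \<or> 2 < a \<or> 5 < b \<or> d < 6" for c :: "'k tensor" and a b d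
    proof -
      have "\<exists>A\<in>{{..<6}, {3..<8}, {..<3} \<union> {6..<8}}. {a, b, d} \<subseteq> A" using that(2-) by auto
      then show ?thesis using that(1) unfolding vanishes_on_def by blast
    qed
  qed (simp_all add: ws_def upt_rec)
  moreover have "length ws = 7" by (simp add: ws_def)
  ultimately show ?thesis by (simp only:)
qed

text \<open>The 36 entries meeting both blocks face \<open>3 * 3 + 3 * 3 + 3 * 6\<close>
  conditions.\<close>

lemma two_subspaces_base_6:
  "realizable TYPE('k::field_char_0) {..<6} {{3..<6}, {..<3}} {..<9::nat} {}
     (\<lambda>l. if l < 3 then {3..<6} else if l < 6 then {..<3} else {..<6})"
proof -
  define ws :: "(nat \<times> int) list list" where "ws = [[(3, 1), (4, 1)],
      [(3, -1), (5, 1)],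
      [(4, -1), (5, -1)],
      [(1, 1), (2, 1)],
      [(2, 1)],
      [(0, 1), (2, 1)],
      [(0, 1), (4, 1)],
      [(0, 2), (1, 1), (5, -1)],
      [(1, 2), (3, -1)]]"
  have "determines 6 (\<lambda>(a, b, d). 2 < a \<or> d < 3) ws"
    unfolding ws_def by code_simp
  then have "realizable TYPE('k::field_char_0) {..<6} {{3..<6}, {..<3}} {..<length ws} {}
     (\<lambda>l. if l < 3 then {3..<6} else if l < 6 then {..<3} else {..<6})"
  proof (rule realizable_of_determines[where es = "[]"])
    show "c a b d = 0" if "\<forall>A\<in>{{3..<6}, {..<3}}. vanishes_on A c" "a \<le> b" "b \<le> d" "d < 6"
      "case (a, b, d) of (a, b, d) \<Rightarrow> 2 < a \<or> d < 3" for c :: "'k tensor" and a b d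
    proof -
      have "\<exists>A\<in>{{3..<6}, {..<3}}. {a, b, d} \<subseteq> A" using that(2-) by auto
      then show ?thesis using that(1) unfolding vanishes_on_def by blast
    qed
  qed (simp_all add: ws_def upt_rec)
  moreover have "length ws = 9" by (simp add: ws_def)
  ultimately show ?thesis by (simp only:)
qed

text \<open>The odd start of an induction in steps of two. There are 45 free entries and
  \<open>4 * 3 + 4 * 3 + 3 * 7\<close> conditions.\<close>

lemma two_subspaces_base_7:
  "realizable TYPE('k::field_char_0) {..<7} {{3..<7}, {..<3} \<union> {6}} {..<11::nat} {}
     (\<lambda>l. if l < 4 then {3..<7} else if l < 8 then {..<3} \<union> {6} else {..<7})"
proof -
  define ws :: "(nat \<times> int) list list" where "ws = [[(3, 1), (6, 1)],
      [(3, 1)],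
      [(3, -1), (4, 1)],
      [(3, 1), (5, 1)],
      [(1, -1), (6, 1)],
      [(0, 1), (2, 1)],
      [(0, 1), (2, -1)],
      [(0, 1), (6, 1)],
      [(0, 1), (1, -1), (4, 1), (6, 1)],
      [(1, 1), (2, 1), (5, 2)],
      [(2, 2), (4, 2), (5, 2)]]"
  have "determines 7 (\<lambda>(a, b, d). 2 < a \<or> d < 3 \<or> (b < 3 \<and> 5 < d) \<or> 5 < b) ws"
    unfolding ws_def by code_simp
  then have "realizable TYPE('k::field_char_0) {..<7} {{3..<7}, {..<3} \<union> {6}} {..<length ws} {}
     (\<lambda>l. if l < 4 then {3..<7} else if l < 8 then {..<3} \<union> {6} else {..<7})"
  proof (rule realizable_of_determines[where es = "[]"])
    show "c a b d = 0" if "\<forall>A\<in>{{3..<7}, {..<3} \<union> {6}}. vanishes_on A c" "a \<le> b" "b \<le> d" "d < 7"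
      "case (a, b, d) of (a, b, d) \<Rightarrow> 2 < a \<or> d < 3 \<or> (b < 3 \<and> 5 < d) \<or> 5 < b" for c :: "'k tensor" and a b d
    proof -
      have "3 \<le> a \<or> (a < 3 \<or> a = 6) \<and> (b < 3 \<or> b = 6) \<and> (d < 3 \<or> d = 6)"
        using that(2-) unfolding prod.case by presburger
      then have "{a, b, d} \<subseteq> {3..<7} \<or> {a, b, d} \<subseteq> {..<3} \<union> {6}"
      proof
        assume "3 \<le> a"
        then show ?thesis using that(2-4) by simp
      next
        assume "(a < 3 \<or> a = 6) \<and> (b < 3 \<or> b = 6) \<and> (d < 3 \<or> d = 6)"
        then have "{a, b, d} \<subseteq> {..<3} \<union> {6}" by blast
        then show ?thesis by blast
      qed
      then show ?thesis
        using that(1) vanishes_onD[of "{3..<7}" c] vanishes_onD[of "{..<3} \<union> {6}" c]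
        unfolding ball_simps by metis
    qed
  qed (simp_all add: ws_def upt_rec)
  moreover have "length ws = 11" by (simp add: ws_def)
  ultimately show ?thesis by (simp only:)
qed

lemma square_free_entries:
  assumes "symmetric_tensor c" "\<And>i j. i < N \<Longrightarrow> j < N \<Longrightarrow> c i i j = 0" "a \<le> b" "b \<le> d" "d < N" "a = b \<or> b = d"
  shows "c a b d = 0"
proof -
  have "c a b b = c b b a" using assms(1) unfolding symmetric_tensor_def by metis
  then show ?thesis using assms by (cases "a = b") auto
qed

text \<open>The coordinate points kill all entries with a repeated index; the gradient at the
  all-ones vector gives four independent equations for the four square-free entries.\<close>

lemma one_subspace_base_4:
  "realizable TYPE('k::field_char_0) {..<4} {{3}} {..<5::nat} {} (\<lambda>l. if l < 1 then {3} else {..<4})"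
proof -
  define ws :: "(nat \<times> int) list list" where
    "ws = [[(3, 1)], [(0, 1)], [(1, 1)], [(2, 1)], [(0, 1), (1, 1), (2, 1), (3, 1)]]"
  have es: "{..<4} \<subseteq> set ([3, 0, 1, 2] :: nat list)" by (simp add: numeral_eq_Suc lessThan_Suc)
  have "determines 4 (\<lambda>(a, b, d). a = b \<or> b = d) [ws ! 4]"
    unfolding ws_def by code_simp
  then have "realizable TYPE('k::field_char_0) {..<4} {{3}} {..<length ws} {} (\<lambda>l. if l < 1 then {3} else {..<4})"
  proof (rule realizable_of_determines[where es = "[3, 0, 1, 2]"])
    show "c a b d = 0" if "symmetric_tensor c" "\<forall>i\<in>set [3, 0, 1, 2]. \<forall>j<4. c i i j = 0" "a \<le> b" "b \<le> d" "d < 4"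
      "case (a, b, d) of (a, b, d) \<Rightarrow> a = b \<or> b = d" for c :: "'k tensor" and a b d
      using es square_free_entries[OF that(1) _ that(3-5)] that(2,6) by blast
  qed (simp_all add: ws_def upt_rec)
  moreover have "length ws = 5" by (simp add: ws_def)
  ultimately show ?thesis by (simp only:)
qed

text \<open>After the coordinate points, 46 square-free entries with an index below 3 remain. The
  two further points on the subspace impose 3 conditions each and the five others 8 each.\<close>

lemma one_subspace_base_8:
  "realizable TYPE('k::field_char_0) {..<8} {{3..<8}} {..<15::nat} {} (\<lambda>l. if l < 7 then {3..<8} else {..<8})"
proof -
  define vs :: "(nat \<times> int) list list" where "vs = [[(3, 1), (4, -1), (7, -1)],
      [(3, 1), (4, 1), (7, 1)],
      [(0, -1), (1, 1), (6, 1), (7, 1)],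
      [(0, 1), (1, 1), (4, 1), (5, 1)],
      [(0, 1), (2, -1), (3, 1), (6, 1), (7, 1)],
      [(1, 1), (2, 1), (3, 1), (7, 1)],
      [(0, -1), (2, -1), (3, -1), (5, 1)]]"
  define ws :: "(nat \<times> int) list list" where "ws = [[(3, 1)],
      [(4, 1)],
      [(5, 1)],
      [(6, 1)],
      [(7, 1)],
      [(3, 1), (4, -1), (7, -1)],
      [(3, 1), (4, 1), (7, 1)],
      [(0, 1)],
      [(1, 1)],
      [(2, 1)],
      [(0, -1), (1, 1), (6, 1), (7, 1)],
      [(0, 1), (1, 1), (4, 1), (5, 1)],
      [(0, 1), (2, -1), (3, 1), (6, 1), (7, 1)],
      [(1, 1), (2, 1), (3, 1), (7, 1)],
      [(0, -1), (2, -1), (3, -1), (5, 1)]]"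
  have es: "{..<8} \<subseteq> set ([3, 4, 5, 6, 7, 0, 1, 2] :: nat list)" by (simp add: numeral_eq_Suc lessThan_Suc)
  have "determines 8 (\<lambda>(a, b, d). a = b \<or> b = d \<or> 2 < a) vs"
    unfolding vs_def by code_simp
  then have "realizable TYPE('k::field_char_0) {..<8} {{3..<8}} {..<length ws} {} (\<lambda>l. if l < 7 then {3..<8} else {..<8})"
  proof (rule realizable_of_determines[where es = "[3, 4, 5, 6, 7, 0, 1, 2]"])
    show "c a b d = 0" if "symmetric_tensor c" "\<forall>A\<in>{{3..<8}}. vanishes_on A c"
      "\<forall>i\<in>set [3, 4, 5, 6, 7, 0, 1, 2]. \<forall>j<8. c i i j = 0" "a \<le> b" "b \<le> d" "d < 8"
      "case (a, b, d) of (a, b, d) \<Rightarrow> a = b \<or> b = d \<or> 2 < a" for c :: "'k tensor" and a b d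
      proof (cases "2 < a")
      case True
      then show ?thesis using that(2,4-6) vanishes_onD[of "{3..<8}" c a b d] by simp
    next
      case False
      then show ?thesis using es square_free_entries[OF that(1) _ that(4-6)] that(3,7) by blast
    qed
  qed (simp_all add: ws_def vs_def upt_rec)
  moreover have "length ws = 15" by (simp add: ws_def)
  ultimately show ?thesis by (simp only:)
qed

text \<open>The restart beyond the exceptional case. The coordinate points leave the 56 square-free
  entries, and the seven points of \<open>vs\<close> impose \<open>7 * 8\<close> conditions on
  them.\<close>

lemma cubics_base_8:
  "realizable TYPE('k::field_char_0) {..<8} {} {..<15::nat} {} (\<lambda>l. {..<8})"
proof -
  define vs :: "(nat \<times> int) list list" where "vs = [[(2, 1), (3, 2), (6, 2), (7, 1)],
      [(2, 1), (4, 1), (5, 1), (7, 1)],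
      [(1, 1), (3, 1), (4, 1), (6, 1)],
      [(0, 1), (1, 1), (2, 1), (7, 1)],
      [(1, 1), (5, 1), (6, 1), (7, 1)],
      [(0, -1), (3, 1), (5, 1), (7, 1)],
      [(0, 1), (4, -1), (6, -1), (7, -1)]]"
  define ws :: "(nat \<times> int) list list" where "ws = map (\<lambda>i. [(i, 1)]) [0..<8] @ vs"
  have "determines 8 (\<lambda>(a, b, d). a = b \<or> b = d) vs"
    unfolding vs_def by code_simp
  then have "realizable TYPE('k::field_char_0) {..<8} {} {..<length ws} {} (\<lambda>l. {..<8})"
  proof (rule realizable_of_determines[where es = "[0..<8]"])
    show "c a b d = 0" if "symmetric_tensor c"
      "\<forall>i\<in>set [0..<8]. \<forall>j<8. c i i j = 0" "a \<le> b" "b \<le> d" "d < 8"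
      "case (a, b, d) of (a, b, d) \<Rightarrow> a = b \<or> b = d" for c :: "'k tensor" and a b d
      using square_free_entries[OF that(1) _ that(3-5)] that by auto
    have "\<forall>w\<in>set ws. fst ` set w \<subseteq> {..<8}" by (auto simp: ws_def vs_def)
    then show "list_all2 (\<lambda>w A. fst ` set w \<subseteq> A \<inter> {..<8}) ws (map (\<lambda>l. {..<8}) [0..<length ws])"
      by (simp add: list_all2_conv_all_nth)
  qed (auto simp: ws_def)
  moreover have "length ws = 15" by (simp add: ws_def vs_def)
  ultimately show ?thesis by (simp only:)
qed

text \<open>With at most two indices every entry has a repeated index, so the coordinate points are
  enough and no elimination takes place. For these \<open>N\<close> the number
  \<open>(N + 2) * (N + 1) div 6\<close> equals \<open>N\<close>.\<close>

lemma cubics_base_le_2: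
  assumes "N \<le> 2"
  shows "realizable TYPE('k::field_char_0) {..<N} {} {..<N} {} (\<lambda>l. {..<N})"
proof -
  define ws :: "(nat \<times> int) list list" where "ws = map (\<lambda>i. [(i, 1)]) [0..<N]"
  have "determines N (\<lambda>(a, b, d). a = b \<or> b = d) []"
    using assms by (auto simp: determines_def covers_def list_all_iff)
  then have "realizable TYPE('k::field_char_0) {..<N} {} {..<length ws} {} (\<lambda>l. {..<N})"
  proof (rule realizable_of_determines[where es = "[0..<N]"])
    show "c a b d = 0" if "symmetric_tensor c"
      "\<forall>i\<in>set [0..<N]. \<forall>j<N. c i i j = 0" "a \<le> b" "b \<le> d" "d < N"
      "case (a, b, d) of (a, b, d) \<Rightarrow> a = b \<or> b = d" for c :: "'k tensor" and a b d
      using square_free_entries[OF that(1) _ that(3-5)] that by auto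
  qed (auto simp: ws_def list_all2_conv_all_nth)
  moreover have "length ws = N" by (simp add: ws_def)
  ultimately show ?thesis by (simp only:)
qed

text \<open>Carries an explicit configuration to arbitrary index sets. Three blocks of coordinates
  and three kinds of points cover all base cases; some blocks are taken empty.\<close>

lemma realizable_transport:
  fixes L M P :: "'l set" and X Y Z :: "nat set"
  assumes base: "realizable TYPE('k::field) {..<x + y + z} \<Z> {..<p + q + r} {}
      (\<lambda>l. if l < p then A else if l < p + q then B else C)"
    and sub: "A \<union> B \<union> C \<subseteq> {..<x + y + z}" "\<And>A. A \<in> \<Z> \<Longrightarrow> A \<subseteq> {..<x + y + z}"
    and I: "finite X" "finite Y" "finite Z" "X \<inter> Y = {}" "X \<inter> Z = {}" "Y \<inter> Z = {}"
      "card X = x" "card Y = y" "card Z = z"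
    and D: "finite L" "finite M" "finite P" "L \<inter> M = {}" "L \<inter> P = {}" "M \<inter> P = {}"
      "card L = p" "card M = q" "card P = r"
  obtains f where "f ` {..<x} = X" "f ` {x..<x + y} = Y" "f ` {x + y..<x + y + z} = Z"
    "realizable TYPE('k::field) (X \<union> Y \<union> Z) ((`) f ` \<Z>) (L \<union> M \<union> P) {}
       (\<lambda>l. if l \<in> L then f ` A else if l \<in> M then f ` B else f ` C)"
proof -
  obtain f :: "nat \<Rightarrow> nat" where f: "inj_on f {..<x + y + z}"
    "f ` {..<x} = X" "f ` {x..<x + y} = Y" "f ` {x + y..<x + y + z} = Z"
    by (rule enumerate_partition[OF I])
  obtain g :: "nat \<Rightarrow> 'l" where g: "inj_on g {..<p + q + r}"
    "g ` {..<p} = L" "g ` {p..<p + q} = M" "g ` {p + q..<p + q + r} = P"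
    by (rule enumerate_partition[OF D])
  have split: "{..<a + b + c} = {..<a} \<union> {a..<a + b} \<union> {a + b..<a + b + c}" for a b c :: nat by auto
  have gl: "g l \<in> L \<longleftrightarrow> l < p" "g l \<in> M \<longleftrightarrow> p \<le> l \<and> l < p + q" if "l < p + q + r" for l
  proof -
    have "g l \<in> g ` {..<p} \<longleftrightarrow> l \<in> {..<p}" "g l \<in> g ` {p..<p + q} \<longleftrightarrow> l \<in> {p..<p + q}"
      by (rule inj_on_image_mem_iff[OF g(1)]; use that in auto)+
    then show "g l \<in> L \<longleftrightarrow> l < p" "g l \<in> M \<longleftrightarrow> p \<le> l \<and> l < p + q"
      unfolding g(2,3) by simp_all
  qed
  have "realizable TYPE('k) (f ` {..<x + y + z}) ((`) f ` \<Z>) (g ` {..<p + q + r}) {}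
    (\<lambda>l. if l \<in> L then f ` A else if l \<in> M then f ` B else f ` C)"
    by (rule realizable_image[OF base f(1) g(1) sub(2)]) (auto simp: gl)
  moreover have "f ` {..<x + y + z} = X \<union> Y \<union> Z" unfolding split image_Un f ..
  moreover have "g ` {..<p + q + r} = L \<union> M \<union> P" unfolding split image_Un g ..
  ultimately show ?thesis using f(2-4) by (intro that) simp_all
qed

lemma realizable_weaken:
  assumes "realizable TYPE('k::field) I \<Z> D S s" "\<And>l. l \<in> D \<union> S \<Longrightarrow> s l \<subseteq> s' l"
    "I = I'" "\<Z> = \<Z>'" "D = D'" "S = S'"
  shows "realizable TYPE('k::field) I' \<Z>' D' S' s'"
  using assms unfolding realizable_def by (metis subsetD)

section \<open>The degeneration argument\<close>

text \<open>A triple of indices that misses one of \<open>X\<close>, \<open>Y\<close>,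
  \<open>Z\<close> belongs to an entry that vanishes by hypothesis; any other triple lies in their
  union. Hence only eight coordinates matter, whatever the size of \<open>I\<close>.\<close>

lemma realizable_three_subspaces:
  fixes L M P :: "'l set"
  assumes I: "finite I" "X \<union> Y \<union> Z \<subseteq> I" "X \<inter> Y = {}" "X \<inter> Z = {}" "Y \<inter> Z = {}"
    "card X = 3" "card Y = 3" "card Z = 2"
    and D: "finite L" "finite M" "finite P" "L \<inter> M = {}" "L \<inter> P = {}" "M \<inter> P = {}"
    "card L = 2" "card M = 2" "card P = 3"
  shows "realizable TYPE('k::field_char_0) I {I - Z, I - X, I - Y} (L \<union> M \<union> P) {}
    (\<lambda>l. if l \<in> L then I - X else if l \<in> M then I - Y else I - Z)"
proof -
  have fin: "finite X" "finite Y" "finite Z" using I(1,2) by (auto intro: finite_subset)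
  have base: "realizable TYPE('k) {..<3 + 3 + 2} {{..<6}, {3..<8}, {..<3} \<union> {6..<8}} {..<2 + 2 + 3} {}
     (\<lambda>l :: nat. if l < 2 then {3..<8} else if l < 2 + 2 then {..<3} \<union> {6..<8} else {..<6})"
    using three_subspaces_base[where 'k = 'k] by (simp cong: if_cong)
  obtain f :: "nat \<Rightarrow> nat" where f: "f ` {..<3} = X" "f ` {3..<3 + 3} = Y" "f ` {3 + 3..<3 + 3 + 2} = Z"
    and r: "realizable TYPE('k) (X \<union> Y \<union> Z) ((`) f ` {{..<6}, {3..<8}, {..<3} \<union> {6..<8}}) (L \<union> M \<union> P) {}
       (\<lambda>l. if l \<in> L then f ` {3..<8} else if l \<in> M then f ` ({..<3} \<union> {6..<8}) else f ` {..<6})"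
    by (rule realizable_transport[OF base _ _ fin I(3-8) D]) auto
  have fi: "f ` {..<6} = X \<union> Y" "f ` {3..<8} = Y \<union> Z" "f ` ({..<3} \<union> {6..<8}) = X \<union> Z"
  proof -
    have "{..<6::nat} = {..<3} \<union> {3..<3 + 3}" "{3..<8::nat} = {3..<3 + 3} \<union> {3 + 3..<3 + 3 + 2}"
      "{..<3} \<union> {6..<8::nat} = {..<3} \<union> {3 + 3..<3 + 3 + 2}"
      by auto
    then show "f ` {..<6} = X \<union> Y" "f ` {3..<8} = Y \<union> Z" "f ` ({..<3} \<union> {6..<8}) = X \<union> Z"
      by (simp_all only: image_Un f)
  qed
  define K where "K = X \<union> Y \<union> Z"
  have IK: "(I - Z) \<inter> K = X \<union> Y" "(I - X) \<inter> K = Y \<union> Z" "(I - Y) \<inter> K = X \<union> Z"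
    using I(2-5) by (auto simp: K_def)
  have r0: "realizable TYPE('k) K ((\<lambda>A. A \<inter> K) ` {I - Z, I - X, I - Y}) (L \<union> M \<union> P) {}
     (\<lambda>l. if l \<in> L then Y \<union> Z else if l \<in> M then X \<union> Z else X \<union> Y)"
    using r unfolding K_def[symmetric] image_insert image_empty fi IK .
  have r1: "realizable TYPE('k) I (insert K {I - Z, I - X, I - Y}) {} {} (\<lambda>l :: 'l. I)"
  proof -
    have "c a b d = 0" if "vanishes_on K c" "vanishes_on (I - Z) c" "vanishes_on (I - X) c" "vanishes_on (I - Y) c"
      and abd: "a \<in> I" "b \<in> I" "d \<in> I" for c :: "'k tensor" and a b d
    proof -
      consider "{a, b, d} \<subseteq> I - X" | "{a, b, d} \<subseteq> I - Y" | "{a, b, d} \<subseteq> I - Z" | "{a, b, d} \<subseteq> K"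
        using abd I(3-5) unfolding K_def by blast
      then show ?thesis by cases (use that(1-4) vanishes_onD in metis)+
    qed
    then show ?thesis
      unfolding realizable_def rigid_def vanishes_on_def[of I] by simp
  qed
  show ?thesis
    by (rule realizable_step[OF I(1) _ r0 r1]) (use I(2-5) in \<open>auto simp: K_def\<close>)
qed

text \<open>With \<open>w = card I - 6\<close>, there are \<open>36 + 9 * w\<close> entries meeting
  both \<open>X\<close> and \<open>Y\<close>. The points on the subspaces impose 3 conditions each,
  the three others \<open>card I\<close> each, which is the same number. The induction removes two
  coordinates outside \<open>X\<close> and \<open>Y\<close>, so it needs the starts 6 and 7.\<close>

lemma realizable_two_subspaces:
  fixes L M P :: "'l set"
  assumes "finite I" "X \<subseteq> I" "Y \<subseteq> I" "X \<inter> Y = {}" "card X = 3" "card Y = 3"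
    and "finite L" "finite M" "finite P" "L \<inter> M = {}" "L \<inter> P = {}" "M \<inter> P = {}"
    and "card L = card I - 3" "card M = card I - 3" "card P = 3"
  shows "realizable TYPE('k::field_char_0) I {I - X, I - Y} (L \<union> M \<union> P) {}
    (\<lambda>l. if l \<in> L then I - X else if l \<in> M then I - Y else I)"
  using assms
proof (induction "card I" arbitrary: I L M rule: less_induct)
  case less
  note I = less.prems(1-6) and D = less.prems(7-15)
  have fin: "finite X" "finite Y" using I by (auto intro: finite_subset)
  define W where "W = I - X - Y"
  have W: "finite W" "X \<inter> W = {}" "Y \<inter> W = {}" "I = X \<union> Y \<union> W" using I by (auto simp: W_def)
  have "card (X \<union> Y) = 6" using I fin by (subst card_Un_disjoint) auto
  then have cI: "card I = 6 + card W"
    using W fin I(4) by (metis card_Un_disjoint finite_UnI Int_Un_distrib2 sup_bot.right_neutral)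
  consider (0) "card W = 0" | (1) "card W = 1" | (2) "2 \<le> card W" by linarith
  then show ?case
  proof cases
    case 0
    have base: "realizable TYPE('k) {..<3 + 3 + 0} {{3..<6}, {..<3}} {..<3 + 3 + 3} {}
      (\<lambda>l :: nat. if l < 3 then {3..<6} else if l < 3 + 3 then {..<3} else {..<6})"
      using two_subspaces_base_6[where 'k = 'k] by (simp cong: if_cong)
    have D': "card L = 3" "card M = 3" using D cI 0 by auto
    obtain f :: "nat \<Rightarrow> nat" where f: "f ` {..<3} = X" "f ` {3..<3 + 3} = Y" "f ` {3 + 3..<3 + 3 + 0} = W"
      and r: "realizable TYPE('k) (X \<union> Y \<union> W) ((`) f ` {{3..<6}, {..<3}}) (L \<union> M \<union> P) {}
         (\<lambda>l. if l \<in> L then f ` {3..<6} else if l \<in> M then f ` {..<3} else f ` {..<6})"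
      by (rule realizable_transport[OF base _ _ fin W(1) I(4) W(2,3) I(5,6) 0 D(1-6) D' D(9)]) auto
    have "{..<6::nat} = {..<3} \<union> {3..<3 + 3}" "{3..<6::nat} = {3..<3 + 3}" by auto
    then have "f ` {..<6} = X \<union> Y" "f ` {3..<6} = Y" by (simp_all only: image_Un f)
    moreover have "W = {}" using 0 W(1) by simp
    ultimately show ?thesis
      using r f(1) I(4) W(4) by (elim realizable_weaken) auto
  next
    case 1
    have base: "realizable TYPE('k) {..<3 + 3 + 1} {{3..<7}, {..<3} \<union> {6}} {..<4 + 4 + 3} {}
      (\<lambda>l :: nat. if l < 4 then {3..<7} else if l < 4 + 4 then {..<3} \<union> {6} else {..<7})"
      using two_subspaces_base_7[where 'k = 'k] by (simp cong: if_cong)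
    have D': "card L = 4" "card M = 4" using D cI 1 by auto
    obtain f :: "nat \<Rightarrow> nat" where f: "f ` {..<3} = X" "f ` {3..<3 + 3} = Y" "f ` {3 + 3..<3 + 3 + 1} = W"
      and r: "realizable TYPE('k) (X \<union> Y \<union> W) ((`) f ` {{3..<7}, {..<3} \<union> {6}}) (L \<union> M \<union> P) {}
         (\<lambda>l. if l \<in> L then f ` {3..<7} else if l \<in> M then f ` ({..<3} \<union> {6}) else f ` {..<7})"
      by (rule realizable_transport[OF base _ _ fin W(1) I(4) W(2,3) I(5,6) 1 D(1-6) D' D(9)]) auto
    have "{..<7::nat} = {..<3} \<union> {3..<3 + 3} \<union> {3 + 3..<3 + 3 + 1}"
      "{3..<7::nat} = {3..<3 + 3} \<union> {3 + 3..<3 + 3 + 1}"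
      "{..<3} \<union> {6::nat} = {..<3} \<union> {3 + 3..<3 + 3 + 1}" by auto
    then have "f ` {..<7} = X \<union> Y \<union> W" "f ` {3..<7} = Y \<union> W" "f ` ({..<3} \<union> {6}) = X \<union> W"
      by (simp_all only: image_Un f)
    moreover have "Y \<union> W = I - X" "X \<union> W = I - Y" using W I(4) by auto
    ultimately show ?thesis
      using r W(4) by (elim realizable_weaken) auto
  next
    case 2
    obtain Z where Z: "Z \<subseteq> W" "card Z = 2" "finite Z" using obtain_subset_with_card_n[OF 2] by blast
    have "2 \<le> card L" "2 \<le> card M" using D cI by auto
    then obtain L2 M2 where LM: "L2 \<subseteq> L" "card L2 = 2" "finite L2" "M2 \<subseteq> M" "card M2 = 2" "finite M2"
      using obtain_subset_with_card_n by metis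
    have ZI: "Z \<subseteq> I" "X \<inter> Z = {}" "Y \<inter> Z = {}" using Z(1) W by auto
    have cZ: "card (I - Z) = card I - 2" using Z ZI I(1) by (simp add: card_Diff_subset)
    \<comment> \<open>Only the points of \<open>P\<close> are used twice. A point of
      \<open>L - L2\<close> gives nothing new in the residual problem: its derivatives along
      \<open>Z\<close> involve entries with all indices in \<open>I - X\<close>, where the cubic
      already vanishes; likewise for \<open>M - M2\<close>.\<close>
    have IH: "realizable TYPE('k) (I - Z) {I - Z - X, I - Z - Y} ((L - L2) \<union> (M - M2) \<union> P) {}
      (\<lambda>l. if l \<in> L - L2 then I - Z - X else if l \<in> M - M2 then I - Z - Y else I - Z)"
    proof (rule less.hyps)
      show "card (I - Z) < card I" using cZ cI 2 by linarith
      show "card (L - L2) = card (I - Z) - 3" "card (M - M2) = card (I - Z) - 3"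
        using LM D cZ cI 2 by (auto simp: card_Diff_subset)
    qed (use I D ZI in auto)
    have D2: "realizable TYPE('k) I {I - Z, I - X, I - Y} (L2 \<union> M2 \<union> P) {}
      (\<lambda>l. if l \<in> L2 then I - X else if l \<in> M2 then I - Y else I - Z)"
      by (rule realizable_three_subspaces) (use I D ZI LM Z in auto)
    have eq: "(\<lambda>A. A \<inter> (I - Z)) ` {I - X, I - Y} = {I - Z - X, I - Z - Y}" by auto
    show ?thesis
      by (rule realizable_step[OF I(1) _ IH[folded eq] D2])
        (use D LM ZI in \<open>auto split: if_splits\<close>)
  qed
qed


text \<open>A plane cubic singular at the three coordinate points is a multiple of
  \<open>x * y * z\<close>, which does not vanish at the all-ones vector. This is where the simple
  points of the divisible residue class end up.\<close>

lemma realizable_plane_cubics: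
  fixes P R :: "'l set"
  assumes "card I = 3" "finite P" "card P = 3" "card R = 1" "P \<inter> R = {}"
  shows "realizable TYPE('k::field_char_0) I {} P R (\<lambda>l. I)"
proof -
  have "finite I" using assms(1) by (simp add: card_ge_0_finite)
  then obtain h where h: "bij_betw h P I"
    using assms finite_same_card_bij by metis
  obtain x y z where I: "I = {x, y, z}" "x \<noteq> y" "x \<noteq> z" "y \<noteq> z"
    using assms(1) by (auto simp: card_3_iff)
  define u :: "'l \<Rightarrow> nat \<Rightarrow> 'k" where
    "u l a = (if a \<in> I \<and> (l \<in> R \<or> a = h l) then 1 else 0)" for l a
  have "rigid I {} P R u"
    unfolding rigid_def
  proof (intro allI impI)
    fix c :: "'k tensor"
    assume c: "symmetric_tensor c" "\<forall>l\<in>P. \<forall>j\<in>I. grad I c (u l) j = 0"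
      "\<forall>l\<in>R. cubic_value I c (u l) = 0"
    have sq: "c a a j = 0" if "a \<in> I" "j \<in> I" for a j
    proof -
      from that(1) obtain l where l: "l \<in> P" "a = h l" using h unfolding bij_betw_def by blast
      have "grad I c (u l) j = grad {a} c (u l) j"
        using l that assms(5) \<open>finite I\<close> by (intro grad_restrict) (auto simp: u_def)
      then show ?thesis using c(2) l that by (auto simp: grad_def u_def)
    qed
    have s: "c a b d = c b a d" "c a b d = c a d b" for a b d
      using c(1) unfolding symmetric_tensor_def by blast+
    have perm: "c x z y = c x y z" "c y x z = c x y z" "c y z x = c x y z" "c z x y = c x y z" "c z y x = c x y z"
      using s by metis+
    have zero: "c a b d = 0" if "a \<in> I" "b \<in> I" "d \<in> I" "a = b \<or> b = d \<or> a = d" for a b d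
      using that sq s by metis
    obtain l where l: "l \<in> R" using assms(4) by fastforce
    have "cubic_value I c (u l) = (\<Sum>d\<in>I. \<Sum>a\<in>I. \<Sum>b\<in>I. c a b d)"
      using l by (simp add: cubic_value_def grad_def u_def)
    also have "\<dots> = 6 * c x y z"
      using I zero by (simp add: perm)
    finally have "c x y z = 0" using c(3) l by simp
    then show "vanishes_on I c"
      unfolding vanishes_on_def using zero perm by (auto simp: I)
  qed
  then show ?thesis
    unfolding realizable_def by (intro exI[of _ u]) (auto simp: u_def)
qed

text \<open>This is \<open>k_n = k_{n-3} + (n + 1)\<close> for \<open>n = m + 2\<close>; the
  increment of the numerator is a multiple of 6, so the floor commutes with it.\<close>

lemma num_points_step: "(m + 5) * (m + 4) div 6 = (m + 2) * (m + 1) div 6 + (m + 3)" for m :: nat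
proof -
  have "(m + 5) * (m + 4) = (m + 2) * (m + 1) + (m + 3) * 6" by (simp add: algebra_simps)
  then show ?thesis by (simp only: div_mult_self1)
qed

text \<open>A point on the subspace imposes its 3 normal derivatives, the points of \<open>P\<close>
  impose \<open>card I\<close> conditions each and \<open>R\<close> one: as many as there are
  entries with an index in \<open>X\<close>. The value 5 must be excluded, since together with two
  double points on a line it would settle the exceptional case of seven points in
  \<open>P^4\<close>. Therefore 8, from which the induction would step to 5, is a start.\<close>

lemma realizable_one_subspace:
  fixes L P R :: "'l set"
  assumes "finite I" "X \<subseteq> I" "card X = 3" "card I \<noteq> 5"
    and "finite L" "finite P" "finite R" "L \<inter> P = {}" "L \<inter> R = {}" "P \<inter> R = {}"
    and "card L = (card I - 1) * (card I - 2) div 6" "card P = card I"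
      "card R = (if 3 dvd card I then 1 else 0)"
  shows "realizable TYPE('k::field_char_0) I {I - X} (L \<union> P) R (\<lambda>l. if l \<in> L then I - X else I)"
  using assms
proof (induction "card I" arbitrary: I L P R rule: less_induct)
  case less
  note I = less.prems(1-4) and D = less.prems(5-13)
  have fin: "finite X" "finite (I - X)" using I by (auto intro: finite_subset)
  have XW: "X \<union> (I - X) = I" "X \<inter> (I - X) = {}" using I(2) by auto
  have "3 \<le> card I" using card_mono[OF I(1,2)] I(3) by simp
  have cW: "card (I - X) = card I - 3" using I fin by (simp add: card_Diff_subset)
  consider (3) "card I = 3" | (4) "card I = 4" | (8) "card I = 8" | (step) "6 \<le> card I" "card I - 3 \<noteq> 5"
    using \<open>3 \<le> card I\<close> I(4) by linarith
  then show ?case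
  proof cases
    case 3
    then have "I = X" using I by (metis card_subset_eq)
    moreover have "L = {}" using D 3 by simp
    ultimately have "realizable TYPE('k) I {} (L \<union> P) R (\<lambda>l. I)"
      using realizable_plane_cubics[of I P R] 3 D by simp
    then show ?thesis
      unfolding realizable_def rigid_def using \<open>I = X\<close> \<open>L = {}\<close> by (simp add: vanishes_on_def)
  next
    case 4
    have base: "realizable TYPE('k) {..<3 + 1 + 0} {{3}} {..<1 + 0 + 4} {}
      (\<lambda>l :: nat. if l < 1 then {3} else if l < 1 + 0 then {} else {..<4})"
      using one_subspace_base_4[where 'k = 'k] by (elim realizable_weaken) auto
    have D': "card L = 1" "card P = 4" "R = {}" using D 4 by auto
    obtain f :: "nat \<Rightarrow> nat" where f: "f ` {..<3} = X" "f ` {3..<3 + 1} = I - X" "f ` {3 + 1..<3 + 1 + 0} = {}"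
      and r: "realizable TYPE('k) (X \<union> (I - X) \<union> {}) ((`) f ` {{3}}) (L \<union> {} \<union> P) {}
         (\<lambda>l. if l \<in> L then f ` {3} else if l \<in> {} then f ` {} else f ` {..<4})"
      by (rule realizable_transport[OF base _ _ fin finite.emptyI, of L "{}" P]) (use I D D' cW 4 in auto)
    have "{..<4::nat} = {..<3} \<union> {3..<3 + 1}" "{3::nat} = {3..<3 + 1}" by auto
    then have "f ` {..<4} = I" "f ` {3} = I - X" by (simp_all only: image_Un f XW)
    then show ?thesis using r XW D'(3) by (elim realizable_weaken) auto
  next
    case 8
    have base: "realizable TYPE('k) {..<3 + 5 + 0} {{3..<8}} {..<7 + 0 + 8} {}
      (\<lambda>l :: nat. if l < 7 then {3..<8} else if l < 7 + 0 then {} else {..<8})"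
      using one_subspace_base_8[where 'k = 'k] by (elim realizable_weaken) auto
    have D': "card L = 7" "card P = 8" "R = {}" using D 8 by auto
    obtain f :: "nat \<Rightarrow> nat" where f: "f ` {..<3} = X" "f ` {3..<3 + 5} = I - X" "f ` {3 + 5..<3 + 5 + 0} = {}"
      and r: "realizable TYPE('k) (X \<union> (I - X) \<union> {}) ((`) f ` {{3..<8}}) (L \<union> {} \<union> P) {}
         (\<lambda>l. if l \<in> L then f ` {3..<8} else if l \<in> {} then f ` {} else f ` {..<8})"
      by (rule realizable_transport[OF base _ _ fin finite.emptyI, of L "{}" P]) (use I D D' cW 8 in auto)
    have "{..<8::nat} = {..<3} \<union> {3..<3 + 5}" "{3..<8::nat} = {3..<3 + 5}" by auto
    then have "f ` {..<8} = I" "f ` {3..<8} = I - X" by (simp_all only: image_Un f XW)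
    then show ?thesis using r XW D'(3) by (elim realizable_weaken) auto
  next
    case step
    have "3 \<le> card (I - X)" using cW step by linarith
    then obtain Y where Y: "Y \<subseteq> I - X" "card Y = 3" "finite Y" using obtain_subset_with_card_n by blast
    have cY: "card (I - Y) = card I - 3" using Y I(1) by (subst card_Diff_subset) auto
    define m where "m = card I - 6"
    have m: "card I = m + 6" using step by (simp add: m_def)
    have cL: "card L = (m + 2) * (m + 1) div 6 + (m + 3)"
      using D(7) m num_points_step[of m] by (simp add: add.commute)
    then obtain L2 where L2: "L2 \<subseteq> L" "card L2 = m + 3" "finite L2"
      using obtain_subset_with_card_n[of "m + 3" L] by auto
    obtain P2 where P2: "P2 \<subseteq> P" "card P2 = 3" "finite P2"
      using obtain_subset_with_card_n[of 3 P] D(8) m by auto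
    \<comment> \<open>The second subspace is \<open>I - Y\<close>. It receives the points
      \<open>L - L2\<close>, now in both subspaces, all but three of the free points, and the simple
      point. The points of \<open>P - P2\<close> return in the residual problem with their
      derivatives along \<open>Y\<close>.\<close>
    have IH: "realizable TYPE('k) (I - Y) {I - Y - X} ((L - L2) \<union> (P - P2)) R
      (\<lambda>l. if l \<in> L - L2 then I - Y - X else I - Y)"
    proof (rule less.hyps)
      show "card (I - Y) < card I" "card (I - Y) \<noteq> 5" using cY step by linarith+
      show "card (L - L2) = (card (I - Y) - 1) * (card (I - Y) - 2) div 6"
        using L2 cL m cY by (simp add: card_Diff_subset)
      show "card (P - P2) = card (I - Y)" using P2 D(8) cY by (simp add: card_Diff_subset)
      have "3 dvd m + 6 \<longleftrightarrow> 3 dvd m + 3" by presburger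
      then show "card R = (if 3 dvd card (I - Y) then 1 else 0)" using D(9) cY m by simp
    qed (use I D Y in auto)
    have C: "realizable TYPE('k) I {I - Y, I - X} (L2 \<union> (P - P2) \<union> P2) {}
      (\<lambda>l. if l \<in> L2 then I - X else if l \<in> P - P2 then I - Y else I)"
      unfolding insert_commute[of "I - Y"]
      by (rule realizable_two_subspaces) (use I D Y L2 P2 m in \<open>auto simp: card_Diff_subset\<close>)
    have eq: "(\<lambda>A. A \<inter> (I - Y)) ` {I - X} = {I - Y - X}" by auto
    show ?thesis
      by (rule realizable_step[OF I(1) _ IH[folded eq] C])
        (use D L2 P2 Y in \<open>auto split: if_splits\<close>)
  qed
qed

text \<open>Each step of three coordinates adds \<open>card I\<close> double points and, in the
  class divisible by 3, one simple point. The classes start at 0, 1 and 2; the last one must start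
  again at 8 because 5 is exceptional.\<close>

lemma realizable_cubics:
  fixes D S :: "'l set"
  assumes "finite I" "card I \<noteq> 5" "finite D" "finite S" "D \<inter> S = {}"
    and "card D = (card I + 2) * (card I + 1) div 6"
    and "card S = (if 3 dvd card I then card I div 3 else 0)"
  shows "realizable TYPE('k::field_char_0) I {} D S (\<lambda>l. I)"
  using assms
proof (induction "card I" arbitrary: I D S rule: less_induct)
  case less
  note I = less.prems(1,2) and D = less.prems(3-7)
  consider (small) "card I \<le> 2" | (8) "card I = 8" | (step) "3 \<le> card I" "card I - 3 \<noteq> 5"
    by linarith
  then show ?case
  proof cases
    case small
    then consider "card I = 0" | "card I = 1" | "card I = 2" by linarith
    then have "card D = card I" "card S = 0" using D by (cases; simp)+
    then have D': "card D = card I" "S = {}" using D(2) by auto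
    obtain f :: "nat \<Rightarrow> nat"
      where r: "realizable TYPE('k) (I \<union> {} \<union> {}) ((`) f ` {}) (D \<union> {} \<union> {}) {}
         (\<lambda>l. if l \<in> D then f ` {..<card I} else if l \<in> {} then f ` {} else f ` {})"
      and f: "f ` {..<card I} = I"
    proof (rule realizable_transport[of "card I" 0 0 "{}" "card I" 0 0 "{..<card I}" "{}" "{}" I "{}" "{}" D "{}" "{}"])
      show "realizable TYPE('k) {..<card I + 0 + 0} {} {..<card I + 0 + 0} {}
        (\<lambda>l. if l < card I then {..<card I} else if l < card I + 0 then {} else {})"
        using cubics_base_le_2[OF small, where 'k = 'k] by (elim realizable_weaken) auto
    qed (use I D D' in auto)
    then show ?thesis using D'(2) by (elim realizable_weaken) auto
  next
    case 8
    then have D': "card D = 15" "S = {}" using D by auto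
    obtain f :: "nat \<Rightarrow> nat"
      where r: "realizable TYPE('k) (I \<union> {} \<union> {}) ((`) f ` {}) (D \<union> {} \<union> {}) {}
         (\<lambda>l. if l \<in> D then f ` {..<8} else if l \<in> {} then f ` {} else f ` {})"
      and f: "f ` {..<8} = I"
    proof (rule realizable_transport[of 8 0 0 "{}" 15 0 0 "{..<8}" "{}" "{}" I "{}" "{}" D "{}" "{}"])
      show "realizable TYPE('k) {..<8 + 0 + 0} {} {..<15 + 0 + 0} {}
        (\<lambda>l :: nat. if l < 15 then {..<8} else if l < 15 + 0 then {} else {})"
        using cubics_base_8[where 'k = 'k] by (elim realizable_weaken) auto
    qed (use I D D' 8 in auto)
    then show ?thesis using D'(2) by (elim realizable_weaken) auto
  next
    case step
    obtain X where X: "X \<subseteq> I" "card X = 3" "finite X" using obtain_subset_with_card_n[OF step(1)] by blast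
    have cX: "card (I - X) = card I - 3" using X I(1) by (subst card_Diff_subset) auto
    define m where "m = card I - 3"
    have m: "card I = m + 3" using step by (simp add: m_def)
    have cD: "card D = (m + 2) * (m + 1) div 6 + (m + 3)"
      using D(4) m num_points_step[of m] by (simp add: add.commute)
    then obtain P where P: "P \<subseteq> D" "card P = m + 3" "finite P"
      using obtain_subset_with_card_n[of "m + 3" D] by auto
    have dvd: "3 dvd m + 3 \<longleftrightarrow> 3 dvd m" by presburger
    have "(if 3 dvd m then 1 else 0) \<le> card S" using D(5) m dvd by auto
    then obtain R where R: "R \<subseteq> S" "card R = (if 3 dvd m then 1 else 0)" "finite R"
      using obtain_subset_with_card_n by blast
    have IH: "realizable TYPE('k) (I - X) {} (D - P) (S - R) (\<lambda>l. I - X)"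
    proof (rule less.hyps)
      show "card (I - X) < card I" "card (I - X) \<noteq> 5" using cX step by linarith+
      show "card (D - P) = (card (I - X) + 2) * (card (I - X) + 1) div 6"
        using P cD m cX by (simp add: card_Diff_subset)
      show "card (S - R) = (if 3 dvd card (I - X) then card (I - X) div 3 else 0)"
        using R D(5) cX m dvd by (simp add: card_Diff_subset)
    qed (use I D in auto)
    then have IH': "realizable TYPE('k) (I - X) ((\<lambda>A. A \<inter> (I - X)) ` {}) (D - P) (S - R) (\<lambda>l. I - X)"
      by simp
    \<comment> \<open>The points \<open>D - P\<close> occur a second time: having determined the
      cubic on \<open>I - X\<close>, they now contribute their derivatives along
      \<open>X\<close>.\<close>
    have B: "realizable TYPE('k) I {I - X} ((D - P) \<union> P) R (\<lambda>l. if l \<in> D - P then I - X else I)"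
    proof (rule realizable_one_subspace)
      show "card (D - P) = (card I - 1) * (card I - 2) div 6"
        using P cD m by (simp add: card_Diff_subset)
    qed (use I D X P R m dvd in auto)
    show ?thesis
      by (rule realizable_step[OF I(1) _ IH' B])
        (use D P R in \<open>auto split: if_splits\<close>)
  qed
qed

section \<open>Evaluation and derivatives of polynomials\<close>

abbreviation lookup where "lookup \<equiv> Poly_Mapping.lookup"
abbreviation keys where "keys \<equiv> Poly_Mapping.keys"
abbreviation single where "single \<equiv> Poly_Mapping.single"

definition monom_eval :: "('v \<Rightarrow>\<^sub>0 nat) \<Rightarrow> ('v \<Rightarrow> 'k::field) \<Rightarrow> 'k" where
  "monom_eval m v = (\<Prod>x\<in>keys m. v x ^ lookup m x)"

lemma poly_mapping_sum_single: "f = (\<Sum>m\<in>keys f. single m (lookup f m))"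
proof (rule poly_mapping_eqI)
  fix m
  have "lookup (\<Sum>m\<in>keys f. single m (lookup f m)) m = (\<Sum>m'\<in>keys f. if m' = m then lookup f m' else 0)"
    unfolding lookup_sum by (intro sum.cong) (auto simp: lookup_single when_def)
  also have "\<dots> = lookup f m" by (simp add: in_keys_iff)
  finally show "lookup f m = lookup (\<Sum>m\<in>keys f. single m (lookup f m)) m" by simp
qed

lemma mpoly_induct [case_names single add]:
  fixes f :: "'a \<Rightarrow>\<^sub>0 'b::comm_monoid_add"
  assumes "\<And>m c. P (single m c)" "\<And>f g. P f \<Longrightarrow> P g \<Longrightarrow> P (f + g)"
  shows "P f"
proof -
  have "P 0" using assms(1)[of undefined 0] by simp
  have "P (\<Sum>m\<in>A. single m (lookup f m))" if "finite A" for A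
    using that by (induction A rule: finite_induct) (use assms \<open>P 0\<close> in auto)
  then show ?thesis using poly_mapping_sum_single[of f] finite_keys by metis
qed

lemma monom_eval_superset:
  assumes "finite A" "keys m \<subseteq> A"
  shows "monom_eval m v = (\<Prod>x\<in>A. v x ^ lookup m x)"
  unfolding monom_eval_def using assms by (intro prod.mono_neutral_left) (auto simp: in_keys_iff)

lemma monom_eval_0 [simp]: "monom_eval 0 v = 1"
  by (simp add: monom_eval_def)

lemma monom_eval_add: "monom_eval (m + m') v = monom_eval m v * monom_eval m' v"
proof -
  have "finite (keys m \<union> keys m')" "keys (m + m') \<subseteq> keys m \<union> keys m'" using keys_add[of m m'] by auto
  then show ?thesis
    by (simp add: monom_eval_superset[of "keys m \<union> keys m'"] lookup_add power_add prod.distrib)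
qed

lemma monom_eval_single [simp]: "monom_eval (single x i) v = v x ^ i"
  by (simp add: monom_eval_def)

lemma mpoly_eval_superset:
  assumes "finite A" "keys f \<subseteq> A"
  shows "mpoly_eval f v = (\<Sum>m\<in>A. lookup f m * monom_eval m v)"
  unfolding mpoly_eval_def monom_eval_def[symmetric]
  using assms by (intro sum.mono_neutral_left) (auto simp: in_keys_iff)

lemma mpoly_eval_0 [simp]: "mpoly_eval 0 v = 0"
  by (simp add: mpoly_eval_def)

lemma mpoly_eval_add: "mpoly_eval (f + g) v = mpoly_eval f v + mpoly_eval g v"
proof -
  have "finite (keys f \<union> keys g)" "keys (f + g) \<subseteq> keys f \<union> keys g" using keys_add[of f g] by auto
  then show ?thesis
    by (simp add: mpoly_eval_superset[of "keys f \<union> keys g"] lookup_add distrib_right sum.distrib)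
qed

lemma mpoly_eval_single [simp]: "mpoly_eval (single m c) v = c * monom_eval m v"
  by (simp add: mpoly_eval_superset[of "{m}"])

lemma mpoly_eval_mult: "mpoly_eval (f * g) v = mpoly_eval f v * mpoly_eval g v"
proof (induction f rule: mpoly_induct)
  case (single m c)
  show ?case
    by (induction g rule: mpoly_induct)
      (auto simp: mult_single monom_eval_add distrib_left mpoly_eval_add)
qed (simp add: distrib_right mpoly_eval_add)

lemma mpoly_eval_uminus: "mpoly_eval (- f) v = - mpoly_eval f v"
  using mpoly_eval_add[of f "- f" v] by (simp add: minus_unique)

lemma mpoly_eval_diff: "mpoly_eval (f - g) v = mpoly_eval f v - mpoly_eval g v"
  using mpoly_eval_add[of f "- g" v] by (simp add: mpoly_eval_uminus)

lemma mpoly_eval_1 [simp]: "mpoly_eval 1 v = 1"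
  using mpoly_eval_single[of 0 1 v] by simp

lemma mpoly_eval_power: "mpoly_eval (f ^ i) v = mpoly_eval f v ^ i"
  by (induction i) (auto simp: mpoly_eval_mult)

lemma mpoly_eval_sum: "mpoly_eval (sum f A) v = (\<Sum>x\<in>A. mpoly_eval (f x) v)"
  by (induction A rule: infinite_finite_induct) (auto simp: mpoly_eval_add)

lemma mpoly_eval_prod: "mpoly_eval (prod f A) v = (\<Prod>x\<in>A. mpoly_eval (f x) v)"
  by (induction A rule: infinite_finite_induct) (auto simp: mpoly_eval_mult)

lemma mpoly_eval_scale: "mpoly_eval (mpoly_scale c f) v = c * mpoly_eval f v"
  by (simp add: mpoly_scale_def mpoly_eval_mult)

text \<open>The subtraction of exponents truncates where \<open>x_j\<close> does not occur, but the
  coefficient is then zero.\<close>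

definition pderiv_mpoly :: "'v \<Rightarrow> ('v, 'k::field) mpoly \<Rightarrow> ('v, 'k) mpoly" where
  "pderiv_mpoly j f = (\<Sum>m\<in>keys f. single (m - single j 1) (of_nat (lookup m j) * lookup f m))"

lemma lookup_pderiv:
  "lookup (pderiv_mpoly j f) m = of_nat (lookup m j + 1) * lookup f (m + single j 1)"
proof -
  have "of_nat (lookup m' j) * lookup f m' * (if m' - single j 1 = m then 1 else 0) =
      (if m' = m + single j 1 then of_nat (lookup m j + 1) * lookup f m' else 0)" for m'
  proof (cases "lookup m' j = 0")
    case True
    then have "m' \<noteq> m + single j 1" by (auto simp: lookup_add)
    then show ?thesis using True by simp
  next
    case False
    have "m' - single j 1 = m \<longleftrightarrow> m' = m + single j 1"
    proof
      assume "m' - single j 1 = m"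
      then show "m' = m + single j 1"
        using False by (intro poly_mapping_eqI) (auto simp: lookup_add lookup_minus lookup_single when_def)
    qed simp
    then show ?thesis by (auto simp: lookup_add)
  qed
  note * = this
  have "lookup (pderiv_mpoly j f) m =
      (\<Sum>m'\<in>keys f. of_nat (lookup m' j) * lookup f m' * (if m' - single j 1 = m then 1 else 0))"
    unfolding pderiv_mpoly_def lookup_sum by (intro sum.cong) (auto simp: lookup_single when_def)
  also have "\<dots> = of_nat (lookup m j + 1) * lookup f (m + single j 1)"
    unfolding * by (simp add: in_keys_iff)
  finally show ?thesis .
qed

lemma pderiv_add: "pderiv_mpoly j (f + g) = pderiv_mpoly j f + pderiv_mpoly j g"
  by (rule poly_mapping_eqI) (simp add: lookup_pderiv lookup_add distrib_left)

lemma pderiv_0 [simp]: "pderiv_mpoly j 0 = 0"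
  by (rule poly_mapping_eqI) (simp add: lookup_pderiv)

lemma pderiv_scale: "pderiv_mpoly j (mpoly_scale c f) = mpoly_scale c (pderiv_mpoly j f)"
  by (rule poly_mapping_eqI)
    (simp add: lookup_pderiv mpoly_scale_def mult_map_scale_conv_mult[symmetric] map.rep_eq when_def)

lemma pderiv_single:
  "pderiv_mpoly j (single m c) = single (m - single j 1) (of_nat (lookup m j) * c)"
  by (cases "c = 0") (simp_all add: pderiv_mpoly_def)

lemma pderiv_commute: "pderiv_mpoly i (pderiv_mpoly j f) = pderiv_mpoly j (pderiv_mpoly i f)"
  by (rule poly_mapping_eqI)
    (auto simp: lookup_pderiv lookup_add lookup_single when_def add_ac)

lemma pderiv_mult: "pderiv_mpoly j (f * g) = pderiv_mpoly j f * g + f * pderiv_mpoly j g"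
proof (induction f rule: mpoly_induct)
  case (single m c)
  show ?case
  proof (induction g rule: mpoly_induct)
    case (single m' c')
    have *: "single (m + m' - single j 1) (of_nat (lookup m j) * x) = single (m - single j 1 + m') (of_nat (lookup m j) * x)"
      for m m' :: "'a \<Rightarrow>\<^sub>0 nat" and x :: 'b
    proof (cases "lookup m j = 0")
      case False
      then have "m + m' - single j 1 = m - single j 1 + m'"
        by (intro poly_mapping_eqI) (auto simp: lookup_add lookup_minus lookup_single when_def)
      then show ?thesis by simp
    qed simp
    show ?case
      using *[of m m' "c * c'"] *[of m' m "c * c'"]
      by (simp add: mult_single pderiv_single lookup_add distrib_left distrib_right single_add add.commute mult_ac)
  qed (simp add: distrib_left pderiv_add add_ac)
qed (simp add: distrib_right pderiv_add add_ac)

section \<open>Forms\<close>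

lemma coord_ring_0 [simp]: "0 \<in> coord_ring n"
  and coord_ring_1 [simp]: "1 \<in> coord_ring n"
  by (auto simp: coord_ring_def)

lemma coord_ring_add: "f \<in> coord_ring n \<Longrightarrow> g \<in> coord_ring n \<Longrightarrow> f + g \<in> coord_ring n"
  using keys_add[of f g] by (auto simp: coord_ring_def)

lemma coord_ring_mult: "f \<in> coord_ring n \<Longrightarrow> g \<in> coord_ring n \<Longrightarrow> f * g \<in> coord_ring n"
proof -
  assume fg: "f \<in> coord_ring n" "g \<in> coord_ring n"
  show ?thesis
    unfolding coord_ring_def
  proof (intro CollectI ballI)
    fix m assume "m \<in> keys (f * g)"
    then obtain a b where "m = a + b" "a \<in> keys f" "b \<in> keys g" using keys_mult[of f g] by blast
    then show "keys m \<subseteq> {..n}" using fg keys_add[of a b] unfolding coord_ring_def by blast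
  qed
qed

lemma coord_ring_single: "c = 0 \<or> keys m \<subseteq> {..n} \<Longrightarrow> single m c \<in> coord_ring n"
  by (auto simp: coord_ring_def)

lemma coord_ring_sum: "(\<And>x. x \<in> A \<Longrightarrow> f x \<in> coord_ring n) \<Longrightarrow> sum f A \<in> coord_ring n"
  by (induction A rule: infinite_finite_induct) (auto intro: coord_ring_add)

lemma coord_ring_prod: "(\<And>x. x \<in> A \<Longrightarrow> f x \<in> coord_ring n) \<Longrightarrow> prod f A \<in> coord_ring n"
  by (induction A rule: infinite_finite_induct) (auto intro: coord_ring_mult)

lemma monom_degree_superset:
  assumes "finite A" "keys m \<subseteq> A"
  shows "monom_degree m = (\<Sum>x\<in>A. lookup m x)"
  unfolding monom_degree_def using assms by (intro sum.mono_neutral_left) (auto simp: in_keys_iff)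

lemma monom_degree_add: "monom_degree (m + m') = monom_degree m + monom_degree m'"
proof -
  have "finite (keys m \<union> keys m')" "keys (m + m') \<subseteq> keys m \<union> keys m'" using keys_add[of m m'] by auto
  then show ?thesis
    by (simp add: monom_degree_superset[of "keys m \<union> keys m'"] lookup_add sum.distrib)
qed

lemma monom_degree_single [simp]: "monom_degree (single x i) = i"
  by (simp add: monom_degree_def)

lemma monom_degree_0 [simp]: "monom_degree 0 = 0"
  by (simp add: monom_degree_def)

lemma monom_degree_eq_0_iff: "monom_degree m = 0 \<longleftrightarrow> m = 0"
proof
  assume "monom_degree m = 0"
  then have "lookup m x = 0" for x by (cases "x \<in> keys m") (auto simp: monom_degree_def in_keys_iff)
  then show "m = 0" by (intro poly_mapping_eqI) simp
qed simp

lemma forms_0 [simp]: "0 \<in> forms n d"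
  by (auto simp: forms_def)

lemma forms_add: "f \<in> forms n d \<Longrightarrow> g \<in> forms n d \<Longrightarrow> f + g \<in> forms n d"
  using keys_add[of f g] by (auto simp: forms_def coord_ring_add)

lemma forms_mult: "f \<in> forms n d \<Longrightarrow> g \<in> forms n e \<Longrightarrow> f * g \<in> forms n (d + e)"
proof -
  assume fg: "f \<in> forms n d" "g \<in> forms n e"
  have "monom_degree m = d + e" if "m \<in> keys (f * g)" for m
  proof -
    from that obtain a b where "m = a + b" "a \<in> keys f" "b \<in> keys g" using keys_mult[of f g] by blast
    then show ?thesis using fg by (auto simp: forms_def monom_degree_add)
  qed
  then show ?thesis using fg by (auto simp: forms_def coord_ring_mult)
qed

lemma forms_single: "keys m \<subseteq> {..n} \<Longrightarrow> monom_degree m = d \<Longrightarrow> single m c \<in> forms n d"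
  by (auto simp: forms_def coord_ring_def)

lemma forms_power: "f \<in> forms n d \<Longrightarrow> f ^ i \<in> forms n (d * i)"
proof (induction i)
  case 0
  then show ?case using forms_single[of 0 n 0 1] by simp
qed (simp add: forms_mult)

lemma forms_scale: "f \<in> forms n d \<Longrightarrow> mpoly_scale c f \<in> forms n d"
  using forms_mult[OF forms_single[of 0 n 0 c]] by (simp add: mpoly_scale_def)

lemma forms_lookup: "f \<in> forms n d \<Longrightarrow> lookup f m \<noteq> 0 \<Longrightarrow> keys m \<subseteq> {..n} \<and> monom_degree m = d"
  by (auto simp: forms_def coord_ring_def in_keys_iff)

lemma pderiv_forms:
  assumes "f \<in> forms n (Suc d)"
  shows "pderiv_mpoly j f \<in> forms n d"
proof -
  have "keys m \<subseteq> {..n} \<and> monom_degree m = d" if "m \<in> keys (pderiv_mpoly j f)" for m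
  proof -
    from that have "lookup f (m + single j 1) \<noteq> 0" by (auto simp: in_keys_iff lookup_pderiv)
    then have *: "keys (m + single j 1) \<subseteq> {..n}" "monom_degree (m + single j 1) = Suc d"
      using forms_lookup[OF assms] by auto
    have "keys m \<subseteq> keys (m + single j 1)" by (auto simp: in_keys_iff lookup_add)
    then show ?thesis using * by (auto simp: monom_degree_add)
  qed
  then show ?thesis by (auto simp: forms_def coord_ring_def)
qed

lemma euler_form:
  assumes "f \<in> forms n d"
  shows "(\<Sum>j\<le>n. v j * mpoly_eval (pderiv_mpoly j f) v) = of_nat d * mpoly_eval f v"
proof -
  have mon: "(\<Sum>j\<le>n. v j * mpoly_eval (pderiv_mpoly j (single m c)) v) = of_nat (monom_degree m) * (c * monom_eval m v)"
    if "keys m \<subseteq> {..n}" for m and c :: 'a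
  proof -
    have "v j * mpoly_eval (pderiv_mpoly j (single m c)) v = of_nat (lookup m j) * (c * monom_eval m v)" for j
    proof (cases "lookup m j = 0")
      case False
      then have "m = single j 1 + (m - single j 1)"
        by (intro poly_mapping_eqI) (auto simp: lookup_add lookup_minus lookup_single when_def)
      then have "monom_eval m v = v j * monom_eval (m - single j 1) v"
        by (metis monom_eval_add monom_eval_single power_one_right)
      then show ?thesis by (simp add: pderiv_single mult_ac)
    qed (simp add: pderiv_single)
    then have "(\<Sum>j\<le>n. v j * mpoly_eval (pderiv_mpoly j (single m c)) v) = (\<Sum>j\<le>n. of_nat (lookup m j) * (c * monom_eval m v))"
      by (intro sum.cong) auto
    also have "\<dots> = of_nat (monom_degree m) * (c * monom_eval m v)"
      using that by (simp add: monom_degree_superset[of "{..n}"] sum_distrib_right)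
    finally show ?thesis .
  qed
  have "(\<Sum>j\<le>n. v j * mpoly_eval (pderiv_mpoly j (\<Sum>m\<in>A. single m (lookup f m))) v) =
      of_nat d * mpoly_eval (\<Sum>m\<in>A. single m (lookup f m)) v" if "finite A" "A \<subseteq> keys f" for A
    using that
  proof (induction A rule: finite_induct)
    case (insert m A)
    then have "keys m \<subseteq> {..n}" "monom_degree m = d" using forms_lookup[OF assms, of m] by (auto simp: in_keys_iff)
    then show ?case
      using insert mon[of m "lookup f m"]
      by (simp add: pderiv_add mpoly_eval_add distrib_left sum.distrib)
  qed simp
  from this[of "keys f"] show ?thesis by (simp flip: poly_mapping_sum_single)
qed

lemma forms_degree_0: "f \<in> forms n 0 \<Longrightarrow> mpoly_eval f v = lookup f 0"
proof -
  assume "f \<in> forms n 0"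
  then have "keys f \<subseteq> {0}" by (auto simp: forms_def monom_degree_eq_0_iff)
  then show ?thesis by (simp add: mpoly_eval_superset[of "{0}"])
qed

section \<open>Dimension counts\<close>

definition linear_functional :: "(('v, 'k::field) mpoly \<Rightarrow> 'k) \<Rightarrow> bool" where
  "linear_functional \<phi> \<longleftrightarrow> (\<forall>f g. \<phi> (f + g) = \<phi> f + \<phi> g) \<and> (\<forall>c f. \<phi> (mpoly_scale c f) = c * \<phi> f)"

lemma functional_kernel_subspace:
  assumes "mpoly.subspace V" "\<And>a. a \<in> A \<Longrightarrow> linear_functional (\<phi> a)"
  shows "mpoly.subspace {x \<in> V. \<forall>a\<in>A. \<phi> a x = 0}"
proof -
  have "\<phi> a 0 = 0" if "a \<in> A" for a
  proof -
    have "\<phi> a (mpoly_scale 0 0) = 0 * \<phi> a 0" using assms(2)[OF that] unfolding linear_functional_def by blast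
    then show ?thesis by simp
  qed
  then show ?thesis
    using assms unfolding mpoly.subspace_def linear_functional_def by auto
qed

text \<open>Functionals are added one at a time: the new kernel, together with one vector where the
  functional is nonzero, spans the old one. The finite set \<open>T\<close> keeps the bases finite
  inside the infinite-dimensional polynomial space.\<close>

lemma dim_functional_kernel:
  assumes V: "mpoly.subspace V" "V \<subseteq> mpoly.span T" "finite T" and A: "finite A"
    and \<phi>: "\<And>a. a \<in> A \<Longrightarrow> linear_functional (\<phi> a)"
  shows "mpoly.dim V \<le> mpoly.dim {x \<in> V. \<forall>a\<in>A. \<phi> a x = 0} + card A"
  using A \<phi>
proof (induction A rule: finite_induct)
  case (insert a A)
  define K where "K = {x \<in> V. \<forall>a\<in>A. \<phi> a x = 0}"
  define K' where "K' = {x \<in> V. \<forall>b\<in>insert a A. \<phi> b x = 0}"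
  have K: "mpoly.subspace K" unfolding K_def using V(1) insert.prems by (intro functional_kernel_subspace) auto
  have lin: "linear_functional (\<phi> a)" using insert.prems by simp
  have "mpoly.dim K \<le> mpoly.dim K' + 1"
  proof (cases "\<forall>x\<in>K. \<phi> a x = 0")
    case True
    then have "K' = K" by (auto simp: K_def K'_def)
    then show ?thesis by simp
  next
    case False
    then obtain x0 where x0: "x0 \<in> K" "\<phi> a x0 \<noteq> 0" by blast
    obtain B where B: "B \<subseteq> K'" "mpoly.independent B" "K' \<subseteq> mpoly.span B" "card B = mpoly.dim K'"
      by (rule mpoly.basis_exists)
    have "B \<subseteq> mpoly.span T" using B(1) V(2) by (auto simp: K'_def)
    then have "finite B" using mpoly.independent_span_bound[OF V(3) B(2)] by blast
    have "K \<subseteq> mpoly.span (insert x0 B)"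
    proof
      fix x assume x: "x \<in> K"
      define s where "s = \<phi> a x / \<phi> a x0"
      have "x - mpoly_scale s x0 \<in> K" using K x x0(1) by (simp add: mpoly.subspace_diff mpoly.subspace_scale)
      moreover have "\<phi> a (x - mpoly_scale s x0) = 0"
      proof -
        have "\<phi> a x = \<phi> a (x - mpoly_scale s x0) + s * \<phi> a x0"
          using lin unfolding linear_functional_def by (metis diff_add_cancel)
        then show ?thesis using x0(2) by (simp add: s_def)
      qed
      ultimately have "x - mpoly_scale s x0 \<in> K'" by (auto simp: K_def K'_def)
      then have "x - mpoly_scale s x0 \<in> mpoly.span B" using B(3) by blast
      then show "x \<in> mpoly.span (insert x0 B)" using mpoly.span_breakdown_eq by blast
    qed
    then have "mpoly.dim K \<le> card (insert x0 B)" using \<open>finite B\<close> by (intro mpoly.dim_le_card) auto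
    also have "\<dots> \<le> mpoly.dim K' + 1" using card_insert_le_m1[of "card B + 1" B x0] B(4) \<open>finite B\<close>
      by (simp add: card_insert_if)
    finally show ?thesis .
  qed
  moreover have "mpoly.dim V \<le> mpoly.dim K + card A" unfolding K_def using insert by simp
  ultimately show ?case using insert.hyps by (simp add: K'_def)
qed simp

text \<open>The hypotheses say that \<open>L\<close> embeds \<open>U\<close> into the quotient of
  \<open>V\<close> by \<open>W\<close>. Without forming quotients, the image of a basis of
  \<open>U\<close> and a basis of \<open>W\<close> are shown to be jointly independent.\<close>

lemma dim_add_le:
  assumes U: "mpoly.subspace U" "U \<subseteq> mpoly.span T1" "finite T1"
    and W: "mpoly.subspace W" "W \<subseteq> V" and V: "V \<subseteq> mpoly.span T2" "finite T2"
    and L: "\<And>x y. L (x + y) = L x + L y" "\<And>c x. L (mpoly_scale c x) = mpoly_scale c (L x)"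
    and LU: "\<And>x. x \<in> U \<Longrightarrow> L x \<in> V" "\<And>x. x \<in> U \<Longrightarrow> L x \<in> W \<Longrightarrow> x = 0"
  shows "mpoly.dim U + mpoly.dim W \<le> mpoly.dim V"
proof -
  obtain B where B: "B \<subseteq> U" "mpoly.independent B" "U \<subseteq> mpoly.span B" "card B = mpoly.dim U"
    by (rule mpoly.basis_exists)
  obtain C where C: "C \<subseteq> W" "mpoly.independent C" "W \<subseteq> mpoly.span C" "card C = mpoly.dim W"
    by (rule mpoly.basis_exists)
  have finB: "finite B" using mpoly.independent_span_bound[OF U(3) B(2)] B(1) U(2) by blast
  have "C \<subseteq> mpoly.span T2" using C(1) W(2) V(1) by blast
  then have finC: "finite C" using mpoly.independent_span_bound[OF V(2) C(2)] by blast
  have "L 0 = 0" using L(2)[of 0 0] by simp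
  have "L ` S \<subseteq> V \<and> mpoly.independent (L ` S \<union> C) \<and> card (L ` S \<union> C) = card S + card C"
    if "finite S" "S \<subseteq> B" for S
    using that
  proof (induction S rule: finite_induct)
    case (insert x S)
    have "x \<in> U" using insert.prems B(1) by blast
    have notin: "L x \<notin> mpoly.span (L ` S \<union> C)"
    proof
      assume "L x \<in> mpoly.span (L ` S \<union> C)"
      then obtain p q where pq: "L x = p + q" "p \<in> mpoly.span (L ` S)" "q \<in> mpoly.span C"
        unfolding mpoly.span_Un by blast
      have "mpoly.subspace (L ` mpoly.span S)"
      proof (rule mpoly.subspaceI)
        show "0 \<in> L ` mpoly.span S" using \<open>L 0 = 0\<close> mpoly.span_zero by force
        show "a + b \<in> L ` mpoly.span S" if "a \<in> L ` mpoly.span S" "b \<in> L ` mpoly.span S" for a b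
          using that by (auto simp flip: L(1) intro!: imageI mpoly.span_add)
        show "mpoly_scale c a \<in> L ` mpoly.span S" if "a \<in> L ` mpoly.span S" for c a
          using that by (auto simp flip: L(2) intro!: imageI mpoly.span_scale)
      qed
      then have "mpoly.span (L ` S) \<subseteq> L ` mpoly.span S"
        by (intro mpoly.span_minimal) (auto intro: mpoly.span_base)
      then obtain s where s: "s \<in> mpoly.span S" "p = L s" using pq(2) by blast
      have "mpoly.span S \<subseteq> U" using insert.prems B(1) U(1) by (intro mpoly.span_minimal) auto
      then have "x - s \<in> U" using \<open>x \<in> U\<close> s(1) U(1) by (auto intro: mpoly.subspace_diff)
      moreover have "L (x - s) = q"
        using L(1)[of "x - s" s] pq(1) s(2) by (simp add: add.commute)
      moreover have "q \<in> W" using pq(3) mpoly.span_minimal[OF C(1) W(1)] by blast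
      ultimately have "x = s" using LU(2)[of "x - s"] by simp
      moreover have "mpoly.span S \<subseteq> mpoly.span (B - {x})"
        using insert.hyps insert.prems by (intro mpoly.span_mono) auto
      ultimately have "x \<in> mpoly.span (B - {x})" using s(1) by blast
      moreover have "x \<in> B" using insert.prems by simp
      ultimately have "mpoly.dependent B" unfolding mpoly.dependent_def by (rule bexI)
      then show False using B(2) by contradiction
    qed
    have "L x \<notin> L ` S \<union> C"
      using notin mpoly.span_base[of "L x" "L ` S \<union> C"] by (rule contrapos_nn)
    moreover have "mpoly.independent (insert (L x) (L ` S \<union> C))"
      by (rule mpoly.independent_insertI[OF notin]) (use insert in simp)
    ultimately show ?case using insert finC LU(1)[OF \<open>x \<in> U\<close>] by simp
  qed (use C in simp)
  from this[OF finB] have *: "L ` B \<union> C \<subseteq> V" "mpoly.independent (L ` B \<union> C)" "card (L ` B \<union> C) = card B + card C"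
    using C(1) W(2) by auto
  obtain E where E: "E \<subseteq> V" "mpoly.independent E" "V \<subseteq> mpoly.span E" "card E = mpoly.dim V"
    by (rule mpoly.basis_exists)
  have "finite E" using mpoly.independent_span_bound[OF V(2) E(2)] E(1) V(1) by blast
  then have "card (L ` B \<union> C) \<le> card E"
    using mpoly.independent_span_bound[OF _ *(2)] *(1) E(3) by blast
  then show ?thesis using * B(4) C(4) E(4) by simp
qed

section \<open>Dimension of the spaces of forms\<close>

definition monomials :: "nat \<Rightarrow> nat \<Rightarrow> (nat \<Rightarrow>\<^sub>0 nat) set" where
  "monomials n d = {m. keys m \<subseteq> {..n} \<and> monom_degree m = d}"

lemma bij_monomials:
  "bij_betw (\<lambda>m. map (lookup m) [0..<Suc n]) (monomials n d) {l. length l = Suc n \<and> sum_list l = d}"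
proof (rule bij_betw_byWitness[where f' = "Poly_Mapping.nth"])
  have lookup_outside: "lookup m i = 0" if "m \<in> monomials n d" "\<not> i < Suc n" for m i
    using that by (auto simp: monomials_def in_keys_iff)
  show "\<forall>m\<in>monomials n d. Poly_Mapping.nth (map (lookup m) [0..<Suc n]) = m"
    using lookup_outside by (auto intro!: poly_mapping_eqI simp: nth_default_def simp del: upt_Suc)
  show "\<forall>l\<in>{l. length l = Suc n \<and> sum_list l = d}. map (lookup (Poly_Mapping.nth l)) [0..<Suc n] = l"
    by (auto intro!: nth_equalityI simp: nth_default_def simp del: upt_Suc)
  show "(\<lambda>m. map (lookup m) [0..<Suc n]) ` monomials n d \<subseteq> {l. length l = Suc n \<and> sum_list l = d}"
    by (auto simp: monomials_def monom_degree_superset[of "{..n}"] sum_list_map_eq_sum_count[symmetric]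
        interv_sum_list_conv_sum_set_nat atLeast0LessThan lessThan_Suc_atMost simp del: upt_Suc)
  show "Poly_Mapping.nth ` {l. length l = Suc n \<and> sum_list l = d} \<subseteq> monomials n d"
  proof safe
    fix l :: "nat list" assume l: "length l = Suc n" "d = sum_list l"
    have k: "keys (Poly_Mapping.nth l) \<subseteq> {..n}"
    proof
      fix i assume "i \<in> keys (Poly_Mapping.nth l)"
      then have "nth_default 0 l i \<noteq> 0" by (simp add: in_keys_iff del: keys_nth)
      then show "i \<in> {..n}" using l(1) by (simp add: nth_default_def split: if_splits)
    qed
    have "monom_degree (Poly_Mapping.nth l) = (\<Sum>i\<in>{..n}. nth_default 0 l i)"
      using k by (simp add: monom_degree_superset[of "{..n}"])
    also have "\<dots> = sum_list l"
      unfolding sum_list_sum_nth l(1) atLeast0LessThan lessThan_Suc_atMost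
      using l(1) by (intro sum.cong) (auto simp: nth_default_def)
    finally show "Poly_Mapping.nth l \<in> monomials n (sum_list l)" using k by (simp add: monomials_def)
  qed
qed

lemma card_monomials: "card (monomials n d) = (n + d) choose d"
  using bij_betw_same_card[OF bij_monomials, of n d] card_length_sum_list[of "Suc n" d]
  by (simp add: add.commute)

lemma finite_monomials: "finite (monomials n d)"
  using card_monomials[of n d] by (intro card_ge_0_finite) simp

lemma forms_eq_span: "forms n d = mpoly.span ((\<lambda>m. single m (1 :: 'k::field)) ` monomials n d)"
proof
  show "forms n d \<subseteq> mpoly.span ((\<lambda>m. single m (1 :: 'k)) ` monomials n d)"
  proof
    fix f :: "(nat, 'k) mpoly" assume f: "f \<in> forms n d"
    have "single m (lookup f m) \<in> mpoly.span ((\<lambda>m. single m 1) ` monomials n d)" if "m \<in> keys f" for m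
    proof -
      have "m \<in> monomials n d" using forms_lookup[OF f, of m] that by (simp add: monomials_def in_keys_iff)
      moreover have "single m (lookup f m) = mpoly_scale (lookup f m) (single m 1)"
        by (simp add: mpoly_scale_def mult_single)
      ultimately show ?thesis by (auto intro: mpoly.span_scale mpoly.span_base)
    qed
    then have "(\<Sum>m\<in>keys f. single m (lookup f m)) \<in> mpoly.span ((\<lambda>m. single m 1) ` monomials n d)"
      by (intro mpoly.span_sum)
    then show "f \<in> mpoly.span ((\<lambda>m. single m 1) ` monomials n d)"
      by (simp flip: poly_mapping_sum_single)
  qed
  have "mpoly.subspace (forms n d :: (nat, 'k) mpoly set)"
    by (rule mpoly.subspaceI) (auto intro: forms_add forms_scale)
  then show "mpoly.span ((\<lambda>m. single m (1 :: 'k)) ` monomials n d) \<subseteq> forms n d"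
    by (intro mpoly.span_minimal) (auto simp: monomials_def intro: forms_single)
qed

lemma forms_subspace: "mpoly.subspace (forms n d)"
  unfolding forms_eq_span by (rule mpoly.subspace_span)

lemma dim_forms: "mpoly.dim (forms n d :: (nat, 'k::field) mpoly set) = (n + d) choose d"
proof -
  let ?B = "(\<lambda>m. single m (1 :: 'k)) ` monomials n d"
  have inj: "inj_on (\<lambda>m. single m (1 :: 'k)) (monomials n d)"
    by (rule inj_onI) (metis keys_single one_neq_zero singleton_inject)
  have "mpoly.independent ?B"
    unfolding mpoly.dependent_def
  proof safe
    fix m assume m: "m \<in> monomials n d" "single m (1 :: 'k) \<in> mpoly.span (?B - {single m 1})"
    have "mpoly.subspace {f :: (nat, 'k) mpoly. lookup f m = 0}"
      by (rule mpoly.subspaceI)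
        (auto simp: lookup_add mpoly_scale_def mult_map_scale_conv_mult[symmetric] map.rep_eq)
    then have "mpoly.span (?B - {single m 1}) \<subseteq> {f. lookup f m = 0}"
      by (intro mpoly.span_minimal) (auto simp: lookup_single when_def)
    then show False using m(2) by auto
  qed
  then have "mpoly.dim (forms n d :: (nat, 'k) mpoly set) = card ?B"
    unfolding forms_eq_span by (intro mpoly.dim_eq_card) (auto simp: mpoly.span_span)
  then show ?thesis by (simp add: card_image[OF inj] card_monomials)
qed

section \<open>The tensor of a cubic form\<close>

text \<open>Polarisation: the factor \<open>1 / 6\<close> makes the full contraction of the tensor
  with a vector equal to the value of the cubic.\<close>

definition tensor_of :: "(nat, 'k::field) mpoly \<Rightarrow> 'k tensor" where
  "tensor_of f a b d = lookup (pderiv_mpoly a (pderiv_mpoly b (pderiv_mpoly d f))) 0 / 6"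

lemma symmetric_tensor_of: "symmetric_tensor (tensor_of f)"
  unfolding symmetric_tensor_def tensor_of_def by (metis pderiv_commute)

text \<open>Euler's identity is applied to the quadratic form \<open>pderiv_mpoly j f\<close> and
  again to its linear derivatives; the third derivatives are constants.\<close>

lemma grad_tensor_of:
  fixes f :: "(nat, 'k::field_char_0) mpoly"
  assumes "f \<in> forms n 3"
  shows "mpoly_eval (pderiv_mpoly j f) v = 3 * grad {..n} (tensor_of f) v j"
proof -
  define D where "D a g = pderiv_mpoly a g" for a and g :: "(nat, 'k) mpoly"
  have f: "f \<in> forms n (Suc 2)" using assms by (simp add: numeral_3_eq_3 numeral_2_eq_2)
  have 1: "D j f \<in> forms n (Suc 1)" using pderiv_forms[OF f] by (simp add: D_def numeral_2_eq_2)
  have 2: "D a (D j f) \<in> forms n (Suc 0)" for a using pderiv_forms[OF 1] by (simp add: D_def)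
  have 3: "D b (D a (D j f)) \<in> forms n 0" for a b using pderiv_forms[OF 2] by (simp add: D_def)
  have "2 * mpoly_eval (D j f) v = (\<Sum>a\<le>n. v a * mpoly_eval (D a (D j f)) v)"
    using euler_form[OF 1, of v] by (simp add: D_def)
  also have "\<dots> = (\<Sum>a\<le>n. v a * (\<Sum>b\<le>n. v b * lookup (D b (D a (D j f))) 0))"
    using euler_form[OF 2, of v] forms_degree_0[OF 3, of _ _ v] by (simp add: D_def)
  also have "\<dots> = (\<Sum>a\<le>n. \<Sum>b\<le>n. 6 * (tensor_of f b a j * v a * v b))"
    unfolding tensor_of_def D_def sum_distrib_left by (intro sum.cong) (auto simp: mult_ac)
  also have "\<dots> = 6 * grad {..n} (tensor_of f) v j"
    using symmetric_tensor_of[of f] unfolding grad_def sum_distrib_left symmetric_tensor_def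
    by (intro sum.cong refl) (metis (no_types))
  finally show ?thesis by (simp add: D_def)
qed

lemma cubic_value_tensor_of:
  fixes f :: "(nat, 'k::field_char_0) mpoly"
  assumes "f \<in> forms n 3"
  shows "cubic_value {..n} (tensor_of f) v = mpoly_eval f v"
proof -
  have "3 * cubic_value {..n} (tensor_of f) v = (\<Sum>j\<le>n. v j * mpoly_eval (pderiv_mpoly j f) v)"
    unfolding grad_tensor_of[OF assms] cubic_value_def sum_distrib_left by (intro sum.cong) auto
  then show ?thesis using euler_form[OF assms, of v] by simp
qed

lemma form_eq_0I:
  fixes f :: "(nat, 'k::field_char_0) mpoly"
  assumes "f \<in> forms n (Suc d)" "\<And>j. j \<le> n \<Longrightarrow> pderiv_mpoly j f = 0"
  shows "f = 0"
proof (rule poly_mapping_eqI, rule ccontr)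
  fix m assume "lookup f m \<noteq> lookup 0 m"
  then have m: "lookup f m \<noteq> 0" by simp
  then have k: "keys m \<subseteq> {..n}" "monom_degree m = Suc d" using forms_lookup[OF assms(1)] by auto
  then have "m \<noteq> 0" by auto
  then obtain j where j: "lookup m j \<noteq> 0" by (metis lookup_zero poly_mapping_eqI)
  then have "j \<in> keys m" by (simp add: in_keys_iff)
  then have "j \<le> n" using k(1) by blast
  have "m - single j 1 + single j 1 = m"
    using j by (intro poly_mapping_eqI) (auto simp: lookup_add lookup_minus lookup_single when_def)
  then have "lookup (pderiv_mpoly j f) (m - single j 1) = of_nat (lookup (m - single j 1) j + 1) * lookup f m"
    by (simp add: lookup_pderiv)
  moreover have "\<dots> \<noteq> 0" using m by (simp only: mult_eq_0_iff of_nat_eq_0_iff) simp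
  ultimately show False using assms(2)[OF \<open>j \<le> n\<close>] by simp
qed

lemma tensor_of_eq_0:
  fixes f :: "(nat, 'k::field_char_0) mpoly"
  assumes f: "f \<in> forms n 3" and "vanishes_on {..n} (tensor_of f)"
  shows "f = 0"
proof -
  have f: "f \<in> forms n (Suc (Suc (Suc 0)))" using f by (simp add: numeral_3_eq_3)
  have "pderiv_mpoly a (pderiv_mpoly b (pderiv_mpoly d f)) = 0" if "a \<le> n" "b \<le> n" "d \<le> n" for a b d
  proof (rule poly_mapping_eqI)
    fix m
    have *: "pderiv_mpoly a (pderiv_mpoly b (pderiv_mpoly d f)) \<in> forms n 0" using f by (intro pderiv_forms)
    show "lookup (pderiv_mpoly a (pderiv_mpoly b (pderiv_mpoly d f))) m = lookup 0 m"
    proof (cases "m = 0")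
      case True
      then show ?thesis using assms(2) that by (simp add: vanishes_on_def tensor_of_def)
    next
      case False
      then show ?thesis using forms_lookup[OF *, of m] by (auto simp: monom_degree_eq_0_iff)
    qed
  qed
  then show ?thesis using f by (meson form_eq_0I pderiv_forms)
qed

section \<open>Points, double points and their ideals\<close>

definition line :: "(nat \<Rightarrow> 'k::field) \<Rightarrow> 'k point" where
  "line v = {(\<lambda>i. c * v i) | c. True}"

lemma pderiv_1: "pderiv_mpoly j 1 = 0"
  using pderiv_single[of j 0 1] by simp

lemma line_self: "v \<in> line v"
  unfolding line_def by (rule CollectI, rule exI[of _ 1]) simp

lemma mpoly_eval_line: "mpoly_eval f (\<lambda>i. c * v i) =
    (\<Sum>m\<in>keys f. lookup f m * monom_eval m v * c ^ monom_degree m)"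
proof -
  have "monom_eval m (\<lambda>i. c * v i) = monom_eval m v * c ^ monom_degree m" for m
    by (simp add: monom_eval_def monom_degree_def power_mult_distrib prod.distrib power_sum)
  then show ?thesis by (simp add: mpoly_eval_superset[OF finite_keys order_refl] mult_ac)
qed

lemma mpoly_eval_line_form:
  assumes "f \<in> forms n d"
  shows "mpoly_eval f (\<lambda>i. c * v i) = c ^ d * mpoly_eval f v"
proof -
  have "mpoly_eval f (\<lambda>i. c * v i) = (\<Sum>m\<in>keys f. c ^ d * (lookup f m * monom_eval m v))"
    unfolding mpoly_eval_line using assms by (intro sum.cong) (auto simp: forms_def)
  then show ?thesis by (simp add: mpoly_eval_superset[OF finite_keys order_refl] sum_distrib_left)
qed

lemma mpoly_eval_hom_component:
  "mpoly_eval (hom_component d f) v = (\<Sum>m\<in>{m \<in> keys f. monom_degree m = d}. lookup f m * monom_eval m v)"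
  by (simp add: hom_component_def mpoly_eval_sum)

text \<open>The polynomial in the scaling factor \<open>c\<close>. Its coefficients are the values
  of the homogeneous components, so over an infinite field vanishing on a line passes to every
  component.\<close>

definition restrict_line :: "(nat, 'k::field) mpoly \<Rightarrow> (nat \<Rightarrow> 'k) \<Rightarrow> 'k poly" where
  "restrict_line f v = (\<Sum>m\<in>keys f. Polynomial.monom (lookup f m * monom_eval m v) (monom_degree m))"

lemma poly_restrict_line: "poly (restrict_line f v) c = mpoly_eval f (\<lambda>i. c * v i)"
  by (simp add: restrict_line_def poly_sum poly_monom mpoly_eval_line)

lemma coeff_restrict_line: "coeff (restrict_line f v) d = mpoly_eval (hom_component d f) v"
proof -
  have "coeff (restrict_line f v) d = (\<Sum>m\<in>keys f. if monom_degree m = d then lookup f m * monom_eval m v else 0)"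
    by (simp add: restrict_line_def coeff_sum)
  then show ?thesis
    by (simp add: mpoly_eval_hom_component sum.If_cases Collect_conj_eq Int_commute)
qed

lemma restrict_line_eq_0I:
  fixes f :: "(nat, 'k::field_char_0) mpoly"
  assumes "\<And>c. c \<noteq> 0 \<Longrightarrow> mpoly_eval f (\<lambda>i. c * v i) = 0"
  shows "restrict_line f v = 0"
proof -
  \<comment> \<open>The extra factor takes care of \<open>c = 0\<close>, where nothing is
    assumed.\<close>
  have "\<forall>c. poly (restrict_line f v * [:0, 1:]) c = 0"
    using assms by (auto simp: poly_restrict_line)
  then have "restrict_line f v * [:0, 1:] = 0" by (subst (asm) poly_all_0_iff_0)
  then show ?thesis by simp
qed

lemma hom_component_coord_ring: "f \<in> coord_ring n \<Longrightarrow> hom_component d f \<in> coord_ring n"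
  unfolding hom_component_def by (intro coord_ring_sum coord_ring_single) (auto simp: coord_ring_def)

lemma forms_coord_ring: "f \<in> forms n d \<Longrightarrow> f \<in> coord_ring n"
  by (simp add: forms_def)

lemma point_ideal_form:
  assumes "f \<in> forms n d" "mpoly_eval f v = 0"
  shows "f \<in> point_ideal n (line v)"
  using mpoly_eval_line_form[OF assms(1), of _ v] assms by (auto simp: point_ideal_def line_def forms_def)

lemma point_ideal_mult: "f \<in> point_ideal n p \<Longrightarrow> r \<in> coord_ring n \<Longrightarrow> r * f \<in> point_ideal n p"
  by (simp add: point_ideal_def coord_ring_mult mpoly_eval_mult)

lemma ideal_square_add: "f \<in> ideal_square J \<Longrightarrow> g \<in> ideal_square J \<Longrightarrow> f + g \<in> ideal_square J"
  unfolding ideal_square_def by (rule mpoly.span_add)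

lemma ideal_square_sum: "(\<And>x. x \<in> A \<Longrightarrow> f x \<in> ideal_square J) \<Longrightarrow> sum f A \<in> ideal_square J"
  unfolding ideal_square_def by (rule mpoly.span_sum)

lemma ideal_square_base: "f \<in> J \<Longrightarrow> g \<in> J \<Longrightarrow> f * g \<in> ideal_square J"
  unfolding ideal_square_def by (rule mpoly.span_base) blast

lemma ideal_square_mult:
  assumes "f \<in> ideal_square (point_ideal n p)" "r \<in> coord_ring n"
  shows "r * f \<in> ideal_square (point_ideal n p)"
proof -
  let ?S = "{f * g | f g. f \<in> point_ideal n p \<and> g \<in> point_ideal n p}"
  have "mpoly.span ?S \<subseteq> {h. r * h \<in> mpoly.span ?S}"
  proof (rule mpoly.span_minimal)
    show "?S \<subseteq> {h. r * h \<in> mpoly.span ?S}"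
      using point_ideal_mult[OF _ assms(2)] by (fastforce intro: mpoly.span_base simp flip: mult.assoc)
    show "mpoly.subspace {h. r * h \<in> mpoly.span ?S}"
    proof (rule mpoly.subspaceI)
      fix c h assume "h \<in> {h. r * h \<in> mpoly.span ?S}"
      then have "mpoly_scale c (r * h) \<in> mpoly.span ?S" by (auto intro: mpoly.span_scale)
      then show "mpoly_scale c h \<in> {h. r * h \<in> mpoly.span ?S}"
        by (simp add: mpoly_scale_def mult.left_commute)
    qed (auto simp: distrib_left mpoly.span_zero intro: mpoly.span_add)
  qed
  then show ?thesis using assms(1) unfolding ideal_square_def by blast
qed

lemma ideal_square_gradient:
  assumes "f \<in> ideal_square (point_ideal n p)" "v \<in> p"
  shows "mpoly_eval f v = 0" "mpoly_eval (pderiv_mpoly j f) v = 0"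
proof -
  let ?Z = "{f. mpoly_eval f v = 0 \<and> mpoly_eval (pderiv_mpoly j f) v = 0}"
  have "ideal_square (point_ideal n p) \<subseteq> ?Z"
    unfolding ideal_square_def
  proof (rule mpoly.span_minimal)
    show "{f * g |f g. f \<in> point_ideal n p \<and> g \<in> point_ideal n p} \<subseteq> ?Z"
      using assms(2) by (auto simp: point_ideal_def mpoly_eval_mult pderiv_mult mpoly_eval_add)
    show "mpoly.subspace ?Z"
      by (rule mpoly.subspaceI) (auto simp: mpoly_eval_add pderiv_add mpoly_eval_scale pderiv_scale)
  qed
  then show "mpoly_eval f v = 0" "mpoly_eval (pderiv_mpoly j f) v = 0" using assms(1) by blast+
qed

text \<open>Saturation is undone with a power of a coordinate that is nonzero at \<open>v\<close>:
  its value cancels from \<open>g * f\<close>, and once \<open>f\<close> vanishes at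
  \<open>v\<close> the product rule lets it cancel from the gradient too.\<close>

lemma double_point_gradient:
  assumes f: "f \<in> double_point n p" and v: "v \<in> p" "i \<le> n" "v i \<noteq> 0"
  shows "mpoly_eval f v = 0" "mpoly_eval (pderiv_mpoly j f) v = 0"
proof -
  obtain N where N: "\<And>g. g \<in> forms n N \<Longrightarrow> g * f \<in> ideal_square (point_ideal n p)"
    using f unfolding double_point_def saturation_def by blast
  define g where "g = (single (single i N) 1 :: (nat, 'a) mpoly)"
  have "g \<in> forms n N" unfolding g_def using v(2) by (intro forms_single) auto
  note gf = ideal_square_gradient[OF N[OF this] v(1)]
  have g: "mpoly_eval g v \<noteq> 0" using v(3) by (simp add: g_def)
  show f0: "mpoly_eval f v = 0" using gf(1) g by (simp add: mpoly_eval_mult)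
  show "mpoly_eval (pderiv_mpoly j f) v = 0"
    using gf(2)[of j] g f0 by (simp add: pderiv_mult mpoly_eval_add mpoly_eval_mult)
qed

text \<open>
  Conversely, writing \<open>v\<^sub>i x\<^sub>j = \<ell>\<^sub>j + v\<^sub>j x\<^sub>i\<close> with \<open>\<ell>\<^sub>j\<close> vanishing at the point \<open>p\<close> spanned by \<open>v\<close>,
  every monomial is congruent modulo \<open>m\<^sub>p\<^sup>2\<close> to its first order Taylor expansion at \<open>v\<close>.
\<close>

locale chart =
  fixes n i0 :: nat and v :: "nat \<Rightarrow> 'k::field"
  assumes i0: "i0 \<le> n" "v i0 \<noteq> 0"
begin

definition const :: "'k \<Rightarrow> (nat, 'k) mpoly" where "const c = single 0 c"
definition var :: "nat \<Rightarrow> (nat, 'k) mpoly" where "var j = single (single j 1) 1"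
definition ell :: "nat \<Rightarrow> (nat, 'k) mpoly" where "ell j = const (v i0) * var j - const (v j) * var i0"

abbreviation "J \<equiv> ideal_square (point_ideal n (line v))"

text \<open>The first-order Taylor term, homogenised with \<open>x_{i0}\<close>. For
  \<open>d = 0\<close> the exponent truncates, but the derivatives of a constant are zero.\<close>

definition taylor1 :: "nat \<Rightarrow> (nat, 'k) mpoly \<Rightarrow> (nat, 'k) mpoly" where
  "taylor1 d f = (\<Sum>j\<le>n. const (mpoly_eval (pderiv_mpoly j f) v) * (var i0 ^ (d - 1) * ell j))"

definition taylor :: "nat \<Rightarrow> (nat, 'k) mpoly \<Rightarrow> (nat, 'k) mpoly" where
  "taylor d f = const (mpoly_eval f v) * var i0 ^ d + taylor1 d f"

lemma const_simps: "const (a + b) = const a + const b" "const (a * b) = const a * const b" "const 0 = 0" "const 1 = 1"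
  by (simp_all add: const_def single_add mult_single)

lemma const_forms: "const c \<in> forms n 0"
  unfolding const_def by (rule forms_single) auto

lemma var_forms: "j \<le> n \<Longrightarrow> var j \<in> forms n 1"
  unfolding var_def by (rule forms_single) auto

lemma ell_point_ideal:
  assumes "j \<le> n"
  shows "ell j \<in> point_ideal n (line v)"
proof -
  have "ell j = const (v i0) * var j + const (- v j) * var i0"
    by (simp add: ell_def const_def single_uminus)
  moreover have "const a * var i \<in> forms n 1" if "i \<le> n" for a i
    using forms_mult[OF const_forms var_forms[OF that]] by simp
  ultimately have "ell j \<in> forms n 1" using assms i0(1) by (auto intro: forms_add)
  moreover have "mpoly_eval (ell j) v = 0"
    by (simp add: ell_def const_def var_def mpoly_eval_diff mpoly_eval_mult)
  ultimately show ?thesis by (rule point_ideal_form)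
qed

lemma J_coord_mult: "f \<in> J \<Longrightarrow> r \<in> coord_ring n \<Longrightarrow> r * f \<in> J"
  by (rule ideal_square_mult)

lemma taylor_add: "taylor d (f + g) = taylor d f + taylor d g"
  by (simp add: taylor_def taylor1_def mpoly_eval_add pderiv_add const_simps distrib_right sum.distrib add_ac)

lemma taylor_scale: "taylor d (mpoly_scale c f) = const c * taylor d f"
  by (simp add: taylor_def taylor1_def mpoly_eval_scale pderiv_scale const_simps distrib_left sum_distrib_left mult_ac)

lemma monom_taylor:
  "keys m \<subseteq> {..n} \<Longrightarrow> monom_degree m = d \<Longrightarrow>
    const (v i0 ^ d) * single m 1 - taylor d (single m 1) \<in> J"
proof (induction d arbitrary: m)
  case 0
  then have "m = 0" by (simp add: monom_degree_eq_0_iff)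
  then show ?case
    using mpoly.span_zero by (simp add: taylor_def taylor1_def const_simps pderiv_1 ideal_square_def)
next
  case (Suc d)
  then have "m \<noteq> 0" by auto
  then obtain i where i: "lookup m i \<noteq> 0" by (metis lookup_zero poly_mapping_eqI)
  define m' where "m' = m - single i 1"
  have m: "m = single i 1 + m'"
    unfolding m'_def using i by (intro poly_mapping_eqI) (auto simp: lookup_add lookup_minus lookup_single when_def)
  have "i \<in> keys m" using i by (simp add: in_keys_iff)
  then have "i \<le> n" using Suc.prems(1) by blast
  have "keys m' \<subseteq> keys m" by (auto simp: in_keys_iff m lookup_add)
  then have m': "keys m' \<subseteq> {..n}" "monom_degree m' = d"
    using Suc.prems m by (auto simp: monom_degree_add)
  define X where "X = (single m' 1 :: (nat, 'k) mpoly)"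
  define A where "A = const (v i0 ^ d) * X"
  define y where "y = var i0"
  define E where "E = const (mpoly_eval X v)"
  define r where "r = A - taylor d X"
  have r: "r \<in> J" using Suc.IH[OF m'] by (simp add: r_def A_def X_def)
  have fm: "single m 1 = var i * X" by (simp add: X_def var_def m mult_single)
  have ev: "mpoly_eval (var i) v = v i" "mpoly_eval (pderiv_mpoly j (var i)) v = (if j = i then 1 else 0)" for j
    by (auto simp: var_def pderiv_single lookup_single when_def)
  have t1: "taylor1 (Suc d) (var i * X) = E * (y ^ d * ell i) + const (v i) * (y * taylor1 d X)"
  proof -
    \<comment> \<open>The case \<open>d = 0\<close> is separate because of the truncated exponent;
      there \<open>X = 1\<close> has no derivatives.\<close>
    have shift: "y ^ d * (const (mpoly_eval (pderiv_mpoly j X) v) * ell j) =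
        const (mpoly_eval (pderiv_mpoly j X) v) * (y * (y ^ (d - 1) * ell j))" for j
    proof (cases d)
      case 0
      then have "m' = 0" using m'(2) by (simp add: monom_degree_eq_0_iff)
      then show ?thesis by (simp add: X_def pderiv_1 const_simps)
    qed (simp add: mult_ac)
    have "taylor1 (Suc d) (var i * X) =
        (\<Sum>j\<le>n. (if j = i then E * (y ^ d * ell j) else 0) +
          const (v i) * (y ^ d * (const (mpoly_eval (pderiv_mpoly j X) v) * ell j)))"
      unfolding taylor1_def
      by (intro sum.cong refl)
        (auto simp: pderiv_mult mpoly_eval_add mpoly_eval_mult ev const_simps E_def y_def algebra_simps)
    also have "\<dots> = E * (y ^ d * ell i) + const (v i) * (y * taylor1 d X)"
      using \<open>i \<le> n\<close> unfolding shift taylor1_def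
      by (simp add: sum.distrib sum_distrib_left y_def mult_ac)
    finally show ?thesis .
  qed
  have "const (v i0 ^ Suc d) * single m 1 = (ell i + const (v i) * y) * A"
    by (simp add: fm A_def ell_def y_def const_simps algebra_simps)
  moreover have "taylor (Suc d) (single m 1) =
      const (v i) * E * (y * y ^ d) + (E * (y ^ d * ell i) + const (v i) * (y * taylor1 d X))"
    unfolding taylor_def fm t1 by (simp add: mpoly_eval_mult ev const_simps E_def y_def)
  moreover have "A = r + (E * y ^ d + taylor1 d X)"
    by (simp add: r_def taylor_def E_def y_def)
  \<comment> \<open>Passing from degree \<open>d\<close> to \<open>d + 1\<close> multiplies the old
    error by a linear form and adds \<open>ell i * taylor1 d X\<close>, a combination of products of
    two linear forms vanishing at the point.\<close>
  ultimately have "const (v i0 ^ Suc d) * single m 1 - taylor (Suc d) (single m 1) =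
      (ell i + const (v i) * y) * r + ell i * taylor1 d X"
    by (simp add: algebra_simps)
  moreover have "(ell i + const (v i) * y) * r \<in> J"
  proof (rule J_coord_mult[OF r])
    have "ell i \<in> coord_ring n" using ell_point_ideal[OF \<open>i \<le> n\<close>] by (simp add: point_ideal_def)
    moreover have "const (v i) * y \<in> coord_ring n"
      unfolding y_def by (intro coord_ring_mult forms_coord_ring[OF const_forms] forms_coord_ring[OF var_forms] i0)
    ultimately show "ell i + const (v i) * y \<in> coord_ring n" by (rule coord_ring_add)
  qed
  moreover have "ell i * taylor1 d X \<in> J"
  proof -
    have "ell i * taylor1 d X =
        (\<Sum>j\<le>n. (const (mpoly_eval (pderiv_mpoly j X) v) * var i0 ^ (d - 1)) * (ell i * ell j))"
      unfolding taylor1_def sum_distrib_left by (intro sum.cong) (auto simp: mult_ac)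
    moreover have "var i0 ^ e \<in> coord_ring n" for e
      using forms_power[OF var_forms[OF i0(1)]] by (rule forms_coord_ring)
    ultimately show ?thesis
      using \<open>i \<le> n\<close>
      by (auto intro!: ideal_square_sum J_coord_mult[OF ideal_square_base[OF ell_point_ideal ell_point_ideal]]
          coord_ring_mult forms_coord_ring[OF const_forms])
  qed
  ultimately show ?case by (simp add: ideal_square_add)
qed

lemma form_taylor:
  assumes "f \<in> forms n d"
  shows "const (v i0 ^ d) * f - taylor d f \<in> J"
proof -
  have "const (v i0 ^ d) * (\<Sum>m\<in>A. single m (lookup f m)) - taylor d (\<Sum>m\<in>A. single m (lookup f m)) \<in> J"
    if "finite A" "A \<subseteq> keys f" for A
    using that
  proof (induction A rule: finite_induct)
    case empty
    then show ?case using mpoly.span_zero by (simp add: taylor_def taylor1_def const_simps ideal_square_def)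
  next
    case (insert m A)
    have "keys m \<subseteq> {..n}" "monom_degree m = d"
      using forms_lookup[OF assms, of m] insert.prems by (auto simp: in_keys_iff)
    then have "const (lookup f m) * (const (v i0 ^ d) * single m 1 - taylor d (single m 1)) \<in> J"
      by (intro J_coord_mult monom_taylor forms_coord_ring[OF const_forms])
    moreover have "single m (lookup f m) = mpoly_scale (lookup f m) (single m 1)"
      by (simp add: mpoly_scale_def mult_single)
    then have "const (v i0 ^ d) * single m (lookup f m) - taylor d (single m (lookup f m)) =
        const (lookup f m) * (const (v i0 ^ d) * single m 1 - taylor d (single m 1))"
      by (simp only: taylor_scale) (simp add: mpoly_scale_def const_def algebra_simps)
    ultimately have "const (v i0 ^ d) * single m (lookup f m) - taylor d (single m (lookup f m)) \<in> J"
      by (simp only:)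
    moreover have "const (v i0 ^ d) * (\<Sum>m\<in>A. single m (lookup f m)) - taylor d (\<Sum>m\<in>A. single m (lookup f m)) \<in> J"
      using insert by simp
    ultimately have "const (v i0 ^ d) * single m (lookup f m) - taylor d (single m (lookup f m)) +
        (const (v i0 ^ d) * (\<Sum>m\<in>A. single m (lookup f m)) - taylor d (\<Sum>m\<in>A. single m (lookup f m))) \<in> J"
      by (rule ideal_square_add)
    then show ?case
      unfolding sum.insert[OF insert.hyps] taylor_add distrib_left by (simp add: algebra_simps)
  qed
  from this[of "keys f"] show ?thesis by (simp flip: poly_mapping_sum_single)
qed

lemma double_point_of_gradient:
  assumes f: "f \<in> forms n d" "mpoly_eval f v = 0" "\<And>j. j \<le> n \<Longrightarrow> mpoly_eval (pderiv_mpoly j f) v = 0"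
  shows "f \<in> double_point n (line v)"
proof -
  have "taylor d f = 0" using f(2,3) by (simp add: taylor_def taylor1_def const_simps)
  then have "const (v i0 ^ d) * f \<in> J" using form_taylor[OF f(1)] by simp
  then have "const (1 / v i0 ^ d) * (const (v i0 ^ d) * f) \<in> J"
    by (rule J_coord_mult) (rule forms_coord_ring[OF const_forms])
  then have "f \<in> J" using i0(2) by (simp add: const_simps(4) flip: mult.assoc const_simps(2))
  then have "\<forall>g\<in>forms n 0. g * f \<in> J" using J_coord_mult forms_coord_ring by blast
  then show ?thesis
    unfolding double_point_def saturation_def using forms_coord_ring[OF f(1)] by blast
qed

end

section \<open>Finite sets of reduced points\<close>

definition simple_points :: "nat \<Rightarrow> (nat \<Rightarrow> 'k::field) set \<Rightarrow> (nat, 'k) mpoly set" where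
  "simple_points n W = {f \<in> coord_ring n. \<forall>w\<in>W. \<forall>x\<in>line w. mpoly_eval f x = 0}"

definition proj_vector :: "nat \<Rightarrow> (nat \<Rightarrow> 'k::field) \<Rightarrow> bool" where
  "proj_vector n v \<longleftrightarrow> (\<forall>i>n. v i = 0) \<and> (\<exists>i\<le>n. v i \<noteq> 0)"

lemma proj_space_eq: "proj_space n = {line v | v. proj_vector n v}"
  by (simp add: proj_space_def line_def proj_vector_def)

lemma simple_points_form_iff:
  "f \<in> forms n d \<Longrightarrow> f \<in> simple_points n W \<longleftrightarrow> (\<forall>w\<in>W. mpoly_eval f w = 0)"
  unfolding simple_points_def using line_self
  by (auto simp: line_def mpoly_eval_line_form forms_coord_ring)

lemma simple_points_mult: "f \<in> simple_points n W \<Longrightarrow> r \<in> coord_ring n \<Longrightarrow> r * f \<in> simple_points n W"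
  by (simp add: simple_points_def coord_ring_mult mpoly_eval_mult)

text \<open>Homogeneity comes from restricting to lines over an infinite field. For saturation, a
  power of a coordinate nonzero at \<open>w\<close> can be cancelled at all nonzero multiples of
  \<open>w\<close>; a polynomial in the scaling factor then also vanishes at 0.\<close>

lemma closed_subscheme_simple_points:
  fixes W :: "(nat \<Rightarrow> 'k::field_char_0) set"
  assumes W: "\<And>w. w \<in> W \<Longrightarrow> proj_vector n w"
  shows "closed_subscheme n (simple_points n W)"
proof -
  have hom: "hom_component d f \<in> simple_points n W" if f: "f \<in> simple_points n W" for f d
  proof -
    have fc: "f \<in> coord_ring n" using f by (simp add: simple_points_def)
    have "mpoly_eval (hom_component d f) x = 0" if x: "w \<in> W" "x \<in> line w" for w x
    proof -
      have "(\<lambda>i. c * x i) \<in> line w" for c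
      proof -
        obtain b where "x = (\<lambda>i. b * w i)" using x(2) unfolding line_def by blast
        then have "(\<lambda>i. c * x i) = (\<lambda>i. (c * b) * w i)" by (simp add: mult.assoc)
        then show ?thesis unfolding line_def by blast
      qed
      then have "mpoly_eval f (\<lambda>i. c * x i) = 0" for c
        using f x(1) unfolding simple_points_def by blast
      then have "restrict_line f x = 0" by (intro restrict_line_eq_0I)
      then show ?thesis using coeff_restrict_line[of f x d] by simp
    qed
    then show ?thesis using hom_component_coord_ring[OF fc] by (simp add: simple_points_def)
  qed
  have "f \<in> simple_points n W" if f: "f \<in> saturation n (simple_points n W)" for f
  proof -
    obtain N where N: "\<And>g. g \<in> forms n N \<Longrightarrow> g * f \<in> simple_points n W" and fc: "f \<in> coord_ring n"
      using f unfolding saturation_def by blast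
    have "mpoly_eval f x = 0" if x: "w \<in> W" "x \<in> line w" for w x
    proof -
      obtain i where i: "i \<le> n" "w i \<noteq> 0" using W[OF x(1)] unfolding proj_vector_def by blast
      have "(single (single i N) 1 :: (nat, 'k) mpoly) \<in> forms n N" using i(1) by (intro forms_single) auto
      note gf = N[OF this]
      have "mpoly_eval f (\<lambda>i. c * w i) = 0" if "c \<noteq> 0" for c
      proof -
        have "(\<lambda>i. c * w i) \<in> line w" unfolding line_def by blast
        then have "mpoly_eval (single (single i N) 1 * f) (\<lambda>i. c * w i) = 0"
          using gf x(1) unfolding simple_points_def by blast
        then show ?thesis using i(2) that by (simp add: mpoly_eval_mult)
      qed
      then have "restrict_line f w = 0" by (rule restrict_line_eq_0I)
      then have "mpoly_eval f (\<lambda>i. c * w i) = 0" for c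
        using poly_restrict_line[of f w c] by simp
      then show ?thesis using x(2) by (auto simp: line_def)
    qed
    then show ?thesis using fc by (simp add: simple_points_def)
  qed
  moreover have "f \<in> saturation n (simple_points n W)" if "f \<in> simple_points n W" for f
  proof -
    have "\<forall>g\<in>forms n 0. g * f \<in> simple_points n W"
      using simple_points_mult[OF that] forms_coord_ring by blast
    moreover have "f \<in> coord_ring n" using that by (simp add: simple_points_def)
    ultimately show ?thesis unfolding saturation_def by blast
  qed
  moreover have "homogeneous_ideal n (simple_points n W)"
    unfolding homogeneous_ideal_def
  proof (intro conjI ballI allI)
    show "f + g \<in> simple_points n W" if "f \<in> simple_points n W" "g \<in> simple_points n W" for f g
      using that by (simp add: simple_points_def coord_ring_add mpoly_eval_add)
  qed (use hom simple_points_mult in \<open>auto simp: simple_points_def coord_ring_mult mpoly_eval_mult\<close>)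
  ultimately show ?thesis unfolding closed_subscheme_def by blast
qed

text \<open>A further point \<open>x\<close> is separated from each \<open>w\<close> by a linear
  form given by a nonzero 2 by 2 minor; the product of these forms vanishes on all of
  \<open>W\<close> but not at \<open>x\<close>.\<close>

lemma support_simple_points:
  assumes "finite W" "\<And>w. w \<in> W \<Longrightarrow> proj_vector n w"
  shows "scheme_support n (simple_points n W) \<subseteq> line ` W"
proof
  fix q assume q: "q \<in> scheme_support n (simple_points n W)"
  then obtain x where x: "q = line x" "proj_vector n x"
    unfolding scheme_support_def proj_space_eq by blast
  show "q \<in> line ` W"
  proof (rule ccontr)
    assume "q \<notin> line ` W"
    have "\<exists>lf\<in>coord_ring n. (\<forall>y\<in>line w. mpoly_eval lf y = 0) \<and> mpoly_eval lf x \<noteq> 0" if "w \<in> W" for w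
    proof -
      obtain a where a: "a \<le> n" "w a \<noteq> 0" using assms(2)[OF \<open>w \<in> W\<close>] unfolding proj_vector_def by blast
      have "\<exists>b\<le>n. w a * x b - w b * x a \<noteq> 0"
      proof (rule ccontr)
        assume "\<not> ?thesis"
        then have par: "w a * x b = w b * x a" if "b \<le> n" for b using that by simp
        have xw: "x b = (x a / w a) * w b" for b
        proof (cases "b \<le> n")
          case True
          then show ?thesis using par[OF True] a(2) by (simp add: field_simps)
        next
          case False
          then show ?thesis using x(2) assms(2)[OF \<open>w \<in> W\<close>] by (simp add: proj_vector_def)
        qed
        have "x a \<noteq> 0" using xw x(2) unfolding proj_vector_def by (metis divide_eq_0_iff mult_zero_left)
        have "line x = line w"
          unfolding line_def
        proof (intro subset_antisym subsetI; elim CollectE exE conjE)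
          fix y c assume "y = (\<lambda>i. c * x i)"
          then have "y = (\<lambda>i. (c * (x a / w a)) * w i)" using xw by (metis mult.assoc)
          then show "y \<in> {\<lambda>i. c * w i |c. True}" by blast
        next
          fix y c assume "y = (\<lambda>i. c * w i)"
          moreover have "w i = (w a / x a) * x i" for i
            using xw[of i] \<open>x a \<noteq> 0\<close> a(2) by (simp add: field_simps)
          ultimately have "y = (\<lambda>i. (c * (w a / x a)) * x i)" by (metis mult.assoc)
          then show "y \<in> {\<lambda>i. c * x i |c. True}" by blast
        qed
        then show False using \<open>q \<notin> line ` W\<close> \<open>w \<in> W\<close> x(1) by blast
      qed
      then obtain b where b: "b \<le> n" "w a * x b - w b * x a \<noteq> 0" by blast
      define lf :: "(nat, 'a) mpoly" where "lf = single (single b 1) (w a) - single (single a 1) (w b)"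
      have eval: "mpoly_eval lf y = w a * y b - w b * y a" for y
        by (simp add: lf_def mpoly_eval_diff)
      have "lf \<in> coord_ring n"
        unfolding lf_def diff_conv_add_uminus single_uminus[symmetric] using a(1) b(1)
        by (intro coord_ring_add coord_ring_single) auto
      moreover have "\<forall>y\<in>line w. mpoly_eval lf y = 0" by (auto simp: eval line_def)
      moreover have "mpoly_eval lf x \<noteq> 0" using b(2) by (simp add: eval)
      ultimately show ?thesis by blast
    qed
    then obtain lf where lf: "\<And>w. w \<in> W \<Longrightarrow> lf w \<in> coord_ring n"
      "\<And>w y. w \<in> W \<Longrightarrow> y \<in> line w \<Longrightarrow> mpoly_eval (lf w) y = 0" "\<And>w. w \<in> W \<Longrightarrow> mpoly_eval (lf w) x \<noteq> 0"
      by metis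
    define f where "f = (\<Prod>w\<in>W. lf w)"
    have "f \<in> simple_points n W"
      unfolding simple_points_def f_def using lf(1,2) assms(1)
      by (auto simp: mpoly_eval_prod intro!: coord_ring_prod)
    moreover have "mpoly_eval f x \<noteq> 0" using lf(3) assms(1) by (simp add: f_def mpoly_eval_prod)
    ultimately show False using q line_self[of x] unfolding scheme_support_def x(1) by blast
  qed
qed

text \<open>The coefficients are taken on the moment curve \<open>(1, t, t^2, ...)\<close>: the
  value at \<open>w\<close> is then a nonzero polynomial in \<open>t\<close>, and finitely many
  roots have to be avoided.\<close>

lemma ex_nonvanishing_linear_form:
  fixes W :: "(nat \<Rightarrow> 'k::field_char_0) set"
  assumes "finite W" "\<And>w. w \<in> W \<Longrightarrow> proj_vector n w"
  obtains lf where "lf \<in> forms n 1" "\<And>w. w \<in> W \<Longrightarrow> mpoly_eval lf w \<noteq> 0"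
proof -
  define p where "p w = (\<Sum>j\<le>n. Polynomial.monom (w j) j)" for w :: "nat \<Rightarrow> 'k"
  have "p w \<noteq> 0" if w: "w \<in> W" for w
  proof -
    obtain i where "i \<le> n" "w i \<noteq> 0" using assms(2)[OF w] unfolding proj_vector_def by blast
    then have "coeff (p w) i \<noteq> 0" by (simp add: p_def coeff_sum)
    then show ?thesis by auto
  qed
  then have "finite (\<Union>w\<in>W. {t. poly (p w) t = 0})"
    using assms(1) poly_roots_finite by blast
  then obtain t where t: "t \<notin> (\<Union>w\<in>W. {t. poly (p w) t = 0})"
    using ex_new_if_finite[OF infinite_UNIV_char_0[where 'a = 'k]] by blast
  define lf :: "(nat, 'k) mpoly" where "lf = (\<Sum>j\<le>n. single (single j 1) (t ^ j))"
  have "mpoly_eval lf w = poly (p w) t" for w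
    by (simp add: lf_def p_def mpoly_eval_sum poly_sum poly_monom mult.commute)
  moreover have "lf \<in> forms n 1"
    unfolding lf_def using forms_subspace
    by (intro mpoly.subspace_sum) (auto intro: forms_single)
  ultimately show ?thesis using t by (intro that[of lf]) auto
qed

text \<open>The functionals bound the codimension from above. From below, multiplication by
  \<open>lf\<close> embeds the cubics \<open>U\<close> into the degree \<open>d\<close> forms modulo
  those vanishing on \<open>X\<close>. Thus knowledge in degree 3 fixes the codimension in all
  degrees \<open>d \<ge> 3\<close>, hence the length.\<close>

lemma codim_forms_eq:
  fixes X :: "(nat, 'k::field) mpoly set"
  assumes "finite A" and \<phi>: "\<And>a. a \<in> A \<Longrightarrow> linear_functional (\<phi> a)"
    and X: "\<And>f. f \<in> forms n d \<Longrightarrow> f \<in> X \<longleftrightarrow> (\<forall>a\<in>A. \<phi> a f = 0)"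
    and U: "mpoly.subspace U" "U \<subseteq> forms n 3" "card A \<le> mpoly.dim U"
    and lf: "lf \<in> forms n (d - 3)" "3 \<le> d"
    and lower: "\<And>f. f \<in> U \<Longrightarrow> lf * f \<in> X \<Longrightarrow> f = 0"
  shows "codim_forms n X d = card A"
proof -
  have fin: "finite ((\<lambda>m. single m (1 :: 'k)) ` monomials n e)" for e
    using finite_monomials by blast
  have sp: "forms n e \<subseteq> mpoly.span ((\<lambda>m. single m (1 :: 'k)) ` monomials n e)" for e
    by (simp add: forms_eq_span)
  have K: "vanishing_forms n X d = {f \<in> forms n d. \<forall>a\<in>A. \<phi> a f = 0}"
    using X by (auto simp: vanishing_forms_def)
  have V: "vanishing_forms n X d \<subseteq> forms n d" by (simp add: vanishing_forms_def)
  have 1: "mpoly.dim (forms n d :: (nat, 'k) mpoly set) \<le> mpoly.dim (vanishing_forms n X d) + card A"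
    unfolding K by (rule dim_functional_kernel[OF forms_subspace sp fin assms(1) \<phi>])
  have "mpoly.dim U + mpoly.dim (vanishing_forms n X d) \<le> mpoly.dim (forms n d :: (nat, 'k) mpoly set)"
  proof (rule dim_add_le[OF U(1) subset_trans[OF U(2) sp] fin _ V sp fin, where L = "\<lambda>f. lf * f"])
    show "mpoly.subspace (vanishing_forms n X d)"
      unfolding K using forms_subspace \<phi> by (rule functional_kernel_subspace)
    show "lf * f \<in> forms n d" if "f \<in> U" for f
      using forms_mult[OF lf(1), of f 3] that U(2) lf(2) by auto
  qed (auto simp: distrib_left mpoly_scale_def mult.left_commute vanishing_forms_def intro: lower)
  then show ?thesis using 1 U(3) unfolding codim_forms_def by linarith
qed

lemma scheme_length_eq:
  assumes "\<And>d. d \<ge> 3 \<Longrightarrow> codim_forms n X d = L"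
  shows "scheme_length n X = L"
  unfolding scheme_length_def
proof (rule the_equality)
  show "\<exists>d0. \<forall>d\<ge>d0. codim_forms n X d = L" using assms by blast
  fix l assume "\<exists>d0. \<forall>d\<ge>d0. codim_forms n X d = l"
  then obtain d0 where "\<forall>d\<ge>d0. codim_forms n X d = l" by blast
  then show "l = L" using assms[of "max d0 3"] by simp
qed

lemma linear_functional_eval: "linear_functional (\<lambda>f. mpoly_eval f v)"
  "linear_functional (\<lambda>f. mpoly_eval (pderiv_mpoly j f) v)"
  by (auto simp: linear_functional_def mpoly_eval_add mpoly_eval_scale pderiv_add pderiv_scale)

lemma double_points_form:
  fixes f :: "(nat, 'k::field_char_0) mpoly"
  assumes "f \<in> forms n d" "0 < d" "length ps = k" "\<And>i. i < k \<Longrightarrow> ps ! i = line (u i) \<and> proj_vector n (u i)"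
    and "\<And>i j. i < k \<Longrightarrow> j \<le> n \<Longrightarrow> mpoly_eval (pderiv_mpoly j f) (u i) = 0"
  shows "f \<in> double_points n ps"
proof -
  have "f \<in> double_point n (line (u i))" if i: "i < k" for i
  proof -
    obtain i0 where i0: "i0 \<le> n" "u i i0 \<noteq> 0" using assms(4)[OF i] unfolding proj_vector_def by blast
    have "of_nat d * mpoly_eval f (u i) = 0"
      using euler_form[OF assms(1), of "u i"] assms(5)[OF i] by simp
    then have "mpoly_eval f (u i) = 0" using assms(2) by simp
    moreover have "chart n i0 (u i)" using i0 by unfold_locales
    ultimately show ?thesis using assms(1) assms(5)[OF i] by (intro chart.double_point_of_gradient)
  qed
  then show ?thesis
    using assms(1,3,4) unfolding double_points_def by (auto simp: forms_coord_ring in_set_conv_nth)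
qed

lemma double_points_gradient:
  assumes "lf * f \<in> double_points n ps" "length ps = k" "i < k" "ps ! i = line (u i)" "proj_vector n (u i)"
    "mpoly_eval lf (u i) \<noteq> 0"
  shows "mpoly_eval (pderiv_mpoly j f) (u i) = 0"
proof -
  obtain i0 where i0: "i0 \<le> n" "u i i0 \<noteq> 0" using assms(5) unfolding proj_vector_def by blast
  have "ps ! i \<in> set ps" using assms(2,3) by simp
  then have "lf * f \<in> double_point n (line (u i))" using assms(1,4) unfolding double_points_def by auto
  note g = double_point_gradient[OF this line_self i0]
  have "mpoly_eval f (u i) = 0" using g(1) assms(6) by (simp add: mpoly_eval_mult)
  then show ?thesis using g(2)[of j] assms(6) by (simp add: pderiv_mult mpoly_eval_add mpoly_eval_mult)
qed

text \<open>No local computation of lengths is made. A linear form missing all the points carries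
  the cubics to every higher degree, so the codimension is already constant from degree 3 on and is
  itself the length.\<close>

lemma independent_conditions_of_rigid:
  fixes u :: "nat \<Rightarrow> nat \<Rightarrow> 'k::field_char_0"
  assumes ps: "length ps = k" "\<And>i. i < k \<Longrightarrow> ps ! i = line (u i)"
    and u: "\<And>l. l \<in> {..<k} \<union> S \<Longrightarrow> proj_vector n (u l)"
    and S: "finite S" "S \<inter> {..<k} = {}"
    and rigid: "rigid {..n} {} {..<k} S u"
    and count: "(n + 1) * k + card S = (n + 3) choose n"
  defines "\<eta> \<equiv> simple_points n (u ` S)"
  shows "imposes_independent_conditions n (double_points n ps \<inter> \<eta>) 3"
    "zero_dimensional n \<eta>" "scheme_length n \<eta> = card S" "scheme_support n \<eta> \<inter> set ps = {}"
proof -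
  have kernel: "f = 0" if "f \<in> forms n 3" "\<And>i j. i < k \<Longrightarrow> j \<le> n \<Longrightarrow> mpoly_eval (pderiv_mpoly j f) (u i) = 0"
    "\<And>l. l \<in> S \<Longrightarrow> mpoly_eval f (u l) = 0" for f
  proof (rule tensor_of_eq_0[OF that(1)])
    have "\<forall>l\<in>{..<k}. \<forall>j\<in>{..n}. grad {..n} (tensor_of f) (u l) j = 0"
      using that(2) grad_tensor_of[OF that(1)] by simp
    moreover have "\<forall>l\<in>S. cubic_value {..n} (tensor_of f) (u l) = 0"
      using that(3) cubic_value_tensor_of[OF that(1)] by simp
    ultimately show "vanishes_on {..n} (tensor_of f)"
      using rigid symmetric_tensor_of[of f] unfolding rigid_def by blast
  qed
  define \<phi> :: "(nat \<times> nat) + nat \<Rightarrow> (nat, 'k) mpoly \<Rightarrow> 'k" where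
    "\<phi> a f = (case a of Inl (i, j) \<Rightarrow> mpoly_eval (pderiv_mpoly j f) (u i) | Inr l \<Rightarrow> mpoly_eval f (u l))" for a f
  have \<phi>: "linear_functional (\<phi> a)" for a
    using linear_functional_eval by (cases a) (auto simp: \<phi>_def[abs_def])
  have \<phi>_0: "\<phi> a 0 = 0" for a by (cases a) (auto simp: \<phi>_def)
  define A where "A = ({..<k} \<times> {..n}) <+> S"
  have A: "finite A" "card A = (n + 3) choose n"
    using S(1) count by (simp_all add: A_def card_Plus card_cartesian_product mult.commute)
  have all_A: "(\<forall>a\<in>A. \<phi> a f = 0) \<longleftrightarrow>
      (\<forall>i<k. \<forall>j\<le>n. mpoly_eval (pderiv_mpoly j f) (u i) = 0) \<and> (\<forall>l\<in>S. mpoly_eval f (u l) = 0)" for f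
    unfolding A_def Plus_def ball_Un by (auto simp: \<phi>_def)
  have fin: "finite ((\<lambda>m. single m (1 :: 'k)) ` monomials n 3)"
    using finite_monomials by blast
  have sp: "forms n 3 \<subseteq> mpoly.span ((\<lambda>m. single m (1 :: 'k)) ` monomials n 3)"
    by (simp add: forms_eq_span)
  have dim3: "mpoly.dim (forms n 3 :: (nat, 'k) mpoly set) = (n + 3) choose n"
    using dim_forms[of n 3, where 'k = 'k] binomial_symmetric[of n "n + 3"] by simp
  \<comment> \<open>The functionals in \<open>A\<close> are as many as the dimension of the cubics
    and have only the zero cubic in common, so none can be omitted.\<close>
  have no_redundancy: "card A \<le> card B" if "B \<subseteq> A" "\<And>f. f \<in> forms n 3 \<Longrightarrow> \<forall>a\<in>B. \<phi> a f = 0 \<Longrightarrow> \<forall>a\<in>A. \<phi> a f = 0" for B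
  proof -
    have "finite B" using that(1) A(1) by (rule finite_subset)
    have "{f \<in> forms n 3. \<forall>a\<in>B. \<phi> a f = 0} = {0}"
    proof
      show "{f \<in> forms n 3. \<forall>a\<in>B. \<phi> a f = 0} \<subseteq> {0}"
      proof
        fix f assume f: "f \<in> {f \<in> forms n 3. \<forall>a\<in>B. \<phi> a f = 0}"
        then have "\<forall>a\<in>A. \<phi> a f = 0" using that(2)[of f] by simp
        then show "f \<in> {0}" using kernel[of f] f unfolding all_A by simp
      qed
      show "{0} \<subseteq> {f \<in> forms n 3. \<forall>a\<in>B. \<phi> a f = 0}"
        using \<phi>_0 by simp
    qed
    moreover have "mpoly.dim (forms n 3 :: (nat, 'k) mpoly set) \<le> mpoly.dim {f \<in> forms n 3. \<forall>a\<in>B. \<phi> a f = 0} + card B"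
      by (rule dim_functional_kernel[OF forms_subspace sp fin \<open>finite B\<close> \<phi>])
    moreover have "mpoly.dim {0 :: (nat, 'k) mpoly} = 0"
      using mpoly.dim_le_card[of "{0}" "{}"] by simp
    ultimately show ?thesis using A(2) dim3 by simp
  qed
  have double_iff: "f \<in> double_points n ps \<longleftrightarrow> (\<forall>i<k. \<forall>j\<le>n. mpoly_eval (pderiv_mpoly j f) (u i) = 0)"
    if "f \<in> forms n d" "3 \<le> d" for f d
  proof
    assume "f \<in> double_points n ps"
    then show "\<forall>i<k. \<forall>j\<le>n. mpoly_eval (pderiv_mpoly j f) (u i) = 0"
    proof (intro allI impI)
      fix i j assume i: "i < k"
      then have "proj_vector n (u i)" using u by blast
      then show "mpoly_eval (pderiv_mpoly j f) (u i) = 0"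
        using \<open>f \<in> double_points n ps\<close> by (intro double_points_gradient[of 1 f n ps k i u] ps i) simp_all
    qed
  next
    assume "\<forall>i<k. \<forall>j\<le>n. mpoly_eval (pderiv_mpoly j f) (u i) = 0"
    then have g: "mpoly_eval (pderiv_mpoly j f) (u i) = 0" if "i < k" "j \<le> n" for i j using that by blast
    have "ps ! i = line (u i) \<and> proj_vector n (u i)" if "i < k" for i using ps(2) u that by blast
    then show "f \<in> double_points n ps"
      using that(2) by (intro double_points_form[OF that(1) _ ps(1) _ g]) auto
  qed
  have eta_iff: "f \<in> \<eta> \<longleftrightarrow> (\<forall>l\<in>S. mpoly_eval f (u l) = 0)" if "f \<in> forms n d" for f d
    unfolding \<eta>_def by (simp add: simple_points_form_iff[OF that])
  obtain lf where lf: "lf \<in> forms n 1" "\<And>l. l \<in> {..<k} \<union> S \<Longrightarrow> mpoly_eval lf (u l) \<noteq> 0"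
    by (rule ex_nonvanishing_linear_form[of "u ` ({..<k} \<union> S)" n]) (use S(1) u in auto)
  have lfd: "lf ^ (d - 3) \<in> forms n (d - 3)" for d using forms_power[OF lf(1)] by simp
  have lfS: "mpoly_eval f (u l) = 0" if "lf ^ e * f \<in> \<eta>" "l \<in> S" for f e l
  proof -
    have "mpoly_eval (lf ^ e * f) (u l) = 0"
      using that line_self[of "u l"] unfolding \<eta>_def simple_points_def by blast
    then show ?thesis using lf(2)[of l] that(2) by (simp add: mpoly_eval_mult mpoly_eval_power)
  qed
  have codim_X: "codim_forms n (double_points n ps \<inter> \<eta>) d = card A" if d: "3 \<le> d" for d
  proof (rule codim_forms_eq[OF A(1) \<phi> _ forms_subspace order_refl _ lfd d])
    show "f \<in> double_points n ps \<inter> \<eta> \<longleftrightarrow> (\<forall>a\<in>A. \<phi> a f = 0)" if "f \<in> forms n d" for f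
      using double_iff[OF that d] eta_iff[OF that] all_A by blast
    show "card A \<le> mpoly.dim (forms n 3 :: (nat, 'k) mpoly set)"
      using A(2) dim3 by simp
    show "f = 0" if f: "f \<in> forms n 3" "lf ^ (d - 3) * f \<in> double_points n ps \<inter> \<eta>" for f
    proof (rule kernel[OF f(1)])
      show "mpoly_eval (pderiv_mpoly j f) (u i) = 0" if "i < k" for i j
      proof (rule double_points_gradient[where u = u, OF _ ps(1) that ps(2)[OF that]])
        show "lf ^ (d - 3) * f \<in> double_points n ps" using f(2) by blast
        show "proj_vector n (u i)" using that u by blast
        show "mpoly_eval (lf ^ (d - 3)) (u i) \<noteq> 0" using that lf(2)[of i] by (simp add: mpoly_eval_power)
      qed
      show "mpoly_eval f (u l) = 0" if "l \<in> S" for l using lfS f(2) that by blast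
    qed
  qed
  have "scheme_length n (double_points n ps \<inter> \<eta>) = card A" using codim_X by (rule scheme_length_eq)
  then show "imposes_independent_conditions n (double_points n ps \<inter> \<eta>) 3"
    unfolding imposes_independent_conditions_def using codim_X[of 3] A(2) by simp
  \<comment> \<open>For \<open>\<eta>\<close> alone the embedded cubics are those singular at all
    \<open>k\<close> points: there are enough of them by the count, and one that vanishes on
    \<open>S\<close> is zero by rigidity.\<close>
  define U where "U = {f \<in> forms n 3. \<forall>a\<in>Inl ` ({..<k} \<times> {..n}). \<phi> a f = 0}"
  have U: "mpoly.subspace U" unfolding U_def using forms_subspace \<phi> by (rule functional_kernel_subspace)
  have "mpoly.dim (forms n 3 :: (nat, 'k) mpoly set) \<le> mpoly.dim U + card (Inl ` ({..<k} \<times> {..n}) :: ((nat \<times> nat) + nat) set)"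
    unfolding U_def by (rule dim_functional_kernel[OF forms_subspace sp fin _ \<phi>]) simp
  then have dim_U: "card S \<le> mpoly.dim U"
    using count dim3 by (simp add: card_image card_cartesian_product mult.commute)
  have codim_eta: "codim_forms n \<eta> d = card S" if d: "3 \<le> d" for d
  proof (rule codim_forms_eq[OF S(1) linear_functional_eval(1) _ U _ dim_U lfd d])
    show "f \<in> \<eta> \<longleftrightarrow> (\<forall>l\<in>S. mpoly_eval f (u l) = 0)" if "f \<in> forms n d" for f
      by (rule eta_iff[OF that])
    show "U \<subseteq> forms n 3" by (auto simp: U_def)
    show "f = 0" if f: "f \<in> U" "lf ^ (d - 3) * f \<in> \<eta>" for f
    proof (rule kernel)
      show "f \<in> forms n 3" using f(1) by (simp add: U_def)
      show "mpoly_eval (pderiv_mpoly j f) (u i) = 0" if "i < k" "j \<le> n" for i j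
        using f(1) that by (auto simp: U_def \<phi>_def)
      show "mpoly_eval f (u l) = 0" if "l \<in> S" for l by (rule lfS[OF f(2) that])
    qed
  qed
  then show "scheme_length n \<eta> = card S" by (rule scheme_length_eq)
  have supp: "scheme_support n \<eta> \<subseteq> line ` u ` S"
    unfolding \<eta>_def using S(1) u by (intro support_simple_points) auto
  have "closed_subscheme n \<eta>"
    unfolding \<eta>_def using u by (intro closed_subscheme_simple_points) auto
  moreover have "finite (scheme_support n \<eta>)" using finite_subset[OF supp] S(1) by simp
  ultimately show "zero_dimensional n \<eta>" unfolding zero_dimensional_def by (rule conjI)
  show "scheme_support n \<eta> \<inter> set ps = {}"
  proof (rule ccontr)
    assume "scheme_support n \<eta> \<inter> set ps \<noteq> {}"
    then obtain q where "q \<in> scheme_support n \<eta>" and q2: "q \<in> set ps" by (elim ex_in_conv[THEN iffD2, THEN exE] IntE)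
    then have q: "q \<in> line ` u ` S" "q \<in> set ps" using supp by (auto simp only: subset_iff)
    obtain i where i: "i < k" "q = ps ! i" using q(2) ps(1) by (metis in_set_conv_nth)
    obtain l where l: "l \<in> S" "q = line (u l)" using q(1) by blast
    have li: "l \<in> S" "i < k" "line (u l) = line (u i)" using i l ps(2) by simp_all
    have "u l \<in> line (u i)" using line_self[of "u l"] li(3) by simp
    then obtain b where b: "u l = (\<lambda>j. b * u i j)" unfolding line_def by blast
    \<comment> \<open>If a simple point were one of the double points, vanishing there would follow
      from the gradient by Euler's identity, and its condition would be redundant.\<close>
    have "card A \<le> card (A - {Inr l})"
    proof (rule no_redundancy)
      fix f assume f: "f \<in> forms n 3" "\<forall>a\<in>A - {Inr l}. \<phi> a f = 0"
      have "mpoly_eval (pderiv_mpoly j f) (u i) = 0" if "j \<le> n" for j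
      proof -
        have "Inl (i, j) \<in> A - {Inr l}" using li(2) that by (auto simp: A_def)
        then have "\<phi> (Inl (i, j)) f = 0" using f(2) by blast
        then show ?thesis by (simp add: \<phi>_def)
      qed
      then have "mpoly_eval f (u i) = 0" using euler_form[OF f(1), of "u i"] by simp
      then have "mpoly_eval f (u l) = 0" unfolding b using mpoly_eval_line_form[OF f(1), of b "u i"] by simp
      then have "\<phi> (Inr l) f = 0" by (simp add: \<phi>_def)
      then show "\<forall>a\<in>A. \<phi> a f = 0" using f(2) by blast
    qed auto
    moreover have "Inr l \<in> A" using li(1) by (auto simp: A_def)
    ultimately show False using card_Diff1_less[OF A(1), of "Inr l"] by simp
  qed
qed

section \<open>Openness in the space of collections\<close>

text \<open>Here the multidegree is fixed, whereas \<open>multiforms\<close> only asks for its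
  existence; fixing it makes each piece closed under differences. The zero polynomial lies in every
  piece.\<close>

definition multi_piece :: "nat \<Rightarrow> nat \<Rightarrow> (nat \<Rightarrow> nat) \<Rightarrow> (nat \<times> nat, 'k::field) mpoly set" where
  "multi_piece n k d =
     {f. \<forall>m\<in>keys f. keys m \<subseteq> {..<k} \<times> {..n} \<and> (\<forall>i<k. (\<Sum>j\<le>n. lookup m (i, j)) = d i)}"

lemma multi_piece_multiforms: "f \<in> multi_piece n k d \<Longrightarrow> f \<in> multiforms n k"
  unfolding multi_piece_def multiforms_def by blast

lemma multi_piece_0: "0 \<in> multi_piece n k d"
  by (simp add: multi_piece_def)

lemma multi_piece_single: "keys m \<subseteq> {..<k} \<times> {..n} \<Longrightarrow> (\<And>i. i < k \<Longrightarrow> (\<Sum>j\<le>n. lookup m (i, j)) = d i) \<Longrightarrow>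
    single m c \<in> multi_piece n k d"
  by (auto simp: multi_piece_def)

lemma multi_piece_diff: "f \<in> multi_piece n k d \<Longrightarrow> g \<in> multi_piece n k d \<Longrightarrow> f - g \<in> multi_piece n k d"
  using keys_diff[of f g] unfolding multi_piece_def by blast

lemma multi_piece_mult:
  assumes "f \<in> multi_piece n k d" "g \<in> multi_piece n k e"
  shows "f * g \<in> multi_piece n k (\<lambda>i. d i + e i)"
  unfolding multi_piece_def
proof (intro CollectI ballI)
  fix m assume "m \<in> keys (f * g)"
  then obtain a b where m: "m = a + b" "a \<in> keys f" "b \<in> keys g" using keys_mult[of f g] by blast
  have ab: "keys a \<subseteq> {..<k} \<times> {..n} \<and> (\<forall>i<k. (\<Sum>j\<le>n. lookup a (i, j)) = d i)"
    "keys b \<subseteq> {..<k} \<times> {..n} \<and> (\<forall>i<k. (\<Sum>j\<le>n. lookup b (i, j)) = e i)"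
    using assms m(2,3) unfolding multi_piece_def by blast+
  have "keys m \<subseteq> {..<k} \<times> {..n}" using ab keys_add[of a b] unfolding m(1) by blast
  then show "keys m \<subseteq> {..<k} \<times> {..n} \<and> (\<forall>i<k. (\<Sum>j\<le>n. lookup m (i, j)) = d i + e i)"
    using ab by (simp add: m(1) lookup_add sum.distrib)
qed

text \<open>The vectors with labels in \<open>S\<close> are frozen as constants and only the
  \<open>k\<close> points vary. The product of pivots is then multihomogeneous in their coordinates,
  and its nonvanishing defines the open set.\<close>

lemma open_of_rigid:
  fixes u :: "nat \<Rightarrow> nat \<Rightarrow> 'k::field"
  assumes u: "\<And>l. l < k \<Longrightarrow> proj_vector n (u l)" and S: "S \<inter> {..<k} = {}"
    and rigid: "rigid {..n} {} {..<k} S u"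
    and P: "\<And>ps u'. length ps = k \<Longrightarrow> (\<And>i. i < k \<Longrightarrow> ps ! i = line (u' i) \<and> proj_vector n (u' i)) \<Longrightarrow>
      (\<And>l. l \<in> S \<Longrightarrow> u' l = u l) \<Longrightarrow> rigid {..n} {} {..<k} S u' \<Longrightarrow> P ps"
  shows "general_collection n k P"
proof -
  define L :: "nat \<Rightarrow> nat \<Rightarrow> (nat \<times> nat, 'k) mpoly" where
    "L l a = (if l < k then single (single (l, a) 1) 1 else single 0 (u l a))" for l a
  define ev :: "(nat \<Rightarrow> nat \<Rightarrow> 'k) \<Rightarrow> (nat \<times> nat, 'k) mpoly \<Rightarrow> 'k" where
    "ev w f = mpoly_eval f (\<lambda>(i, j). w i j)" for w f
  define R where "R = rigid_rows {..n} {} {..<k} S L"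
  define H :: "(nat \<times> nat, 'k) mpoly set set" where "H = range (multi_piece n k)"
  define I where "I = {..n} \<times> {..n} \<times> {..n}"
  define glue where "glue w l = (if l < k then w l else u l)" for w l
  have iff: "rigid {..n} {} {..<k} S (glue w) \<longleftrightarrow> trivial_kernel ev R I w" for w
  proof -
    have "(\<lambda>l a. ev w (L l a)) = glue w"
      by (intro ext) (simp add: ev_def L_def glue_def)
    moreover have "rigid {..n} {} {..<k} S (\<lambda>l a. ev w (L l a)) \<longleftrightarrow> trivial_kernel ev R I w"
      unfolding R_def I_def
      by (rule rigid_iff_trivial_kernel) (simp_all add: ev_def mpoly_eval_mult mpoly_eval_diff)
    ultimately show ?thesis by simp
  qed
  have L0: "L l a \<in> multi_piece n k (\<lambda>i. if i = l then 1 else 0)" if "l < k" "a \<le> n" for l a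
  proof -
    have "(\<Sum>j\<le>n. lookup (single (l, a) (1 :: nat)) (i, j)) = (if i = l then 1 else 0)" for i
    proof -
      have "(\<Sum>j\<le>n. lookup (single (l, a) (1 :: nat)) (i, j)) = (\<Sum>j\<le>n. if j = a then (if i = l then 1 else 0) else 0)"
        by (intro sum.cong) (auto simp: lookup_single when_def)
      then show ?thesis using that(2) by simp
    qed
    then show ?thesis using that by (auto simp: L_def intro!: multi_piece_single)
  qed
  have c0: "single 0 c \<in> multi_piece n k (\<lambda>_. 0)" for c :: 'k
    by (rule multi_piece_single) auto
  have one0: "(1 :: (nat \<times> nat, 'k) mpoly) \<in> multi_piece n k (\<lambda>_. 0)" using c0[of 1] by simp
  have LS: "L l a \<in> multi_piece n k (\<lambda>_. 0)" if "l \<in> S" for l a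
    using c0 that S by (auto simp: L_def)
  have LS2: "L l a * L l b * L l d \<in> multi_piece n k (\<lambda>_. 0)" if "l \<in> S" for l a b d
    using multi_piece_mult[OF multi_piece_mult[OF LS[OF that] LS[OF that]] LS[OF that]] by simp
  have mono0: "(monomial_row t t' :: (nat \<times> nat, 'k) mpoly) \<in> multi_piece n k (\<lambda>_. 0)" for t t' :: "nat \<times> nat \<times> nat"
    using one0 multi_piece_0 by (auto simp: monomial_row_def)
  have rowH: "\<exists>A\<in>H. \<forall>i\<in>I. q i \<in> A" if "q \<in> R" for q
  proof -
    from that consider
      (g) l j where "l < k" "j \<le> n" "q = (\<lambda>(a, b, d). if d = j then L l a * L l b else 0)"
      | (c) l where "l \<in> S" "q = (\<lambda>(a, b, d). L l a * L l b * L l d)"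
      | (s) t t' where "q = (\<lambda>x. monomial_row t x - monomial_row t' x)"
      unfolding R_def rigid_rows_def by blast
    then show ?thesis
    proof cases
      case g
      have "\<forall>i\<in>I. q i \<in> multi_piece n k (\<lambda>i. (if i = l then 1 else 0) + (if i = l then 1 else 0))"
        using g multi_piece_mult[OF L0 L0] multi_piece_0 by (auto simp: I_def)
      then show ?thesis unfolding H_def by blast
    next
      case c
      have "\<forall>i\<in>I. q i \<in> multi_piece n k (\<lambda>_. 0)" using c LS2 by auto
      then show ?thesis unfolding H_def by blast
    next
      case s
      have "\<forall>i\<in>I. q i \<in> multi_piece n k (\<lambda>_. 0)" using s mono0 multi_piece_diff by blast
      then show ?thesis unfolding H_def by blast
    qed
  qed
  have "trivial_kernel ev R I u"
  proof -
    have "glue u = u" by (intro ext) (simp add: glue_def)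
    then show ?thesis using iff[of u] rigid by simp
  qed
  have "\<exists>F\<in>\<Union>H. ev u F \<noteq> 0 \<and> (\<forall>w. ev w F \<noteq> 0 \<longrightarrow> trivial_kernel ev R I w)"
  proof (rule trivial_kernel_open[where H = H])
    show "1 \<in> \<Union>H" unfolding H_def using one0 by blast
    show "ev p (a * b) = ev p a * ev p b" "ev p (a - b) = ev p a - ev p b" "ev p 1 = 1" for p a b
      by (simp_all add: ev_def mpoly_eval_mult mpoly_eval_diff)
    show "finite I" by (simp add: I_def)
    show "\<exists>A\<in>H. \<forall>i\<in>I. q i \<in> A" if "q \<in> R" for q by (rule rowH[OF that])
    show "trivial_kernel ev R I u" by fact
    fix A B :: "(nat \<times> nat, 'k) mpoly set" assume "A \<in> H" "B \<in> H"
    then obtain d e where AB: "A = multi_piece n k d" "B = multi_piece n k e" unfolding H_def by blast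
    show "\<exists>C\<in>H. \<forall>a\<in>A. \<forall>a'\<in>A. \<forall>b\<in>B. \<forall>b'\<in>B. a * b \<in> C \<and> a * b - a' * b' \<in> C"
      unfolding AB H_def using multi_piece_mult multi_piece_diff
      by (intro bexI[of _ "multi_piece n k (\<lambda>i. d i + e i)"]) blast+
  qed
  then obtain F where F: "F \<in> multiforms n k" "ev u F \<noteq> 0" "\<And>w. ev w F \<noteq> 0 \<Longrightarrow> trivial_kernel ev R I w"
    unfolding H_def using multi_piece_multiforms by blast
  define U where "U = collections n k - zero_locus n k {F}"
  have "zariski_open n k U" unfolding zariski_open_def U_def using F(1) by blast
  moreover have "map (\<lambda>i. line (u i)) [0..<k] \<in> U"
  proof -
    have "map (\<lambda>i. line (u i)) [0..<k] \<in> collections n k"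
      using u by (auto simp: collections_def proj_space_eq)
    moreover have "\<forall>i<k. u i \<in> map (\<lambda>i. line (u i)) [0..<k] ! i" by (simp add: line_self)
    ultimately show ?thesis using F(2) unfolding U_def zero_locus_def ev_def by blast
  qed
  moreover have "P ps" if "ps \<in> U" for ps
  proof -
    have len: "length ps = k" and sub: "set ps \<subseteq> proj_space n"
      using that by (auto simp: U_def collections_def)
    from that obtain w where w: "\<And>i. i < k \<Longrightarrow> w i \<in> ps ! i" "ev w F \<noteq> 0"
      unfolding U_def zero_locus_def ev_def by blast
    have "\<exists>v. ps ! i = line v \<and> proj_vector n v" if "i < k" for i
    proof -
      have "ps ! i \<in> proj_space n" using sub len that nth_mem[of i ps] by blast
      then show ?thesis unfolding proj_space_eq by blast
    qed
    then obtain v where v: "\<And>i. i < k \<Longrightarrow> ps ! i = line (v i) \<and> proj_vector n (v i)" by metis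
    have rw: "rigid {..n} {} {..<k} S (glue w)" using F(3)[OF w(2)] iff by simp
    \<comment> \<open>The representatives \<open>w\<close> where \<open>F\<close> is nonzero may
      differ from the chosen \<open>v\<close> by scalars. The gradient is quadratic, so the
      conditions at \<open>v\<close> imply those at \<open>w\<close>, and rigidity passes from
      \<open>w\<close> to \<open>v\<close>.\<close>
    have gr: "grad {..n} c (glue w l) j = 0" if "l < k" "grad {..n} c (glue v l) j = 0" for c l j
    proof -
      have "w l \<in> line (v l)" using w(1) v that(1) by metis
      then obtain b where "w l = (\<lambda>a. b * v l a)" unfolding line_def by blast
      then have "grad {..n} c (glue w l) j = b * b * grad {..n} c (glue v l) j"
        using that(1) by (simp add: glue_def grad_def sum_distrib_left mult_ac)
      then show ?thesis using that(2) by simp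
    qed
    have gS: "glue w l = glue v l" if "l \<in> S" for l using that S by (auto simp: glue_def)
    have "rigid {..n} {} {..<k} S (glue v)"
      unfolding rigid_def
    proof (intro allI impI)
      fix c :: "'k tensor"
      assume c: "symmetric_tensor c" "\<forall>l\<in>{..<k}. \<forall>j\<in>{..n}. grad {..n} c (glue v l) j = 0"
        "\<forall>l\<in>S. cubic_value {..n} c (glue v l) = 0"
      have "\<forall>l\<in>{..<k}. \<forall>j\<in>{..n}. grad {..n} c (glue w l) j = 0" using gr c(2) by blast
      moreover have "\<forall>l\<in>S. cubic_value {..n} c (glue w l) = 0" using gS c(3) by simp
      ultimately show "vanishes_on {..n} c"
        using rw c(1) unfolding rigid_def by blast
    qed
    moreover have "glue v l = u l" if "l \<in> S" for l using that S by (auto simp: glue_def)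
    ultimately show "P ps"
      using v by (intro P[of ps "glue v"] len) (auto simp: glue_def)
  qed
  ultimately show ?thesis unfolding general_collection_def by blast
qed

text \<open>The product \<open>(n + 3) * (n + 2)\<close> is divisible by 6 unless \<open>n\<close>
  is 2 modulo 3, when the remainder is 2; multiplied by \<open>(n + 1) / 6\<close>, this remainder
  gives \<open>(n + 1) / 3\<close>.\<close>

lemma num_points_count:
  "(n + 1) * k_num n + (if 3 dvd n + 1 then (n + 1) div 3 else 0) = (n + 3) choose 3"
proof -
  have six: "6 * ((n + 3) choose 3) = (n + 3) * (n + 2) * (n + 1)"
  proof -
    have eqs: "Suc 2 = (3 :: nat)" "Suc (n + 2) = n + 3" "Suc 1 = (2 :: nat)" "Suc (n + 1) = n + 2" by simp_all
    have "6 * ((n + 3) choose 3) = 2 * (3 * ((n + 3) choose 3))" by simp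
    also have "3 * ((n + 3) choose 3) = (n + 3) * ((n + 2) choose 2)"
      using Suc_times_binomial[of 2 "n + 2"] unfolding eqs .
    also have "2 * ((n + 3) * ((n + 2) choose 2)) = (n + 3) * (2 * ((n + 2) choose 2))" by simp
    also have "2 * ((n + 2) choose 2) = (n + 2) * (n + 1)"
      using Suc_times_binomial[of 1 "n + 1"] unfolding eqs by simp
    finally show ?thesis by (simp only: mult.assoc)
  qed
  have cancel: "6 * a = 6 * b \<Longrightarrow> a = b" for a b :: nat by simp
  show ?thesis
  proof (cases "3 dvd n + 1")
    case True
    then obtain q where q: "n + 1 = 3 * q" by (rule dvdE)
    have "even (q * (q + 1))" by simp
    then obtain t where t: "q * (q + 1) = 2 * t" by (rule dvdE)
    have "n + 3 = 3 * q + 2" "n + 2 = 3 * q + 1" using q by linarith+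
    then have "(n + 3) * (n + 2) = (3 * q + 2) * (3 * q + 1)" by (simp only:)
    also have "\<dots> = 9 * (q * (q + 1)) + 2" by (simp add: algebra_simps)
    also have "\<dots> = 3 * t * 6 + 2" unfolding t by simp
    finally have n32: "(n + 3) * (n + 2) = 3 * t * 6 + 2" .
    then have k: "k_num n = 3 * t" by (simp add: k_num_def)
    have "6 * ((n + 1) * k_num n + q) = 6 * ((n + 3) choose 3)"
      unfolding six n32 k q by (simp add: algebra_simps)
    then have "(n + 1) * k_num n + q = (n + 3) choose 3" by (rule cancel)
    moreover have "(n + 1) div 3 = q" using q by simp
    ultimately show ?thesis using True by (simp only: if_True)
  next
    case False
    have "6 dvd (n + 3) * (n + 2)"
    proof -
      have "3 dvd n + 3 \<or> 3 dvd n + 2" using False by presburger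
      then have "3 dvd (n + 3) * (n + 2)" by (elim disjE) (rule dvd_mult2, assumption, rule dvd_mult)
      moreover have "2 dvd (n + 3) * (n + 2)" by simp
      moreover have "coprime (2 :: nat) 3" by simp
      ultimately have "2 * 3 dvd (n + 3) * (n + 2)" by (intro divides_mult)
      then show ?thesis by simp
    qed
    then have "6 * k_num n = (n + 3) * (n + 2)" by (simp add: k_num_def)
    then have "6 * ((n + 1) * k_num n) = 6 * ((n + 3) choose 3)" unfolding six by (simp add: mult_ac)
    then have "(n + 1) * k_num n = (n + 3) choose 3" by (rule cancel)
    then show ?thesis using False by (simp only: if_False add_0_right)
  qed
qed

text \<open>Serves both parts of the theorem: for \<open>delta_num n = 0\<close> the scheme
  \<open>\<eta>\<close> is empty, its ideal is the whole coordinate ring, and intersecting with it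
  changes nothing.\<close>

lemma general_cubic_conditions:
  fixes n :: nat
  assumes "n \<noteq> 4"
  shows "general_collection n (k_num n) (\<lambda>ps :: 'k::field_char_0 point list. \<exists>\<eta> :: (nat, 'k) mpoly set.
     zero_dimensional n \<eta> \<and> scheme_length n \<eta> = delta_num n \<and> scheme_support n \<eta> \<inter> set ps = {} \<and>
     (delta_num n = 0 \<longrightarrow> \<eta> = coord_ring n) \<and>
     imposes_independent_conditions n (double_points n ps \<inter> \<eta>) 3)"
proof -
  define k where "k = k_num n"
  define S where "S = {k..<k + delta_num n}"
  have count: "(n + 1) * k + delta_num n = (n + 3) choose 3"
    and \<delta>: "delta_num n = (if 3 dvd n + 1 then (n + 1) div 3 else 0)"
    using num_points_count[of n] unfolding delta_num_def k_def by simp_all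
  have S: "finite S" "S \<inter> {..<k} = {}" "card S = delta_num n" by (auto simp: S_def)
  have "realizable TYPE('k) {..n} {} {..<k} S (\<lambda>l. {..n})"
    using assms S \<delta> by (intro realizable_cubics) (auto simp: k_def k_num_def algebra_simps)
  then obtain u0 :: "nat \<Rightarrow> nat \<Rightarrow> 'k" where
    u0: "\<And>l a. l \<in> {..<k} \<union> S \<Longrightarrow> n < a \<Longrightarrow> u0 l a = 0" "rigid {..n} {} {..<k} S u0"
    unfolding realizable_def by (metis atMost_iff leD)
  \<comment> \<open>A zero vector represents no point. It imposes no condition, so replacing it by a
    coordinate vector can only strengthen the system.\<close>
  define u where "u l = (if \<exists>i\<le>n. u0 l i \<noteq> 0 then u0 l else (\<lambda>i. if i = 0 then 1 else 0))" for l
  have u: "proj_vector n (u l)" if "l \<in> {..<k} \<union> S" for l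
    using u0(1)[OF that] by (auto simp: u_def proj_vector_def)
  have zero: "grad {..n} c v j = 0" if "\<not> (\<exists>i\<le>n. v i \<noteq> 0)" for c and v :: "nat \<Rightarrow> 'k" and j
    using that by (simp add: grad_def)
  have "grad {..n} c (u0 l) j = 0" if "grad {..n} c (u l) j = 0" for c l j
    using that zero by (cases "\<exists>i\<le>n. u0 l i \<noteq> 0") (auto simp: u_def)
  moreover have "cubic_value {..n} c (u0 l) = 0" if "cubic_value {..n} c (u l) = 0" for c l
    using that zero by (cases "\<exists>i\<le>n. u0 l i \<noteq> 0") (auto simp: u_def cubic_value_def)
  ultimately have rigid: "rigid {..n} {} {..<k} S u"
    using u0(2) unfolding rigid_def by meson
  show ?thesis
    unfolding k_def[symmetric]
  proof (rule open_of_rigid[OF _ S(2) rigid])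
    show "proj_vector n (u l)" if "l < k" for l using u that by simp
    fix ps :: "'k point list" and u'
    assume ps: "length ps = k" "\<And>i. i < k \<Longrightarrow> ps ! i = line (u' i) \<and> proj_vector n (u' i)"
      and u': "\<And>l. l \<in> S \<Longrightarrow> u' l = u l" and rigid': "rigid {..n} {} {..<k} S u'"
    have pv: "proj_vector n (u' l)" if "l \<in> {..<k} \<union> S" for l using that ps(2) u' u by auto
    have count': "(n + 1) * k + card S = (n + 3) choose n"
      using count S(3) binomial_symmetric[of n "n + 3"] by simp
    note main = independent_conditions_of_rigid[OF ps(1) _ pv S(1,2) rigid' count']
    have "simple_points n (u' ` S) = coord_ring n" if "delta_num n = 0"
      using that by (simp add: simple_points_def S_def)
    then show "\<exists>\<eta> :: (nat, 'k) mpoly set.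
     zero_dimensional n \<eta> \<and> scheme_length n \<eta> = delta_num n \<and> scheme_support n \<eta> \<inter> set ps = {} \<and>
     (delta_num n = 0 \<longrightarrow> \<eta> = coord_ring n) \<and>
     imposes_independent_conditions n (double_points n ps \<inter> \<eta>) 3"
      using main ps(2) S(3) by (intro exI[of _ "simple_points n (u' ` S)"]) auto
  qed
qed

theorem theorem5p1:
  fixes n :: nat
  assumes "n \<ge> 1"
  shows "(n mod 3 \<noteq> 2 \<and> n \<noteq> 4 \<longrightarrow>
            general_collection n (k_num n)
              (\<lambda>ps :: 'k::{alg_closed_field, field_char_0} point list.
                 imposes_independent_conditions n (double_points n ps) 3)) \<and>
         ((\<exists>p::nat. n = 3 * p + 2) \<longrightarrow>
            general_collection n (k_num n)
              (\<lambda>ps :: 'k point list.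
                 \<exists>\<eta> :: (nat, 'k) mpoly set.
                   zero_dimensional n \<eta> \<and> scheme_length n \<eta> = delta_num n \<and>
                   scheme_support n \<eta> \<inter> set ps = {} \<and>
                   imposes_independent_conditions n (double_points n ps \<inter> \<eta>) 3))"
proof (intro conjI impI)
  assume n: "n mod 3 \<noteq> 2 \<and> n \<noteq> 4"
  have "\<not> 3 dvd n + 1" using n by presburger
  then have "delta_num n = 0" using num_points_count[of n] by (simp add: delta_num_def)
  moreover have "double_points n ps \<inter> coord_ring n = double_points n ps" for ps :: "'k point list"
    by (auto simp: double_points_def)
  ultimately show "general_collection n (k_num n)
      (\<lambda>ps :: 'k point list. imposes_independent_conditions n (double_points n ps) 3)"
    using general_cubic_conditions[of n, where 'k = 'k] n unfolding general_collection_def by metis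
next
  assume "\<exists>p. n = 3 * p + 2"
  then have "n \<noteq> 4" by presburger
  then show "general_collection n (k_num n)
      (\<lambda>ps :: 'k point list. \<exists>\<eta> :: (nat, 'k) mpoly set.
         zero_dimensional n \<eta> \<and> scheme_length n \<eta> = delta_num n \<and>
         scheme_support n \<eta> \<inter> set ps = {} \<and>
         imposes_independent_conditions n (double_points n ps \<inter> \<eta>) 3)"
    using general_cubic_conditions[of n, where 'k = 'k] unfolding general_collection_def by blast
qed

end
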